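(* Under the standing assumptions on $\Omega,p,\Psi$ listed in the context, let $\lambda>0$ and let $g\in L^\infty(\Omega)$ satisfy $0\le g\le\lambda$ a.e. on $\Omega$. For $\varepsilon\in\mathbb R$ define $\mathcal J_{\lambda,\varepsilon}:W^{1,p(x)}(\Omega)\to\mathbb R$ by $$\mathcal J_{\lambda,\varepsilon}(V)=\int_\Omega A(x,\nabla V)\,dx+\frac\lambda2\int_\Omega V^2\,dx+\varepsilon\int_\Omega\frac{|V|^{p(x)}}{p(x)}\,dx-\int_\Omega gV\,dx,$$ and put $\mathcal J_\lambda=\mathcal J_{\lambda,0}$. Let $V\in W^{1,p(x)}(\Omega)$ and $(V_n)_{n\ge1}\subset W^{1,p(x)}(\Omega)$ be such that $V_n\to V$ in $W^{1,p(x)}(\Omega)$. Then for every sequence of real numbers $(\varepsilon_n)_{n\ge1}$ converging to $0$, $$\lim_{n\to\infty}\mathcal J_{\lambda,\varepsilon_n}(V_n)=\mathcal J_\lambda(V).$$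
   Context: Variable exponent spaces: for a measurable bounded $q:\Omega\to[1,\infty)$, $L^{q(x)}(\Omega)$ is the space of measurable $u:\Omega\to\mathbb R$ with $\int_\Omega|u(x)|^{q(x)}dx<\infty$, with the Luxemburg norm $\inf\{t>0:\int_\Omega|u(x)/t|^{q(x)}dx\le1\}$; $W^{1,q(x)}(\Omega)=\{u\in L^{q(x)}(\Omega): |\nabla u|\in L^{q(x)}(\Omega)\}$ (weak gradient) with norm $\|u\|_{L^{q(x)}(\Omega)}+\||\nabla u|\|_{L^{q(x)}(\Omega)}$. Standing assumptions. - $\Omega\subset\mathbb R^N$, $N\ge2$, is an open, bounded, connected Lipschitz domain. - $p:\overline\Omega\to(1,\infty)$ is either log-Hölder continuous (there is $C>0$ with $|p(x)-p(y)|\le C/(-\log|x-y|)$ whenever $0<|x-y|<1/2$) with $p^-:=\min_{\overline\Omega}p\ge\frac{2N}{N+2}$, or continuous with $p^->\frac{2N}{N+2}$. Put $p'(x)=\frac{p(x)}{p(x)-1}$. (In both cases $W^{1,p(x)}(\Omega)$ embeds continuously in $L^2(\Omega)$.) - $\Psi:\overline\Omega\times(0,\infty)\to(0,\infty)$; $\Psi(\cdot,s)$ is measurable for each $s>0$; $\Psi(x,\cdot)$ is locally absolutely continuous on $(0,\infty)$ for a.a. $x\in\Omega$; $\lim_{s\to0^+}\Psi(x,s)s=0$ for each $x\in\Omega$; for a.a. $x\in\Omega$ the function $(0,\infty)\ni s\mapsto\Psi(x,s)s$ is strictly increasing. - $\Phi:\overline\Omega\times\mathbb R\to[0,\infty)$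 is $\Phi(x,s)=\Psi(x,|s|)|s|$ for $s\neq0$, $\Phi(x,0)=0$; $A(x,\xi)=\int_0^{|\xi|}\Phi(x,s)\,ds$ for $\xi\in\mathbb R^N$. - For every $v\in L^{p(x)}(\Omega)$ one has $\Phi(\cdot,v(\cdot))\in L^{p'(x)}(\Omega)$. - There are constants $\delta>0$, $\tilde\delta\ge0$ with $\int_\Omega A(x,\nabla v)\,dx\ge\delta\int_\Omega|\nabla v|^{p(x)}dx-\tilde\delta$ for all $v\in W^{1,p(x)}(\Omega)$. *)

theory Defs
  imports "HOL-Analysis.Analysis"
begin

text \<open>The last coordinate direction of the local coordinate system is the unit vector \<open>e\<close>;
  the other coordinates of \<open>x\<close> are represented by the projection of \<open>x\<close> to the hyperplane
  orthogonal to \<open>e\<close>. Near \<open>z\<close> the set lies strictly above the graph of \<open>\<gamma>\<close>.\<close>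

definition lipschitz_boundary :: "(real ^ 'n) set \<Rightarrow> bool" where
  "lipschitz_boundary \<Omega> \<longleftrightarrow>
    (\<forall>z\<in>frontier \<Omega>. \<exists>r>0. \<exists>e. \<exists>L. \<exists>\<gamma> :: real ^ 'n \<Rightarrow> real.
        norm e = 1 \<and> L-lipschitz_on {y. y \<bullet> e = 0} \<gamma> \<and>
        \<Omega> \<inter> ball z r = {x \<in> ball z r. \<gamma> (x - (x \<bullet> e) *\<^sub>R e) < x \<bullet> e})"

definition bounded_lipschitz_domain :: "(real ^ 'n) set \<Rightarrow> bool" where
  "bounded_lipschitz_domain \<Omega> \<longleftrightarrow>
    \<Omega> \<noteq> {} \<and> open \<Omega> \<and> bounded \<Omega> \<and> connected \<Omega> \<and> lipschitz_boundary \<Omega>"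

definition log_hoelder_on :: "(real ^ 'n) set \<Rightarrow> (real ^ 'n \<Rightarrow> real) \<Rightarrow> bool" where
  "log_hoelder_on S p \<longleftrightarrow>
    (\<exists>C>0. \<forall>x\<in>S. \<forall>y\<in>S. 0 < norm (x - y) \<and> norm (x - y) < 1/2 \<longrightarrow>
        \<bar>p x - p y\<bar> \<le> C / (- ln (norm (x - y))))"

definition locally_abs_continuous_pos :: "(real \<Rightarrow> real) \<Rightarrow> bool" where
  "locally_abs_continuous_pos f \<longleftrightarrow>
    (\<forall>a b. 0 < a \<and> a \<le> b \<longrightarrow>
      (\<forall>\<epsilon>>0. \<exists>\<delta>>0. \<forall>D :: (real \<times> real) set.
         finite D \<and> (\<forall>(c, d)\<in>D. a \<le> c \<and> c \<le> d \<and> d \<le> b) \<and>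
         disjoint_family_on (\<lambda>(c, d). {c<..<d}) D \<and> (\<Sum>(c, d)\<in>D. d - c) < \<delta>
         \<longrightarrow> (\<Sum>(c, d)\<in>D. \<bar>f d - f c\<bar>) < \<epsilon>))"


definition Linfty :: "(real ^ 'n) set \<Rightarrow> (real ^ 'n \<Rightarrow> real) set" where
  "Linfty \<Omega> = {g \<in> borel_measurable (lebesgue_on \<Omega>). \<exists>M. AE x in lebesgue_on \<Omega>. \<bar>g x\<bar> \<le> M}"

text \<open>Elements of the function spaces are represented by functions on the whole space whose
  values outside \<open>\<Omega>\<close> are irrelevant; functions equal almost everywhere on \<open>\<Omega>\<close> are not
  identified.\<close>

definition Lvar :: "(real ^ 'n) set \<Rightarrow> (real ^ 'n \<Rightarrow> real) \<Rightarrow> (real ^ 'n \<Rightarrow> real) set" where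
  "Lvar \<Omega> q = {u \<in> borel_measurable (lebesgue_on \<Omega>).
     (\<integral>\<^sup>+x. ennreal (\<bar>u x\<bar> powr q x) \<partial>lebesgue_on \<Omega>) < \<infinity>}"

definition Lvar_norm :: "(real ^ 'n) set \<Rightarrow> (real ^ 'n \<Rightarrow> real) \<Rightarrow> (real ^ 'n \<Rightarrow> real) \<Rightarrow> real" where
  "Lvar_norm \<Omega> q u =
     Inf {t. t > 0 \<and> (\<integral>\<^sup>+x. ennreal (\<bar>u x / t\<bar> powr q x) \<partial>lebesgue_on \<Omega>) \<le> 1}"


definition partial_deriv :: "'n \<Rightarrow> (real ^ 'n \<Rightarrow> real) \<Rightarrow> real ^ 'n \<Rightarrow> real" where
  "partial_deriv i f x = frechet_derivative f (at x) (axis i 1)"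

primrec Ck :: "nat \<Rightarrow> (real ^ 'n \<Rightarrow> real) \<Rightarrow> bool" where
  "Ck 0 f \<longleftrightarrow> continuous_on UNIV f"
| "Ck (Suc k) f \<longleftrightarrow> (\<forall>x. f differentiable (at x)) \<and> (\<forall>i. Ck k (partial_deriv i f))"

definition test_functions :: "(real ^ 'n) set \<Rightarrow> (real ^ 'n \<Rightarrow> real) set" where
  "test_functions \<Omega> = {\<phi>. (\<forall>k. Ck k \<phi>) \<and>
     compact (closure {x. \<phi> x \<noteq> 0}) \<and> closure {x. \<phi> x \<noteq> 0} \<subseteq> \<Omega>}"

definition is_weak_gradient ::
  "(real ^ 'n) set \<Rightarrow> (real ^ 'n \<Rightarrow> real) \<Rightarrow> (real ^ 'n \<Rightarrow> real ^ 'n) \<Rightarrow> bool" where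
  "is_weak_gradient \<Omega> u G \<longleftrightarrow>
     u \<in> borel_measurable (lebesgue_on \<Omega>) \<and> G \<in> borel_measurable (lebesgue_on \<Omega>) \<and>
     (\<forall>K. compact K \<and> K \<subseteq> \<Omega> \<longrightarrow>
        integrable (lebesgue_on K) u \<and> integrable (lebesgue_on K) G) \<and>
     (\<forall>\<phi>\<in>test_functions \<Omega>. \<forall>i.
        (LINT x|lebesgue_on \<Omega>. u x * partial_deriv i \<phi> x) =
        - (LINT x|lebesgue_on \<Omega>. G x $ i * \<phi> x))"

text \<open>The weak gradient is unique only up to equality almost everywhere on \<open>\<Omega>\<close>;
  \<open>wgrad\<close> chooses one representative.\<close>

definition wgrad :: "(real ^ 'n) set \<Rightarrow> (real ^ 'n \<Rightarrow> real) \<Rightarrow> real ^ 'n \<Rightarrow> real ^ 'n" where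
  "wgrad \<Omega> u = (SOME G. is_weak_gradient \<Omega> u G)"

definition W1var :: "(real ^ 'n) set \<Rightarrow> (real ^ 'n \<Rightarrow> real) \<Rightarrow> (real ^ 'n \<Rightarrow> real) set" where
  "W1var \<Omega> q = {u \<in> Lvar \<Omega> q. (\<exists>G. is_weak_gradient \<Omega> u G) \<and>
     (\<lambda>x. norm (wgrad \<Omega> u x)) \<in> Lvar \<Omega> q}"

definition W1var_norm :: "(real ^ 'n) set \<Rightarrow> (real ^ 'n \<Rightarrow> real) \<Rightarrow> (real ^ 'n \<Rightarrow> real) \<Rightarrow> real" where
  "W1var_norm \<Omega> q u = Lvar_norm \<Omega> q u + Lvar_norm \<Omega> q (\<lambda>x. norm (wgrad \<Omega> u x))"


definition Phi :: "(real ^ 'n \<Rightarrow> real \<Rightarrow> real) \<Rightarrow> real ^ 'n \<Rightarrow> real \<Rightarrow> real" where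
  "Phi \<Psi> x s = (if s = 0 then 0 else \<Psi> x \<bar>s\<bar> * \<bar>s\<bar>)"

definition A_fun :: "(real ^ 'n \<Rightarrow> real \<Rightarrow> real) \<Rightarrow> real ^ 'n \<Rightarrow> real ^ 'n \<Rightarrow> real" where
  "A_fun \<Psi> x \<xi> = (LINT s:{0..norm \<xi>}|lborel. Phi \<Psi> x s)"

definition J_fun ::
  "(real ^ 'n) set \<Rightarrow> (real ^ 'n \<Rightarrow> real) \<Rightarrow> (real ^ 'n \<Rightarrow> real \<Rightarrow> real) \<Rightarrow> (real ^ 'n \<Rightarrow> real)
    \<Rightarrow> real \<Rightarrow> real \<Rightarrow> (real ^ 'n \<Rightarrow> real) \<Rightarrow> real" where
  "J_fun \<Omega> p \<Psi> g lam \<epsilon> V =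
     (LINT x|lebesgue_on \<Omega>. A_fun \<Psi> x (wgrad \<Omega> V x))
     + lam / 2 * (LINT x|lebesgue_on \<Omega>. (V x)\<^sup>2)
     + \<epsilon> * (LINT x|lebesgue_on \<Omega>. \<bar>V x\<bar> powr p x / p x)
     - (LINT x|lebesgue_on \<Omega>. g x * V x)"

end

theory Submission
  imports Defs
begin

text \<open>
  Norm convergence in \<open>L\<^sup>p\<^sup>(\<^sup>x\<^sup>)\<close> is used only through modular convergence. For the gradient term, a
  subsequence of \<open>|\<nabla>V\<^sub>n - \<nabla>V|\<close> has summable modulars, so \<open>|\<nabla>V\<^sub>n|\<close> is dominated by
  \<open>h = |\<nabla>V| + (\<Sum> |\<nabla>V\<^sub>n - \<nabla>V|\<^sup>p)\<^sup>1\<^sup>/\<^sup>p\<close>, and \<open>A(x, \<nabla>V\<^sub>n) \<le> h \<Phi>(x, h) \<le> h\<^sup>p + \<Phi>(x, h)\<^sup>p\<^sup>'\<close>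
  is an integrable bound for dominated convergence. The quadratic and the linear term need the
  embedding of \<open>W\<^sup>1\<^sup>,\<^sup>r\<close> with \<open>r = 2N/(N+2)\<close> into \<open>L\<^sup>2\<close>. It is proved by Gagliardo's argument
  directly on the Lipschitz domain, without extension or mollification: near each boundary point there
  are \<open>N\<close> linearly independent directions in which short segments stay inside the domain; along almost
  every such segment the function is the integral of its weak gradient, which bounds a power of the
  function by integrals over lines in each of the \<open>N\<close> directions; the Loomis-Whitney inequality
  and Hoelder's inequality then give the critical exponent. Truncating the function at height \<open>M\<close>
  keeps the quantities finite, so that they can be absorbed.
\<close>

section \<open>Smooth bump functions and the fundamental lemma of the calculus of variations\<close>

text \<open>The exponent \<open>2N/(N+2)\<close> is the one whose Sobolev conjugate is 2, and
  \<open>p\<close> may attain it, so the embedding is needed at its critical exponent. As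
  \<open>\<Omega>\<close> is bounded and \<open>p\<close> is at least \<open>2N/(N+2)\<close>, one
  embedding with that constant exponent serves every \<open>p\<close>. Gagliardo's argument is an
  \<open>L^1\<close> estimate; it is applied to the power \<open>1 + \<beta>\<close> of the function
  with \<open>\<beta> = (N-2)/N\<close>, because \<open>(1 + \<beta>) N/(N-1) = 2\<close>. The
  square integral then reappears on the right with an exponent below 1, and dividing by it is
  legitimate only if it is known to be finite. Two obstacles come from the representation of the
  data. \<open>wgrad\<close> picks an arbitrary weak gradient, so the gradient of a difference has
  to be compared with the difference of the gradients; this needs uniqueness almost everywhere,
  hence the fundamental lemma. And \<open>\<Phi>\<close> is not assumed to be jointly measurable:
  measurability of \<open>A(x, \<nabla>V)\<close> is drawn from the growth hypothesis, which makes
  \<open>\<Phi>(x, v(x))\<close> measurable for every admissible \<open>v\<close>, through Riemann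
  sums.\<close>

lemma Ck_imp_continuous: "Ck k f \<Longrightarrow> continuous_on UNIV f"
  by (cases k) (auto intro!: differentiable_imp_continuous_on simp: differentiable_on_def
      differentiable_at_withinI)

lemma Ck_SucD: "Ck (Suc k) f \<Longrightarrow> Ck k f"
proof (induction k arbitrary: f)
  case 0
  then show ?case using Ck_imp_continuous[of "Suc 0" f] by simp
next
  case (Suc k)
  then show ?case by (metis Ck.simps(2))
qed

lemma partial_derivI:
  assumes "(f has_derivative f') (at x)"
  shows "partial_deriv i f x = f' (axis i 1)"
  unfolding partial_deriv_def using frechet_derivative_at[OF assms] by simp

lemma partial_deriv_has_derivative:
  assumes "f differentiable (at x)"
  shows "(f has_derivative frechet_derivative f (at x)) (at x)"
  using assms frechet_derivative_works by blast

lemma Ck_const: "Ck k (\<lambda>x::real^'n. c)"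
proof (induction k arbitrary: c)
  case (Suc k)
  have "partial_deriv i (\<lambda>x::real^'n. c) = (\<lambda>x. 0)" for i
    by (rule ext, subst partial_derivI[where f'="\<lambda>_. 0"]) auto
  then show ?case using Suc by simp
qed simp

lemma Ck_add:
  fixes f g :: "real^'n \<Rightarrow> real"
  shows "Ck k f \<Longrightarrow> Ck k g \<Longrightarrow> Ck k (\<lambda>x. f x + g x)"
proof (induction k arbitrary: f g)
  case 0 then show ?case by (simp add: continuous_on_add)
next
  case (Suc k)
  have "partial_deriv i (\<lambda>x. f x + g x) = (\<lambda>x. partial_deriv i f x + partial_deriv i g x)" for i
  proof
    fix x
    have "((\<lambda>x. f x + g x) has_derivative
       (\<lambda>h. frechet_derivative f (at x) h + frechet_derivative g (at x) h)) (at x)"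
      using Suc.prems by (intro has_derivative_add partial_deriv_has_derivative) auto
    from partial_derivI[OF this] show "partial_deriv i (\<lambda>x. f x + g x) x
        = partial_deriv i f x + partial_deriv i g x"
      by (simp add: partial_deriv_def)
  qed
  then show ?case using Suc by (auto intro: differentiable_add)
qed

lemma Ck_mult:
  fixes f g :: "real^'n \<Rightarrow> real"
  shows "Ck k f \<Longrightarrow> Ck k g \<Longrightarrow> Ck k (\<lambda>x. f x * g x)"
proof (induction k arbitrary: f g)
  case 0 then show ?case by (simp add: continuous_on_mult)
next
  case (Suc k)
  have "partial_deriv i (\<lambda>x. f x * g x) = (\<lambda>x. f x * partial_deriv i g x + partial_deriv i f x * g x)" for i
  proof
    fix x
    have "((\<lambda>x. f x * g x) has_derivative
       (\<lambda>h. f x * frechet_derivative g (at x) h + frechet_derivative f (at x) h * g x)) (at x)"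
      using Suc.prems by (intro has_derivative_mult partial_deriv_has_derivative) auto
    from partial_derivI[OF this] show "partial_deriv i (\<lambda>x. f x * g x) x
        = f x * partial_deriv i g x + partial_deriv i f x * g x"
      by (simp add: partial_deriv_def)
  qed
  moreover have "Ck k f" "Ck k g" using Suc.prems Ck_SucD by blast+
  ultimately show ?case using Suc by (auto intro!: differentiable_mult Ck_add)
qed

lemma Ck_prod:
  fixes f :: "'i \<Rightarrow> real^'n \<Rightarrow> real"
  assumes "\<And>i. i \<in> I \<Longrightarrow> Ck k (f i)"
  shows "Ck k (\<lambda>x. \<Prod>i\<in>I. f i x)"
  using assms by (induction I rule: infinite_finite_induct) (auto intro: Ck_const Ck_mult)

text \<open>Dividing by \<open>t ^ k\<close> makes the family closed under differentiation up to
  linear combinations, so smoothness of the classical function \<open>exp (- c / t)\<close> needs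
  one induction. The parameter \<open>c\<close> is kept because letting it tend to 0 turns bumps
  into indicator functions.\<close>

definition flat :: "nat \<Rightarrow> real \<Rightarrow> real \<Rightarrow> real" where
  "flat k c t = (if t > 0 then exp (- c / t) / t ^ k else 0)"

text \<open>Substituting \<open>y = 1 / t\<close> turns the claim into the decay of
  \<open>y ^ k / exp (c * y)\<close> at infinity; to the left of 0 the function vanishes
  identically.\<close>

lemma flat_tendsto_0:
  assumes "c > 0"
  shows "(flat k c \<longlongrightarrow> 0) (at 0)"
proof -
  have "((\<lambda>y. (c * y) ^ k / exp (c * y)) \<longlongrightarrow> 0) at_top"
    by (rule filterlim_compose[OF tendsto_power_div_exp_0])
       (use assms filterlim_tendsto_pos_mult_at_top[OF tendsto_const assms filterlim_ident] in simp)
  from tendsto_mult[OF tendsto_const this, of "1 / c ^ k"]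
  have "((\<lambda>y. y ^ k / exp (c * y)) \<longlongrightarrow> 0) at_top"
    using assms by (simp add: power_mult_distrib)
  from filterlim_compose[OF this filterlim_inverse_at_top_right]
  have "((\<lambda>t. inverse t ^ k / exp (c * inverse t)) \<longlongrightarrow> 0) (at_right 0)" .
  then have r: "(flat k c \<longlongrightarrow> 0) (at_right 0)"
    by (rule Lim_transform_eventually)
       (rule eventually_mono[OF eventually_at_right_less],
         simp add: flat_def exp_minus divide_inverse power_inverse)
  have l: "(flat k c \<longlongrightarrow> 0) (at_left 0)"
    by (rule Lim_transform_eventually[OF tendsto_const])
       (rule eventually_at_leftI[of "-1"], auto simp: flat_def)
  from l r show ?thesis by (simp add: filterlim_split_at_real)
qed

lemma flat_has_real_derivative:
  assumes "c > 0"
  shows "(flat k c has_real_derivative (c * flat (k+2) c t - k * flat (k+1) c t)) (at t)"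
proof -
  consider "t < 0" | "t = 0" | "t > 0" by linarith
  then show ?thesis
  proof cases
    case 1
    have "((\<lambda>_. 0) has_real_derivative 0) (at t)" by simp
    then have "(flat k c has_real_derivative 0) (at t)"
      by (rule has_field_derivative_transform_within_open[of _ _ _ "{..<0}"])
         (use 1 in \<open>auto simp: flat_def\<close>)
    then show ?thesis using 1 by (simp add: flat_def)
  next
    case 2
    \<comment> \<open>The difference quotient at 0 is the next member of the family, whose limit is
      known.\<close>
    have "(flat k c y - flat k c 0) / (y - 0) = flat (k+1) c y" for y
      by (simp add: flat_def)
    then have "(flat k c has_real_derivative 0) (at 0)"
      using flat_tendsto_0[OF assms, of "k+1"] unfolding has_field_derivative_iff by simp
    then show ?thesis using 2 by (simp add: flat_def)
  next
    case 3
    have "((\<lambda>t. exp (- c / t) / t ^ k) has_real_derivative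
       (exp (- c / t) * (c / t^2) * t ^ k - exp (- c / t) * (k * t ^ (k - 1))) / (t^k * t^k)) (at t)"
      using 3 by (auto intro!: derivative_eq_intros simp: power2_eq_square)
    moreover have "(exp (- c / t) * (c / t^2) * t ^ k - exp (- c / t) * (k * t ^ (k - 1))) / (t^k * t^k)
      = c * flat (k+2) c t - k * flat (k+1) c t"
      using 3 by (cases k) (auto simp: flat_def field_simps power2_eq_square)
    ultimately have "((\<lambda>t. exp (- c / t) / t ^ k) has_real_derivative (c * flat (k+2) c t - k * flat (k+1) c t)) (at t)"
      by simp
    then show ?thesis
      by (rule has_field_derivative_transform_within_open[of _ _ _ "{0<..}"])
         (use 3 in \<open>auto simp: flat_def\<close>)
  qed
qed

text \<open>The induction runs over all \<open>k\<close> because one derivative raises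
  \<open>k\<close> by 1 and by 2. The affine argument covers both factors of a bump:
  \<open>s = 1\<close> for the lower faces and \<open>s = -1\<close> for the upper ones.\<close>

lemma Ck_flat_coordinate:
  fixes i :: "'n::finite"
  assumes "c > 0"
  shows "Ck m (\<lambda>x. flat k c (s * x $ i + t))"
proof (induction m arbitrary: k)
  case 0
  have "continuous_on UNIV (flat k c)"
    using flat_has_real_derivative[OF assms] by (intro continuous_at_imp_continuous_on ballI DERIV_isCont)
  from continuous_on_compose2[OF this, of UNIV "\<lambda>x. s * x $ i + t"] show ?case
    by (simp add: continuous_intros)
next
  case (Suc m)
  let ?d = "\<lambda>y. c * flat (k+2) c y - k * flat (k+1) c y"
  have d: "((\<lambda>x::real^'n. flat k c (s * x $ i + t)) has_derivative (\<lambda>h. ?d (s * x $ i + t) * (s * h $ i))) (at x)" for x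
  proof -
    have "((\<lambda>x::real^'n. s * x $ i + t) has_derivative (\<lambda>h. s * h $ i)) (at x)"
      by (auto intro!: derivative_eq_intros bounded_linear_imp_has_derivative[OF bounded_linear_vec_nth])
    from has_derivative_compose[OF this flat_has_real_derivative[OF assms, of k, THEN has_field_derivative_imp_has_derivative]]
    show ?thesis by (simp add: mult.commute)
  qed
  have "partial_deriv j (\<lambda>x. flat k c (s * x $ i + t)) =
     (\<lambda>x. (c * s * axis j 1 $ i) * flat (k+2) c (s * x $ i + t)
         + (- k * s * axis j 1 $ i) * flat (k+1) c (s * x $ i + t))" for j
    by (rule ext, subst partial_derivI[OF d]) (simp add: algebra_simps)
  moreover have "Ck m (\<lambda>x. (c * s * axis j 1 $ i) * flat (k+2) c (s * x $ i + t)
         + (- k * s * axis j 1 $ i) * flat (k+1) c (s * x $ i + t))" for j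
    by (intro Ck_add Ck_mult Ck_const Suc)
  ultimately show ?case using d unfolding Ck.simps differentiable_def by auto
qed

text \<open>Each pair of factors is positive exactly between two opposite faces, so the product is
  positive exactly on \<open>box a b\<close>. Boxes are convenient supports: they generate the Borel
  sets and translations map them to boxes.\<close>

definition bump :: "real \<Rightarrow> real^'n \<Rightarrow> real^'n \<Rightarrow> real^'n \<Rightarrow> real" where
  "bump c a b x = (\<Prod>i\<in>UNIV. flat 0 c (x $ i - a $ i) * flat 0 c (b $ i - x $ i))"

lemma Ck_bump: "c > 0 \<Longrightarrow> Ck k (bump c a b)"
  unfolding bump_def[abs_def]
  using Ck_flat_coordinate[of c k 0 1 _ "- a $ _"] Ck_flat_coordinate[of c k 0 "-1" _ "b $ _"]
  by (intro Ck_prod Ck_mult) auto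

lemma bump_nonneg: "0 \<le> bump c a b x"
  unfolding bump_def by (intro prod_nonneg) (simp add: flat_def)

lemma bump_le_1: "c > 0 \<Longrightarrow> bump c a b x \<le> 1"
  unfolding bump_def by (intro prod_le_1 conjI mult_le_one) (auto simp: flat_def)

lemma bump_eq_0_iff: "bump c a b x = 0 \<longleftrightarrow> x \<notin> box a b"
  by (auto simp: bump_def flat_def mem_box_cart)

lemma closure_bump: "closure {x. bump c a b x \<noteq> 0} \<subseteq> cbox a b"
  by (rule closure_minimal) (use box_subset_cbox in \<open>auto simp: bump_eq_0_iff\<close>)

lemma bump_in_test_functions:
  assumes "c > 0" "cbox a b \<subseteq> \<Omega>"
  shows "bump c a b \<in> test_functions \<Omega>"
proof -
  have "compact (cbox a b \<inter> closure {x. bump c a b x \<noteq> 0})" 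
    by (intro compact_Int_closed) auto
  moreover have "cbox a b \<inter> closure {x. bump c a b x \<noteq> 0} = closure {x. bump c a b x \<noteq> 0}"
    using closure_bump by blast
  ultimately show ?thesis
    using assms closure_bump[of c a b] Ck_bump[of c _ a b] by (auto simp: test_functions_def)
qed

lemma bump_translate: "bump c a b (x - v) = bump c (a + v) (b + v) x"
  by (simp add: bump_def algebra_simps)

lemma bump_tendsto_indicator:
  fixes a b x :: "real^'n"
  shows
  "(\<lambda>n. bump (1 / real (Suc n)) a b x) \<longlonglongrightarrow> indicator (box a b) x"
proof (cases "x \<in> box a b")
  case True
  have 0: "(\<lambda>n. 1 / real (Suc n)) \<longlonglongrightarrow> 0" by (rule LIMSEQ_Suc[OF lim_1_over_n])
  have f: "(\<lambda>n. flat 0 (1 / real (Suc n)) t) \<longlonglongrightarrow> 1" if "t > 0" for t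
  proof -
    have "(\<lambda>n. exp (- (1 / real (Suc n)) / t)) \<longlonglongrightarrow> exp (- 0 / t)"
      by (intro tendsto_intros 0) (use that in auto)
    then show ?thesis using that by (simp add: flat_def)
  qed
  have "(\<lambda>n. bump (1 / real (Suc n)) a b x) \<longlonglongrightarrow> (\<Prod>i\<in>(UNIV::'n set). 1 * 1)"
    unfolding bump_def by (rule tendsto_prod, rule tendsto_mult[OF f f]) (use True in \<open>auto simp: mem_box_cart\<close>)
  then show ?thesis using True by simp
next
  case False
  then have "bump c a b x = 0" for c by (simp add: bump_eq_0_iff)
  then show ?thesis using False by simp
qed

lemma borel_measurable_bump[measurable]: "c > 0 \<Longrightarrow> bump c a b \<in> borel_measurable borel"
  using Ck_bump[of c 0 a b] by (auto intro: borel_measurable_continuous_onI)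

text \<open>The positive and the negative part are viewed as densities of two finite measures. These
  agree on boxes, a generator closed under intersection, hence everywhere, and finite measures
  determine their densities almost everywhere.\<close>

lemma AE_zero_if_box_integrals_zero:
  fixes f :: "'a::euclidean_space \<Rightarrow> real"
  assumes f: "integrable lborel f"
    and 0: "\<And>a b. (LINT x|lborel. f x * indicator (box a b) x) = 0"
  shows "AE x in lborel. f x = 0"
proof -
  have [measurable]: "f \<in> borel_measurable borel" using f by auto
  let ?p = "\<lambda>x. ennreal (f x)" and ?m = "\<lambda>x. ennreal (- f x)"
  have fin: "(\<integral>\<^sup>+x. ?p x \<partial>lborel) < \<infinity>" "(\<integral>\<^sup>+x. ?m x \<partial>lborel) < \<infinity>"
    using f by (auto simp: real_integrable_def less_top)
  have "density lborel ?p = density lborel ?m"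
  proof (rule measure_eqI_generator_eq[where E="range (\<lambda>(a, b). box a b::'a set)" and \<Omega>=UNIV
        and A="\<lambda>n. box (- (real n *\<^sub>R One)) (real n *\<^sub>R One)"])
    show "Int_stable (range (\<lambda>(a, b). box a b::'a set))"
      by (auto simp: Int_stable_def box_Int_box)
    show "range (\<lambda>n. box (- (real n *\<^sub>R One)) (real n *\<^sub>R One)) \<subseteq> range (\<lambda>(a, b). box a b::'a set)"
      by auto
    show "(\<Union>n. box (- (real n *\<^sub>R One)) (real n *\<^sub>R One)) = (UNIV::'a set)"
      using UN_box_eq_UNIV by auto
    show "emeasure (density lborel ?p) (box (- (real n *\<^sub>R One)) (real n *\<^sub>R One)) \<noteq> \<infinity>" for n
    proof -
      have "emeasure (density lborel ?p) (box (- (real n *\<^sub>R One)) (real n *\<^sub>R One))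
         \<le> (\<integral>\<^sup>+x. ?p x \<partial>lborel)"
        by (subst emeasure_density) (auto intro!: nn_integral_mono split: split_indicator)
      then show ?thesis using fin by (auto simp: top_unique)
    qed
    fix X assume "X \<in> range (\<lambda>(a, b). box a b::'a set)"
    then obtain a b where X: "X = box a b" by auto
    have i: "integrable lborel (\<lambda>x. f x * indicator (box a b) x)"
      using f by (rule integrable_real_mult_indicator[rotated]) auto
    have eq: "(\<integral>\<^sup>+x. ennreal (f x * indicator X x) \<partial>lborel) = emeasure (density lborel ?p) X"
       "(\<integral>\<^sup>+x. ennreal (- (f x * indicator X x)) \<partial>lborel) = emeasure (density lborel ?m) X"
      unfolding X by (subst emeasure_density, auto intro!: nn_integral_cong split: split_indicator)+
    have "(\<integral>\<^sup>+x. ennreal (f x * indicator X x) \<partial>lborel) < \<infinity>"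
       "(\<integral>\<^sup>+x. ennreal (- (f x * indicator X x)) \<partial>lborel) < \<infinity>"
      using i X by (auto simp: real_integrable_def less_top)
    moreover have "enn2real (\<integral>\<^sup>+x. ennreal (f x * indicator X x) \<partial>lborel)
       = enn2real (\<integral>\<^sup>+x. ennreal (- (f x * indicator X x)) \<partial>lborel)"
      using 0[of a b] real_lebesgue_integral_def[OF i] X by simp
    ultimately show "emeasure (density lborel ?p) X = emeasure (density lborel ?m) X"
      unfolding eq[symmetric] by (metis ennreal_enn2real infinity_ennreal_def)
  next
    show "sets (density lborel ?p) = sigma_sets UNIV (range (\<lambda>(a, b). box a b::'a set))"
      by (simp add: borel_eq_box)
    show "sets (density lborel ?m) = sigma_sets UNIV (range (\<lambda>(a, b). box a b::'a set))"
      by (simp add: borel_eq_box)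
  qed auto
  then have "AE x in lborel. ?p x = ?m x"
    using fin by (subst (asm) finite_density_unique) auto
  then show ?thesis
  proof eventually_elim
    \<comment> \<open>One of the two sides is 0, whatever the sign of \<open>f x\<close>, so
      equality makes both vanish.\<close>
    case (elim x)
    then show ?case by (cases "f x \<ge> 0") (auto simp: ennreal_neg ennreal_eq_0_iff)
  qed
qed

text \<open>On a box inside \<open>W\<close> the bumps tend boundedly to indicators as
  \<open>c\<close> tends to 0, so dominated convergence reduces the claim to integrals over boxes.
  Working box by box is forced, since \<open>f\<close> is integrable only locally.\<close>

lemma AE_zero_if_bump_integrals_zero:
  fixes f :: "real^'n \<Rightarrow> real"
  assumes W: "open W"
    and int: "\<And>a b. cbox a b \<subseteq> W \<Longrightarrow> integrable (lebesgue_on (cbox a b)) f"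
    and 0: "\<And>a b c. cbox a b \<subseteq> W \<Longrightarrow> c > 0 \<Longrightarrow> (LINT x|lebesgue. f x * bump c a b x) = 0"
  shows "AE x in lebesgue. x \<in> W \<longrightarrow> f x = 0"
proof -
  have *: "AE x in lebesgue. x \<in> box A B \<longrightarrow> f x = 0" if AB: "cbox A B \<subseteq> W" for A B
  proof -
    have i: "integrable lebesgue (\<lambda>x. indicator (cbox A B) x * f x)"
      using int[OF AB] by (simp add: integrable_restrict_space)
    have "integrable lebesgue (\<lambda>x. (indicator (cbox A B) x * f x) * indicator (box A B) x)"
      by (rule integrable_real_mult_indicator[OF _ i]) auto
    then have iw: "integrable lebesgue (\<lambda>x. indicator (box A B) x * f x)"
      by (rule Bochner_Integration.integrable_cong[THEN iffD1, rotated -1])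
         (use box_subset_cbox in \<open>auto split: split_indicator\<close>)
    \<comment> \<open>The box criterion is stated for \<open>lborel\<close>, while \<open>f\<close>
      is only Lebesgue measurable; a Borel representative bridges the gap.\<close>
    from completion_ex_borel_measurable_real[OF borel_measurable_integrable[OF iw]]
    obtain g where g[measurable]: "g \<in> borel_measurable lborel"
      and fg: "AE x in lborel. indicator (box A B) x * f x = g x" by auto
    have fg': "AE x in lebesgue. indicator (box A B) x * f x = g x"
      by (rule AE_completion[OF fg])
    have "integrable lebesgue g"
      by (rule integrable_cong_AE_imp[OF iw measurable_completion[OF g] fg'])
    then have ig: "integrable lborel g" by (subst (asm) integrable_completion) auto
    have "AE x in lborel. g x = 0"
    proof (rule AE_zero_if_box_integrals_zero[OF ig])
      fix a b :: "real^'n"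
      obtain a' b' where ab': "box a b \<inter> box A B = box a' b'" using box_Int_box by blast
      show "(LINT x|lborel. g x * indicator (box a b) x) = 0"
      \<comment> \<open>For an empty intersection the corners \<open>a'\<close> and
        \<open>b'\<close> are arbitrary, and \<open>cbox a' b'\<close> may leave
        \<open>cbox A B\<close>; no bump can be used then.\<close>
      proof (cases "box a' b' = {}")
        case True
        have "AE x in lebesgue. g x * indicator (box a b) x = 0"
          using fg' by eventually_elim (use True ab' in \<open>auto simp: disjoint_iff split: split_indicator_asm split_indicator\<close>)
        then have "(LINT x|lebesgue. g x * indicator (box a b) x) = 0"
          by (rule integral_eq_zero_AE)
        then show ?thesis by (subst (asm) integral_completion) auto
      next
        case False
        have sub: "cbox a' b' \<subseteq> cbox A B"
        proof -
          have "box a' b' \<subseteq> box A B" using ab' by blast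
          moreover from this have "box A B \<noteq> {}" using False by blast
          ultimately show ?thesis using closure_mono[of "box a' b'" "box A B"] False by (simp add: closure_box)
        qed
        have eq0: "(LINT x|lebesgue. f x * bump c a' b' x) = 0" if "c > 0" for c
          using 0[of a' b' c] sub AB that by auto
        have eq: "(LINT x|lborel. g x * bump (1 / real (Suc n)) a' b' x) = 0" for n
        proof -
          have "(LINT x|lborel. g x * bump (1 / real (Suc n)) a' b' x)
             = (LINT x|lebesgue. g x * bump (1 / real (Suc n)) a' b' x)"
            by (subst integral_completion) auto
          also have "\<dots> = (LINT x|lebesgue. (indicator (box A B) x * f x) * bump (1 / real (Suc n)) a' b' x)"
          proof (rule integral_cong_AE)
            show "(\<lambda>x. g x * bump (1 / real (Suc n)) a' b' x) \<in> borel_measurable lebesgue"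
              by (rule measurable_completion) auto
            show "(\<lambda>x. (indicator (box A B) x * f x) * bump (1 / real (Suc n)) a' b' x) \<in> borel_measurable lebesgue"
              by (intro borel_measurable_times borel_measurable_integrable[OF iw] measurable_completion) auto
          qed (use fg' in auto)
          also have "\<dots> = (LINT x|lebesgue. f x * bump (1 / real (Suc n)) a' b' x)"
            by (rule Bochner_Integration.integral_cong)
               (use ab' bump_eq_0_iff[of "1 / real (Suc n)" a' b'] in \<open>auto split: split_indicator\<close>)
          finally show ?thesis using eq0 by simp
        qed
        have "(\<lambda>n. LINT x|lborel. g x * bump (1 / real (Suc n)) a' b' x)
            \<longlonglongrightarrow> (LINT x|lborel. g x * indicator (box a' b') x)"
        proof (rule integral_dominated_convergence[where w="\<lambda>x. norm (g x)"])
          show "AE x in lborel. (\<lambda>n. g x * bump (1 / real (Suc n)) a' b' x) \<longlonglongrightarrow> g x * indicator (box a' b') x"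
            by (intro AE_I2 tendsto_intros bump_tendsto_indicator)
          show "AE x in lborel. norm (g x * bump (1 / real (Suc n)) a' b' x) \<le> norm (g x)" for n
            using bump_nonneg bump_le_1[of "1 / real (Suc n)" a' b']
            by (intro AE_I2) (simp add: abs_mult mult_left_le abs_of_nonneg[OF bump_nonneg])
        qed (use ig in auto)
        then have "(LINT x|lborel. g x * indicator (box a' b') x) = 0"
          using eq by (simp add: LIMSEQ_const_iff)
        moreover have "(LINT x|lborel. g x * indicator (box a b) x) = (LINT x|lborel. g x * indicator (box a' b') x)"
          by (rule integral_cong_AE)
             (use fg in \<open>auto simp flip: ab' split: split_indicator elim!: eventually_mono\<close>)
        ultimately show ?thesis by simp
      qed
    qed
    from AE_completion[OF this] fg' show ?thesis
      by eventually_elim (auto split: split_indicator)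
  qed
  \<comment> \<open>The countable cover of \<open>W\<close> consists of closed boxes; their faces
    are null sets.\<close>
  have **: "AE x in lebesgue. x \<in> cbox A B \<longrightarrow> f x = 0" if AB: "cbox A B \<subseteq> W" for A B
  proof -
    have "cbox A B - box A B \<in> null_sets lebesgue"
      using negligible_frontier_interval negligible_iff_null_sets by blast
    from AE_not_in[OF this] *[OF AB] show ?thesis by eventually_elim auto
  qed
  obtain D where D: "countable D" "D \<subseteq> Pow W" "\<And>X. X \<in> D \<Longrightarrow> \<exists>a b. X = cbox a b" "\<Union>D = W"
    using open_countable_Union_open_cbox[OF W] by metis
  have "AE x in lebesgue. \<forall>X\<in>D. x \<in> X \<longrightarrow> f x = 0"
    unfolding AE_ball_countable[OF D(1)] using ** D(2,3) by blast
  then show ?thesis by eventually_elim (use D(4) in blast)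
qed

section \<open>Weak gradients and their line integrals\<close>

lemma test_function_outside_support:
  fixes \<phi> :: "real^'n \<Rightarrow> real"
  assumes "x \<notin> closure {x. \<phi> x \<noteq> 0}"
  shows "\<phi> x = 0" "partial_deriv i \<phi> x = 0"
proof -
  show "\<phi> x = 0" using assms closure_subset[of "{x. \<phi> x \<noteq> 0}"] by blast
  have "(\<phi> has_derivative (\<lambda>_. 0)) (at x)"
  proof (rule has_derivative_transform_within_open[where s="- closure {x. \<phi> x \<noteq> 0}" and f="\<lambda>_. 0"])
    show "0 = \<phi> y" if "y \<in> - closure {x. \<phi> x \<noteq> 0}" for y
      using that closure_subset[of "{x. \<phi> x \<noteq> 0}"] by auto
  qed (use assms in \<open>auto intro: open_Compl closed_closure\<close>)
  from partial_derivI[OF this] show "partial_deriv i \<phi> x = 0" by simp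
qed

lemma test_function_continuous:
  assumes "\<phi> \<in> test_functions \<Omega>"
  shows "continuous_on UNIV \<phi>" "continuous_on UNIV (partial_deriv i \<phi>)"
proof -
  have "Ck 0 \<phi>" "Ck (Suc 0) \<phi>" using assms unfolding test_functions_def by blast+
  then show "continuous_on UNIV \<phi>" "continuous_on UNIV (partial_deriv i \<phi>)" by auto
qed

text \<open>Functions with a weak gradient are integrable on compact subsets only; the support of
  the test function supplies the compact set, and with it the integrability that linearity of the
  integral requires.\<close>

lemma integrable_mult_compact_support:
  fixes u \<psi> :: "'a::euclidean_space \<Rightarrow> real"
  assumes K: "compact K" "K \<subseteq> \<Omega>" and \<Omega>: "\<Omega> \<in> sets lebesgue"
    and u: "integrable (lebesgue_on K) u"
    and \<psi>: "continuous_on UNIV \<psi>" "\<And>x. x \<notin> K \<Longrightarrow> \<psi> x = 0"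
  shows "integrable (lebesgue_on \<Omega>) (\<lambda>x. u x * \<psi> x)"
proof -
  have "bounded (\<psi> ` K)"
    using compact_continuous_image[OF continuous_on_subset[OF \<psi>(1)] K(1)] compact_imp_bounded by blast
  then obtain B where B: "\<And>x. x \<in> K \<Longrightarrow> \<bar>\<psi> x\<bar> \<le> B" by (auto simp: bounded_iff)
  have B': "\<bar>\<psi> x\<bar> \<le> max B 0" for x using B[of x] \<psi>(2)[of x] by (cases "x \<in> K") auto
  have Km: "K \<inter> space lebesgue \<in> sets lebesgue" using K(1) by (simp add: lmeasurable_compact fmeasurableD)
  have i: "integrable lebesgue (\<lambda>x. indicator K x *\<^sub>R u x)"
    using u by (subst (asm) integrable_restrict_space[OF Km])
  have m: "\<psi> \<in> borel_measurable lebesgue"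
    by (rule measurable_completion) (use \<psi>(1) in \<open>auto intro: borel_measurable_continuous_onI\<close>)
  have "integrable lebesgue (\<lambda>x. (indicator K x *\<^sub>R u x) * \<psi> x)"
  proof (rule Bochner_Integration.integrable_bound)
    show "integrable lebesgue (\<lambda>x. max B 0 * (indicator K x *\<^sub>R u x))" using i by simp
    show "AE x in lebesgue. norm ((indicator K x *\<^sub>R u x) * \<psi> x) \<le> norm (max B 0 * (indicator K x *\<^sub>R u x))"
      using B' by (intro AE_I2) (auto simp: abs_mult mult.commute intro!: mult_right_mono)
  qed (use borel_measurable_integrable[OF i] m in auto)
  also have "(\<lambda>x. (indicator K x *\<^sub>R u x) * \<psi> x) = (\<lambda>x. indicator \<Omega> x *\<^sub>R (u x * \<psi> x))"
    using \<psi>(2) K(2) by (auto simp: fun_eq_iff split: split_indicator)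
  finally show ?thesis using \<Omega> by (simp add: integrable_restrict_space)
qed

lemma is_weak_gradient_diff:
  fixes u v :: "real^'n \<Rightarrow> real"
  assumes \<Omega>: "open \<Omega>" and G: "is_weak_gradient \<Omega> u G" and H: "is_weak_gradient \<Omega> v H"
  shows "is_weak_gradient \<Omega> (\<lambda>x. u x - v x) (\<lambda>x. G x - H x)"
  unfolding is_weak_gradient_def
proof (intro conjI allI impI ballI)
  show "(\<lambda>x. u x - v x) \<in> borel_measurable (lebesgue_on \<Omega>)" "(\<lambda>x. G x - H x) \<in> borel_measurable (lebesgue_on \<Omega>)"
    using G H by (auto simp: is_weak_gradient_def)
  show "integrable (lebesgue_on K) (\<lambda>x. u x - v x)" "integrable (lebesgue_on K) (\<lambda>x. G x - H x)"
    if "compact K \<and> K \<subseteq> \<Omega>" for K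
    using G H that by (auto simp: is_weak_gradient_def)
  fix \<phi> i assume \<phi>: "\<phi> \<in> test_functions \<Omega>"
  let ?K = "closure {x. \<phi> x \<noteq> 0}"
  have K: "compact ?K" "?K \<subseteq> \<Omega>" using \<phi> by (auto simp: test_functions_def)
  have \<Omega>m: "\<Omega> \<in> sets lebesgue" using \<Omega> by simp
  have [simp]: "integrable (lebesgue_on \<Omega>) (\<lambda>x. w x * \<phi> x)"
      "integrable (lebesgue_on \<Omega>) (\<lambda>x. w x * partial_deriv i \<phi> x)"
    if "integrable (lebesgue_on ?K) w" for w
    using integrable_mult_compact_support[OF K \<Omega>m that test_function_continuous(1)[OF \<phi>]]
      integrable_mult_compact_support[OF K \<Omega>m that test_function_continuous(2)[OF \<phi>]]
      test_function_outside_support[of _ \<phi>] by blast+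
  have int: "integrable (lebesgue_on ?K) u" "integrable (lebesgue_on ?K) v"
    "integrable (lebesgue_on ?K) (\<lambda>x. G x $ i)" "integrable (lebesgue_on ?K) (\<lambda>x. H x $ i)"
    using G H K by (auto simp: is_weak_gradient_def intro: integrable_bounded_linear[OF bounded_linear_vec_nth])
  show "(LINT x|lebesgue_on \<Omega>. (u x - v x) * partial_deriv i \<phi> x) =
        - (LINT x|lebesgue_on \<Omega>. (G x - H x) $ i * \<phi> x)"
    using int G H \<phi> by (simp add: left_diff_distrib is_weak_gradient_def)
qed

text \<open>Both candidates have the same integral against every bump inside
  \<open>\<Omega>\<close>, so the fundamental lemma applies to each component of the difference.
  This identifies \<open>wgrad\<close> of a difference, which is chosen independently of the
  gradients of the two functions.\<close>

lemma is_weak_gradient_unique: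
  fixes u :: "real^'n \<Rightarrow> real"
  assumes \<Omega>: "open \<Omega>" and G: "is_weak_gradient \<Omega> u G" and H: "is_weak_gradient \<Omega> u H"
  shows "AE x in lebesgue_on \<Omega>. G x = H x"
proof -
  have "AE x in lebesgue. x \<in> \<Omega> \<longrightarrow> G x $ i - H x $ i = 0" for i
  proof (rule AE_zero_if_bump_integrals_zero[OF \<Omega>])
    fix a b :: "real^'n" assume ab: "cbox a b \<subseteq> \<Omega>"
    have int: "integrable (lebesgue_on (cbox a b)) (\<lambda>x. G x $ i)" "integrable (lebesgue_on (cbox a b)) (\<lambda>x. H x $ i)"
      using G H ab by (auto simp: is_weak_gradient_def intro: integrable_bounded_linear[OF bounded_linear_vec_nth])
    then show "integrable (lebesgue_on (cbox a b)) (\<lambda>x. G x $ i - H x $ i)" by simp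
    fix c :: real assume "c > 0"
    then have \<phi>: "bump c a b \<in> test_functions \<Omega>" using bump_in_test_functions ab by blast
    have \<Omega>m: "\<Omega> \<in> sets lebesgue" using \<Omega> by simp
    have 0: "bump c a b x = 0" if "x \<notin> cbox a b" for x
      using that bump_eq_0_iff[of c a b x] box_subset_cbox[of a b] by auto
    have bump0: "bump c a b x = 0" if "x \<notin> \<Omega>" for x using 0 that ab by blast
    have [simp]: "integrable (lebesgue_on \<Omega>) (\<lambda>x. G x $ i * bump c a b x)"
      "integrable (lebesgue_on \<Omega>) (\<lambda>x. H x $ i * bump c a b x)"
      by (rule integrable_mult_compact_support[OF compact_cbox ab \<Omega>m _ test_function_continuous(1)[OF \<phi>] 0],
          fact, assumption)+
    have "(LINT x|lebesgue. (G x $ i - H x $ i) * bump c a b x)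
       = (LINT x|lebesgue_on \<Omega>. (G x $ i - H x $ i) * bump c a b x)"
      using \<Omega>m bump0 by (subst integral_restrict_space)
        (auto intro!: Bochner_Integration.integral_cong split: split_indicator)
    also have "\<dots> = (LINT x|lebesgue_on \<Omega>. G x $ i * bump c a b x) - (LINT x|lebesgue_on \<Omega>. H x $ i * bump c a b x)"
      by (simp add: left_diff_distrib)
    also have "\<dots> = 0"
    proof -
      have "(LINT x|lebesgue_on \<Omega>. u x * partial_deriv i (bump c a b) x) = - (LINT x|lebesgue_on \<Omega>. G x $ i * bump c a b x)"
        using G \<phi> unfolding is_weak_gradient_def by blast
      moreover have "(LINT x|lebesgue_on \<Omega>. u x * partial_deriv i (bump c a b) x) = - (LINT x|lebesgue_on \<Omega>. H x $ i * bump c a b x)"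
        using H \<phi> unfolding is_weak_gradient_def by blast
      ultimately show ?thesis by simp
    qed
    finally show "(LINT x|lebesgue. (G x $ i - H x $ i) * bump c a b x) = 0" .
  qed
  then have "AE x in lebesgue. \<forall>i. x \<in> \<Omega> \<longrightarrow> G x $ i - H x $ i = 0"
    unfolding AE_all_countable by blast
  then show ?thesis
    using \<Omega> by (subst AE_restrict_space_iff) (auto simp: vec_eq_iff)
qed

lemma wgrad_is_weak_gradient:
  "is_weak_gradient \<Omega> u G \<Longrightarrow> is_weak_gradient \<Omega> u (wgrad \<Omega> u)"
  unfolding wgrad_def by (rule someI[of "is_weak_gradient \<Omega> u" G])

section \<open>Directional derivatives and translation along segments\<close>

definition dir_deriv :: "(real^'n \<Rightarrow> real) \<Rightarrow> real^'n \<Rightarrow> real^'n \<Rightarrow> real" where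
  "dir_deriv f v x = (\<Sum>i\<in>UNIV. v $ i * partial_deriv i f x)"

lemma frechet_derivative_eq_dir_deriv:
  assumes "f differentiable (at x)"
  shows "frechet_derivative f (at x) v = dir_deriv f v x"
proof -
  have lin: "linear (frechet_derivative f (at x))" using assms linear_frechet_derivative by blast
  have "frechet_derivative f (at x) v = frechet_derivative f (at x) (\<Sum>i\<in>UNIV. v $ i *\<^sub>R axis i 1)"
    using basis_expansion[of v] by (simp add: scalar_mult_eq_scaleR)
  also have "\<dots> = dir_deriv f v x"
    using lin by (simp add: linear_sum linear_scale dir_deriv_def partial_deriv_def)
  finally show ?thesis .
qed

lemma has_real_derivative_along_line:
  fixes f :: "real^'n \<Rightarrow> real"
  assumes "\<And>x. f differentiable (at x)"
  shows "((\<lambda>s. f (x - s *\<^sub>R v)) has_real_derivative - dir_deriv f v (x - s *\<^sub>R v)) (at s)"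
proof -
  have "((\<lambda>s. x - s *\<^sub>R v) has_derivative (\<lambda>h. - (h *\<^sub>R v))) (at s)"
    by (auto intro!: derivative_eq_intros)
  from has_derivative_compose[OF this partial_deriv_has_derivative[OF assms]]
  have "((\<lambda>s. f (x - s *\<^sub>R v)) has_derivative (\<lambda>h. dir_deriv f (- (h *\<^sub>R v)) (x - s *\<^sub>R v))) (at s)"
    using frechet_derivative_eq_dir_deriv[OF assms] by simp
  moreover have "dir_deriv f (- (h *\<^sub>R v)) y = - dir_deriv f v y * h" for h y
    by (simp add: dir_deriv_def sum_negf sum_distrib_left sum_distrib_right algebra_simps)
  ultimately have "((\<lambda>s. f (x - s *\<^sub>R v)) has_derivative (\<lambda>h. - dir_deriv f v (x - s *\<^sub>R v) * h)) (at s)"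
    by (simp only:)
  then show ?thesis by (simp only: has_field_derivative_def)
qed

lemma partial_deriv_translate:
  assumes "f differentiable (at (x - v))"
  shows "partial_deriv i (\<lambda>x. f (x - v)) x = partial_deriv i f (x - v)"
proof -
  have "((\<lambda>x. x - v) has_derivative (\<lambda>h. h)) (at x)" by (auto intro!: derivative_eq_intros)
  from partial_derivI[OF has_derivative_compose[OF this partial_deriv_has_derivative[OF assms]]]
  show ?thesis by (simp add: partial_deriv_def)
qed

lemma bump_differentiable: "c > 0 \<Longrightarrow> bump c a b differentiable (at x)"
  using Ck_bump[of c "Suc 0" a b] by simp

lemma dir_deriv_bump_translate:
  "c > 0 \<Longrightarrow> dir_deriv (bump c a b) w (x - v) = dir_deriv (bump c (a + v) (b + v)) w x"
  using partial_deriv_translate[OF bump_differentiable[of c a b "x - v"]]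
  by (simp add: dir_deriv_def bump_translate[abs_def])

lemma continuous_on_dir_deriv_bump: "c > 0 \<Longrightarrow> continuous_on UNIV (dir_deriv (bump c a b) v)"
  using Ck_bump[of c "Suc 0" a b]
  unfolding dir_deriv_def[abs_def] by (intro continuous_on_sum continuous_on_mult continuous_on_const) auto

lemma dir_deriv_bump_outside: "x \<notin> cbox a b \<Longrightarrow> dir_deriv (bump c a b) v x = 0"
proof -
  assume "x \<notin> cbox a b"
  then have "x \<notin> closure {x. bump c a b x \<noteq> 0}" using closure_bump by blast
  from test_function_outside_support(2)[OF this] show ?thesis by (simp add: dir_deriv_def)
qed

lemma dir_deriv_bump_bounded:
  assumes "c > 0"
  obtains B where "\<And>x. \<bar>dir_deriv (bump c a b) v x\<bar> \<le> B" "B \<ge> 0"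
proof -
  have "bounded (dir_deriv (bump c a b) v ` cbox a b)"
    by (intro compact_imp_bounded compact_continuous_image compact_cbox
        continuous_on_subset[OF continuous_on_dir_deriv_bump[OF assms]]) auto
  then obtain B where B: "\<And>x. x \<in> cbox a b \<Longrightarrow> \<bar>dir_deriv (bump c a b) v x\<bar> \<le> B"
    by (auto simp: bounded_iff)
  show ?thesis
    by (rule that[of "max B 0"]) (use B dir_deriv_bump_outside[of _ a b c v] in \<open>fastforce simp: max_def\<close>)+
qed

lemma integrable_mult_bounded:
  fixes u \<psi> :: "'a \<Rightarrow> real"
  assumes u: "integrable M u" and [measurable]: "\<psi> \<in> borel_measurable M" and B: "\<And>x. \<bar>\<psi> x\<bar> \<le> B"
  shows "integrable M (\<lambda>x. u x * \<psi> x)"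
proof (rule Bochner_Integration.integrable_bound)
  show "integrable M (\<lambda>x. B * u x)" using u by simp
  have "\<bar>u x * \<psi> x\<bar> \<le> \<bar>B * u x\<bar>" for x
    using B[of x] by (simp add: abs_mult mult.commute) (meson abs_ge_self mult_right_mono abs_ge_zero order_trans)
  then show "AE x in M. norm (u x * \<psi> x) \<le> norm (B * u x)" by simp
qed (use borel_measurable_integrable[OF u] in simp)

lemma
  fixes f :: "'a::euclidean_space \<Rightarrow> 'b::{banach, second_countable_topology}"
  assumes f[measurable]: "f \<in> borel_measurable borel"
  shows lborel_integral_translate: "(LINT x|lborel. f (x + v)) = (LINT x|lborel. f x)"
    and lborel_integrable_translate_iff: "integrable lborel (\<lambda>x. f (x + v)) \<longleftrightarrow> integrable lborel f"
proof -
  have "(LINT x|lborel. f x) = (LINT x|distr lborel borel ((+) v). f x)"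
    by (simp only: lborel_distr_plus)
  also have "\<dots> = (LINT x|lborel. f (x + v))" by (subst integral_distr) (auto simp: add.commute)
  finally show "(LINT x|lborel. f (x + v)) = (LINT x|lborel. f x)" by simp
  have "integrable lborel f \<longleftrightarrow> integrable (distr lborel borel ((+) v)) f"
    by (simp only: lborel_distr_plus)
  also have "\<dots> \<longleftrightarrow> integrable lborel (\<lambda>x. f (x + v))"
    by (subst integrable_distr_eq) (auto simp: add.commute)
  finally show "integrable lborel (\<lambda>x. f (x + v)) \<longleftrightarrow> integrable lborel f" by simp
qed

text \<open>Fubini with \<open>x\<close> inside: by translation invariance the integral of
  \<open>\<bar>h\<bar>\<close> over the shifted points does not depend on \<open>s\<close>, and
  \<open>s\<close> ranges over a bounded interval.\<close>

lemma integrable_along_segments: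
  fixes h :: "'a::euclidean_space \<Rightarrow> real"
  assumes h: "integrable lborel h"
  shows "integrable (lborel \<Otimes>\<^sub>M lborel) (\<lambda>(x, s). h (x + s *\<^sub>R v) * indicator {0..t} s)"
proof -
  have [measurable]: "h \<in> borel_measurable borel" using h by auto
  have hs: "integrable lborel (\<lambda>x. h (x + s *\<^sub>R v))" for s
    using h by (subst lborel_integrable_translate_iff) auto
  have "integrable (lborel \<Otimes>\<^sub>M lborel) (\<lambda>(s, x). h (x + s *\<^sub>R v) * indicator {0..t} s)"
  proof (rule lborel_pair.Fubini_integrable)
    have "(\<integral>x. norm (case (s, x) of (s, x) \<Rightarrow> h (x + s *\<^sub>R v) * indicator {0..t} s) \<partial>lborel)
        = (\<integral>x. \<bar>h x\<bar> \<partial>lborel) * indicator {0..t} s" for s :: real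
      using lborel_integral_translate[of "\<lambda>x. \<bar>h x\<bar>" "s *\<^sub>R v"] by (simp add: abs_mult)
    moreover have "integrable lborel (indicator {0..t} :: real \<Rightarrow> real)"
      by (rule integrable_real_indicator) (auto simp: emeasure_lborel_Icc_eq)
    ultimately show "integrable lborel (\<lambda>s::real. \<integral>x. norm (case (s, x) of (s, x) \<Rightarrow> h (x + s *\<^sub>R v) * indicator {0..t} s) \<partial>lborel)"
      by simp
    show "AE s in lborel. integrable lborel (\<lambda>x. case (s, x) of (s, x) \<Rightarrow> h (x + s *\<^sub>R v) * indicator {0..t} s)"
      using hs by simp
  qed measurable
  from lborel_pair.integrable_product_swap[OF this] show ?thesis
    by (simp add: case_prod_unfold)
qed

lemma borel_measurable_dir_deriv_bump[measurable]:
  "c > 0 \<Longrightarrow> dir_deriv (bump c a b) v \<in> borel_measurable borel"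
  by (rule borel_measurable_continuous_onI[OF continuous_on_dir_deriv_bump])

lemma integrable_mult_dir_deriv_bump:
  assumes u: "integrable lborel u" and c: "c > 0"
  shows "integrable lborel (\<lambda>x. u x * dir_deriv (bump c a b) v x)"
proof -
  obtain B where "\<And>x. \<bar>dir_deriv (bump c a b) v x\<bar> \<le> B" using dir_deriv_bump_bounded[OF c] by metis
  from integrable_mult_bounded[OF u _ this] c show ?thesis by auto
qed

lemma integrable_mult_bump:
  assumes u: "integrable lborel u" and c: "c > 0"
  shows "integrable lborel (\<lambda>x. u x * bump c a b x)"
  by (rule integrable_mult_bounded[OF u, where B=1])
     (use c bump_le_1[of c a b] in \<open>auto simp: abs_of_nonneg[OF bump_nonneg]\<close>)

lemma partial_deriv_eq_dir_deriv: "partial_deriv i f x = dir_deriv f (axis i 1) x"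
  by (simp add: dir_deriv_def axis_def if_distrib[of "\<lambda>y. y * _"] sum.delta' cong: if_cong)

lemma dir_deriv_bump_by_parts:
  fixes u :: "real^'n \<Rightarrow> real" and G :: "real^'n \<Rightarrow> real^'n"
  assumes u: "integrable lborel u" and G: "integrable lborel G"
    and wg: "\<And>i. (LINT x|lborel. u x * partial_deriv i (bump c a b) x) = - (LINT x|lborel. G x $ i * bump c a b x)"
    and c: "c > 0"
  shows "(LINT x|lborel. u x * dir_deriv (bump c a b) v x) = - (LINT x|lborel. (G x \<bullet> v) * bump c a b x)"
proof -
  have Gi: "integrable lborel (\<lambda>x. G x $ i)" for i
    using G by (rule integrable_bounded_linear[OF bounded_linear_vec_nth])
  have 1: "integrable lborel (\<lambda>x. u x * partial_deriv i (bump c a b) x)" for i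
    using integrable_mult_dir_deriv_bump[OF u c] by (simp add: partial_deriv_eq_dir_deriv)
  have "(LINT x|lborel. u x * dir_deriv (bump c a b) v x)
    = (LINT x|lborel. (\<Sum>i\<in>UNIV. v $ i * (u x * partial_deriv i (bump c a b) x)))"
    by (simp add: dir_deriv_def sum_distrib_left ac_simps)
  also have "\<dots> = (\<Sum>i\<in>UNIV. v $ i * (LINT x|lborel. u x * partial_deriv i (bump c a b) x))"
    using 1 by simp
  also have "\<dots> = - (\<Sum>i\<in>UNIV. v $ i * (LINT x|lborel. G x $ i * bump c a b x))"
    using wg by (simp add: sum_negf)
  also have "(\<Sum>i\<in>UNIV. v $ i * (LINT x|lborel. G x $ i * bump c a b x))
     = (LINT x|lborel. (\<Sum>i\<in>UNIV. v $ i * (G x $ i * bump c a b x)))"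
    using integrable_mult_bump[OF Gi c] by simp
  also have "\<dots> = (LINT x|lborel. (G x \<bullet> v) * bump c a b x)"
    by (simp add: inner_vec_def sum_distrib_right sum_distrib_left ac_simps)
  finally show ?thesis .
qed

text \<open>The path runs backwards, since a translation of \<open>u\<close> by \<open>t\<close>
  times \<open>v\<close> becomes a translation of the bump in the opposite direction; hence the
  minus sign.\<close>

lemma bump_increment:
  assumes c: "c > 0" and t: "t \<ge> 0"
  shows "bump c a b (x - t *\<^sub>R v) - bump c a b x
    = - (LINT s|lborel. dir_deriv (bump c a b) v (x - s *\<^sub>R v) * indicator {0..t} s)"
proof -
  have "(LINT s|lborel. (- dir_deriv (bump c a b) v (x - s *\<^sub>R v)) * indicator {0..t} s)
     = bump c a b (x - t *\<^sub>R v) - bump c a b (x - 0 *\<^sub>R v)"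
  proof (rule integral_FTC_Icc_real[OF t])
    fix s
    show "((\<lambda>s. bump c a b (x - s *\<^sub>R v)) has_real_derivative - dir_deriv (bump c a b) v (x - s *\<^sub>R v)) (at s)"
      by (rule has_real_derivative_along_line[OF bump_differentiable[OF c]])
    have "continuous_on UNIV (\<lambda>s. - dir_deriv (bump c a b) v (x - s *\<^sub>R v))"
      by (intro continuous_intros continuous_on_compose2[OF continuous_on_dir_deriv_bump[OF c]]) auto
    then show "isCont (\<lambda>s. - dir_deriv (bump c a b) v (x - s *\<^sub>R v)) s"
      by (simp add: continuous_on_eq_continuous_at)
  qed
  then show ?thesis by simp
qed

text \<open>The form of the weak gradient in which Fubini's theorem can be used: both functions are
  Borel and integrable on the whole space, and only bumps serve as test functions, since these
  suffice for the fundamental lemma. Values outside \<open>\<Omega>\<close> are constrained by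
  integrability alone.\<close>

definition weak_gradient_pair :: "(real^'n) set \<Rightarrow> (real^'n \<Rightarrow> real) \<Rightarrow> (real^'n \<Rightarrow> real^'n) \<Rightarrow> bool" where
  "weak_gradient_pair \<Omega> u G \<longleftrightarrow> integrable lborel u \<and> integrable lborel G \<and>
    (\<forall>a b c i. cbox a b \<subseteq> \<Omega> \<longrightarrow> c > 0 \<longrightarrow>
      (LINT x|lborel. u x * partial_deriv i (bump c a b) x) = - (LINT x|lborel. G x $ i * bump c a b x))"

lemma weak_gradient_pairD:
  assumes "weak_gradient_pair \<Omega> u G"
  shows "integrable lborel u" "integrable lborel G"
    and "cbox a b \<subseteq> \<Omega> \<Longrightarrow> c > 0 \<Longrightarrow>
      (LINT x|lborel. u x * partial_deriv i (bump c a b) x) = - (LINT x|lborel. G x $ i * bump c a b x)"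
  using assms by (auto simp: weak_gradient_pair_def)

text \<open>The increment of \<open>u\<close> is moved onto the bump by translation. The increment
  of the bump is the integral of its directional derivative along the segment; integrating by parts
  for each \<open>s\<close> and translating back puts \<open>G\<close> in its place. The hypothesis
  on the shifted boxes keeps every translated bump a test function in
  \<open>\<Omega>\<close>.\<close>

lemma weak_gradient_increment_bump:
  fixes u :: "real^'n \<Rightarrow> real" and G :: "real^'n \<Rightarrow> real^'n"
  assumes wp: "weak_gradient_pair \<Omega> u G"
    and c: "c > 0" and t: "t \<ge> 0"
    and sub: "\<And>s. 0 \<le> s \<Longrightarrow> s \<le> t \<Longrightarrow> cbox (a + s *\<^sub>R v) (b + s *\<^sub>R v) \<subseteq> \<Omega>"
  shows "(LINT x|lborel. (u (x + t *\<^sub>R v) - u x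
      - (LINT s|lborel. (G (x + s *\<^sub>R v) \<bullet> v) * indicator {0..t} s)) * bump c a b x) = 0"
proof -
  note u = weak_gradient_pairD(1)[OF wp] and G = weak_gradient_pairD(2)[OF wp]
  have [measurable]: "u \<in> borel_measurable borel" "G \<in> borel_measurable borel" using u G by auto
  have [measurable]: "bump c a b \<in> borel_measurable borel" "dir_deriv (bump c a b) v \<in> borel_measurable borel"
    using c by auto
  have Gv: "integrable lborel (\<lambda>x. G x \<bullet> v)" using G by simp
  have ut: "integrable lborel (\<lambda>x. u (x + t *\<^sub>R v))"
    using u by (subst lborel_integrable_translate_iff) auto
  have "(LINT x|lborel. u (x + t *\<^sub>R v) * bump c a b x) = (LINT x|lborel. u x * bump c a b (x - t *\<^sub>R v))"
    using lborel_integral_translate[of "\<lambda>x. u x * bump c a b (x - t *\<^sub>R v)" "t *\<^sub>R v"] by simp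
  then have "(LINT x|lborel. (u (x + t *\<^sub>R v) - u x) * bump c a b x)
     = (LINT x|lborel. u x * bump c a b (x - t *\<^sub>R v)) - (LINT x|lborel. u x * bump c a b x)"
    using integrable_mult_bump[OF ut c] integrable_mult_bump[OF u c] by (simp add: left_diff_distrib)
  also have "\<dots> = (LINT x|lborel. u x * (bump c a b (x - t *\<^sub>R v) - bump c a b x))"
    using integrable_mult_bump[OF u c, of "a + t *\<^sub>R v" "b + t *\<^sub>R v"] integrable_mult_bump[OF u c]
    by (simp add: right_diff_distrib bump_translate)
  also have "\<dots> = (LINT x|lborel. (LINT s|lborel. - (u x * dir_deriv (bump c a b) v (x - s *\<^sub>R v) * indicator {0..t} s)))"
    by (simp add: bump_increment[OF c t] mult.assoc)
  \<comment> \<open>For fixed \<open>s\<close> the integral over \<open>x\<close> has the form to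
    which the weak gradient applies, so the order of integration is exchanged.\<close>
  also have "\<dots> = (LINT s|lborel. (LINT x|lborel. - (u x * dir_deriv (bump c a b) v (x - s *\<^sub>R v) * indicator {0..t} s)))"
  proof (rule lborel_pair.Fubini_integral[symmetric])
    obtain B where B: "\<And>x. \<bar>dir_deriv (bump c a b) v x\<bar> \<le> B" using dir_deriv_bump_bounded[OF c] by metis
    have *: "integrable (lborel \<Otimes>\<^sub>M lborel) (\<lambda>z. u (fst z) * indicator {0..t} (snd z))"
      using integrable_along_segments[OF u, of 0 t] by (simp add: case_prod_unfold)
    have "integrable (lborel \<Otimes>\<^sub>M lborel) (\<lambda>z. - ((u (fst z) * indicator {0..t} (snd z)) * dir_deriv (bump c a b) v (fst z - snd z *\<^sub>R v)))"
      by (intro Bochner_Integration.integrable_minus integrable_mult_bounded[OF *]) (use B in \<open>auto\<close>)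
    then show "integrable (lborel \<Otimes>\<^sub>M lborel) (\<lambda>(x, s). - (u x * dir_deriv (bump c a b) v (x - s *\<^sub>R v) * indicator {0..t} s))"
      by (simp add: case_prod_unfold ac_simps)
  qed
  also have "\<dots> = (LINT s|lborel. (LINT x|lborel. (G (x + s *\<^sub>R v) \<bullet> v) * indicator {0..t} s * bump c a b x))"
  proof (rule Bochner_Integration.integral_cong[OF refl])
    fix s :: real
    show "(LINT x|lborel. - (u x * dir_deriv (bump c a b) v (x - s *\<^sub>R v) * indicator {0..t} s))
       = (LINT x|lborel. (G (x + s *\<^sub>R v) \<bullet> v) * indicator {0..t} s * bump c a b x)"
    proof (cases "s \<in> {0..t}")
      case True
      then have sub': "cbox (a + s *\<^sub>R v) (b + s *\<^sub>R v) \<subseteq> \<Omega>" using sub by auto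
      have "(LINT x|lborel. u x * dir_deriv (bump c a b) v (x - s *\<^sub>R v))
        = - (LINT x|lborel. (G x \<bullet> v) * bump c a b (x - s *\<^sub>R v))"
        using dir_deriv_bump_by_parts[OF u G weak_gradient_pairD(3)[OF wp sub' c] c]
        by (simp add: dir_deriv_bump_translate[OF c] bump_translate)
      also have "(LINT x|lborel. (G x \<bullet> v) * bump c a b (x - s *\<^sub>R v))
         = (LINT x|lborel. (G (x + s *\<^sub>R v) \<bullet> v) * bump c a b x)"
        using lborel_integral_translate[of "\<lambda>x. (G x \<bullet> v) * bump c a b (x - s *\<^sub>R v)" "s *\<^sub>R v"] by simp
      finally show ?thesis using True by simp
    qed simp
  qed
  also have "\<dots> = (LINT x|lborel. (LINT s|lborel. (G (x + s *\<^sub>R v) \<bullet> v) * indicator {0..t} s * bump c a b x))"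
  proof (rule lborel_pair.Fubini_integral)
    have "integrable (lborel \<Otimes>\<^sub>M lborel) (\<lambda>z. (case z of (x, s) \<Rightarrow> (G (x + s *\<^sub>R v) \<bullet> v) * indicator {0..t} s) * bump c a b (fst z))"
      by (rule integrable_mult_bounded[OF integrable_along_segments[OF Gv], where B=1])
         (use c bump_le_1[of c a b] in \<open>auto simp: abs_of_nonneg[OF bump_nonneg]\<close>)
    then show "integrable (lborel \<Otimes>\<^sub>M lborel) (\<lambda>(x, s). (G (x + s *\<^sub>R v) \<bullet> v) * indicator {0..t} s * bump c a b x)"
      by (simp add: case_prod_unfold)
  qed
  also have "\<dots> = (LINT x|lborel. (LINT s|lborel. (G (x + s *\<^sub>R v) \<bullet> v) * indicator {0..t} s) * bump c a b x)"
    by simp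
  finally have eq: "(LINT x|lborel. (u (x + t *\<^sub>R v) - u x) * bump c a b x)
    = (LINT x|lborel. (LINT s|lborel. (G (x + s *\<^sub>R v) \<bullet> v) * indicator {0..t} s) * bump c a b x)" .
  have i1: "integrable lborel (\<lambda>x. (u (x + t *\<^sub>R v) - u x) * bump c a b x)"
    using ut u by (intro integrable_mult_bump[OF _ c]) simp
  have "integrable lborel (\<lambda>x. LINT s|lborel. (G (x + s *\<^sub>R v) \<bullet> v) * indicator {0..t} s)"
    using lborel_pair.integrable_fst'[OF integrable_along_segments[OF Gv, of v t]] by simp
  from integrable_mult_bump[OF this c, of a b] show ?thesis
    using eq i1 by (subst left_diff_distrib) simp
qed

text \<open>The difference of the two sides has integral 0 against every bump in \<open>W\<close>.
  The exceptional null set depends on \<open>t\<close>; \<open>AE_along_segments\<close> later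
  exchanges the quantifiers.\<close>

lemma weak_gradient_increment_AE:
  fixes u :: "real^'n \<Rightarrow> real" and G :: "real^'n \<Rightarrow> real^'n"
  assumes wp: "weak_gradient_pair \<Omega> u G"
    and t: "t \<ge> 0" and W: "open W" and sub: "\<And>x s. x \<in> W \<Longrightarrow> 0 \<le> s \<Longrightarrow> s \<le> t \<Longrightarrow> x + s *\<^sub>R v \<in> \<Omega>"
  shows "AE x in lborel. x \<in> W \<longrightarrow>
    u (x + t *\<^sub>R v) - u x = (LINT s|lborel. (G (x + s *\<^sub>R v) \<bullet> v) * indicator {0..t} s)"
proof -
  note u = weak_gradient_pairD(1)[OF wp] and G = weak_gradient_pairD(2)[OF wp]
  have [measurable]: "u \<in> borel_measurable borel" "G \<in> borel_measurable borel" using u G by auto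
  have ut: "integrable lborel (\<lambda>x. u (x + t *\<^sub>R v))"
    using u by (subst lborel_integrable_translate_iff) auto
  have Gv: "integrable lborel (\<lambda>x. G x \<bullet> v)" using G by simp
  let ?f = "\<lambda>x. u (x + t *\<^sub>R v) - u x - (LINT s|lborel. (G (x + s *\<^sub>R v) \<bullet> v) * indicator {0..t} s)"
  have "integrable lborel (\<lambda>x. LINT s|lborel. (G (x + s *\<^sub>R v) \<bullet> v) * indicator {0..t} s)"
    using lborel_pair.integrable_fst'[OF integrable_along_segments[OF Gv, of v t]] by simp
  then have f: "integrable lborel ?f" using ut u by simp
  then have fl: "integrable lebesgue ?f" by (subst integrable_completion) auto
  have "AE x in lebesgue. x \<in> W \<longrightarrow> ?f x = 0"
  proof (rule AE_zero_if_bump_integrals_zero[OF W])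
    fix a b :: "real^'n" and c :: real assume ab: "cbox a b \<subseteq> W"
    show "integrable (lebesgue_on (cbox a b)) ?f"
      using integrable_mult_indicator[OF _ fl, of "cbox a b"] by (subst integrable_restrict_space) simp_all
    assume c: "c > 0"
    have "cbox (a + s *\<^sub>R v) (b + s *\<^sub>R v) \<subseteq> \<Omega>" if s: "0 \<le> s" "s \<le> t" for s
    proof
      fix x assume "x \<in> cbox (a + s *\<^sub>R v) (b + s *\<^sub>R v)"
      then have "x - s *\<^sub>R v \<in> cbox a b" by (auto simp: mem_box_cart algebra_simps)
      with ab sub[of "x - s *\<^sub>R v" s] s show "x \<in> \<Omega>" by auto
    qed
    from weak_gradient_increment_bump[OF wp c t this]
    have "(LINT x|lborel. ?f x * bump c a b x) = 0" .
    then show "(LINT x|lebesgue. ?f x * bump c a b x) = 0"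
      using f c by (subst integral_completion) auto
  qed
  then have "AE x in lborel. x \<in> W \<longrightarrow> ?f x = 0"
    by (subst (asm) AE_completion_iff) auto
  then show ?thesis by eventually_elim auto
qed

section \<open>The Loomis-Whitney inequality\<close>

text \<open>For \<open>a > 0\<close> this is the usual power on the extended half-line; with
  exponent 0 the values at 0 and \<open>top\<close> remain 0 and \<open>top\<close>.\<close>

definition epowr :: "ennreal \<Rightarrow> real \<Rightarrow> ennreal" where
  "epowr x a = (if x = top then top else ennreal (enn2real x powr a))"

lemma epowr_ennreal: "0 \<le> x \<Longrightarrow> epowr (ennreal x) a = ennreal (x powr a)"
  by (simp add: epowr_def)

lemma epowr_0 [simp]: "epowr 0 a = 0"
  by (simp add: epowr_def)

lemma epowr_top [simp]: "epowr top a = top"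
  by (simp add: epowr_def)

lemma epowr_mono: "0 \<le> a \<Longrightarrow> x \<le> y \<Longrightarrow> epowr x a \<le> epowr y a"
  by (auto simp: epowr_def top_unique less_top intro!: ennreal_leI powr_mono2 enn2real_mono)

lemma epowr_eq_0_iff: "epowr x a = 0 \<longleftrightarrow> x = 0"
  by (auto simp: epowr_def enn2real_eq_0_iff ennreal_eq_0_iff powr_nonneg_iff)

lemma epowr_eq_top_iff: "epowr x a = top \<longleftrightarrow> x = top"
  by (simp add: epowr_def)

lemma borel_measurable_epowr[measurable]: "(\<lambda>x. epowr x a) \<in> borel_measurable borel"
  unfolding epowr_def by measurable

lemma epowr_mult: "epowr (ennreal c * x) a = ennreal (c powr a) * epowr x a" if "c > 0"
proof (cases "x = top")
  case True
  then show ?thesis using that by (simp add: ennreal_mult_top)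
next
  case False
  then obtain r where r: "x = ennreal r" "r \<ge> 0" by (cases x) auto
  then show ?thesis using that
    by (simp add: ennreal_mult[symmetric] epowr_ennreal powr_mult)
qed

text \<open>Convexity of \<open>exp\<close> at the points \<open>ln (x i)\<close>. A zero among the
  \<open>x i\<close> has no usable logarithm but makes the product vanish.\<close>

lemma weighted_arith_geom_mean:
  fixes x w :: "'a \<Rightarrow> real"
  assumes "finite S" "sum w S = 1" and w: "\<And>i. i \<in> S \<Longrightarrow> w i > 0" and x: "\<And>i. i \<in> S \<Longrightarrow> x i \<ge> 0"
  shows "(\<Prod>i\<in>S. x i powr w i) \<le> (\<Sum>i\<in>S. w i * x i)"
proof (cases "\<exists>i\<in>S. x i = 0")
  case True
  then have "(\<Prod>i\<in>S. x i powr w i) = 0" using assms(1) by auto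
  also have "0 \<le> (\<Sum>i\<in>S. w i * x i)" using w x by (intro sum_nonneg mult_nonneg_nonneg) (auto intro: less_imp_le)
  finally show ?thesis .
next
  case False
  then have x': "x i > 0" if "i \<in> S" for i using x[OF that] that by fastforce
  have "S \<noteq> {}" using assms(2) by auto
  have "(\<Prod>i\<in>S. x i powr w i) = (\<Prod>i\<in>S. exp (w i * ln (x i)))"
    using x' by (intro prod.cong) (auto simp: powr_def dest!: x')
  also have "\<dots> = exp (\<Sum>i\<in>S. w i *\<^sub>R ln (x i))" using assms(1) by (simp add: exp_sum)
  also have "\<dots> \<le> (\<Sum>i\<in>S. w i * exp (ln (x i)))"
    by (rule convex_on_sum[OF assms(1) \<open>S \<noteq> {}\<close> exp_convex assms(2)]) (use w in \<open>auto intro: less_imp_le\<close>)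
  also have "\<dots> = (\<Sum>i\<in>S. w i * x i)" using x' by (intro sum.cong) auto
  finally show ?thesis .
qed

text \<open>After each factor is divided by its integral, the weighted arithmetic-geometric mean
  inequality holds pointwise, and its right-hand side integrates to
  \<open>sum w J = 1\<close>.\<close>

lemma nn_integral_prod_Holder:
  fixes f :: "'j \<Rightarrow> 'a \<Rightarrow> ennreal"
  assumes J: "finite J" and w: "\<And>j. j \<in> J \<Longrightarrow> w j > 0" "sum w J = 1"
    and f[measurable]: "\<And>j. j \<in> J \<Longrightarrow> f j \<in> borel_measurable M"
  shows "(\<integral>\<^sup>+x. (\<Prod>j\<in>J. epowr (f j x) (w j)) \<partial>M) \<le> (\<Prod>j\<in>J. epowr (\<integral>\<^sup>+x. f j x \<partial>M) (w j))"
proof -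
  \<comment> \<open>In \<open>ennreal\<close>, \<open>0 * top = 0\<close>; an infinite integral
    therefore makes the right-hand side infinite only when no integral vanishes, and the zero case
    has to be split off first.\<close>
  consider (zero) "\<exists>j\<in>J. (\<integral>\<^sup>+x. f j x \<partial>M) = 0"
    | (top) "\<forall>j\<in>J. (\<integral>\<^sup>+x. f j x \<partial>M) \<noteq> 0" "\<exists>j\<in>J. (\<integral>\<^sup>+x. f j x \<partial>M) = top"
    | (fin) "\<forall>j\<in>J. (\<integral>\<^sup>+x. f j x \<partial>M) \<noteq> 0" "\<forall>j\<in>J. (\<integral>\<^sup>+x. f j x \<partial>M) \<noteq> top" by blast
  then show ?thesis
  proof cases
    case zero
    then obtain j where j: "j \<in> J" "(\<integral>\<^sup>+x. f j x \<partial>M) = 0" by blast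
    then have "AE x in M. f j x = 0" using nn_integral_0_iff_AE[OF f] by blast
    then have "AE x in M. (\<Prod>j\<in>J. epowr (f j x) (w j)) = 0"
      by eventually_elim (use J j in \<open>auto simp: epowr_eq_0_iff\<close>)
    then have "(\<integral>\<^sup>+x. (\<Prod>j\<in>J. epowr (f j x) (w j)) \<partial>M) = (\<integral>\<^sup>+x. 0 \<partial>M)" by (rule nn_integral_cong_AE)
    then show ?thesis by simp
  next
    case top
    then have "(\<Prod>j\<in>J. epowr (\<integral>\<^sup>+x. f j x \<partial>M) (w j)) = top"
      using J by (simp add: ennreal_prod_eq_top epowr_eq_0_iff epowr_eq_top_iff)
    then show ?thesis by simp
  next
    case fin
    define c where "c j = enn2real (\<integral>\<^sup>+x. f j x \<partial>M)" for j
    have c: "(\<integral>\<^sup>+x. f j x \<partial>M) = ennreal (c j)" "c j > 0" if "j \<in> J" for j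
      using fin that by (auto simp: c_def less_top enn2real_positive_iff zero_less_iff_neq_zero)
    define C where "C = (\<Prod>j\<in>J. c j powr w j)"
    have C: "C > 0" unfolding C_def
    proof (rule prod_pos)
      fix j assume "j \<in> J"
      from c(2)[OF this] show "0 < c j powr w j" by simp
    qed
    have "AE x in M. f j x \<noteq> top" if "j \<in> J" for j
      using nn_integral_PInf_AE[OF f] fin that by auto
    then have "AE x in M. \<forall>j\<in>J. f j x \<noteq> top" using J by (simp add: AE_finite_all)
    then have "AE x in M. (\<Prod>j\<in>J. epowr (f j x) (w j)) \<le> ennreal C * (\<Sum>j\<in>J. ennreal (w j / c j) * f j x)"
    proof eventually_elim
      case (elim x)
      define r where "r j = enn2real (f j x)" for j
      have r: "f j x = ennreal (r j)" "r j \<ge> 0" if "j \<in> J" for j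
        using elim that by (auto simp: r_def less_top)
      have "(\<Prod>j\<in>J. epowr (f j x) (w j)) = (\<Prod>j\<in>J. ennreal (r j powr w j))"
        using r by (intro prod.cong) (auto simp: epowr_ennreal)
      also have "\<dots> = ennreal (\<Prod>j\<in>J. r j powr w j)" by (rule prod_ennreal) auto
      also have "(\<Prod>j\<in>J. r j powr w j) = C * (\<Prod>j\<in>J. (r j / c j) powr w j)"
        unfolding C_def prod.distrib[symmetric] using r(2) c(2)
        by (intro prod.cong) (auto simp: powr_divide less_imp_le dest!: c(2))
      also have "\<dots> \<le> C * (\<Sum>j\<in>J. w j * (r j / c j))"
        using C r(2) c(2) w by (intro mult_left_mono weighted_arith_geom_mean J) (auto simp: less_imp_le)
      also have "ennreal (C * (\<Sum>j\<in>J. w j * (r j / c j))) = ennreal C * (\<Sum>j\<in>J. ennreal (w j / c j * r j))"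
        using C r(2) c(2) w(1)
        by (subst sum_ennreal) (auto simp: ennreal_mult less_imp_le sum_nonneg intro!: divide_nonneg_pos mult_nonneg_nonneg)
      also have "\<dots> = ennreal C * (\<Sum>j\<in>J. ennreal (w j / c j) * f j x)"
      proof (intro arg_cong2[where f=times] sum.cong refl)
        fix j assume j: "j \<in> J"
        show "ennreal (w j / c j * r j) = ennreal (w j / c j) * f j x"
          using ennreal_mult[of "w j / c j" "r j"] r[OF j] c(2)[OF j] w(1)[OF j] by (simp only: divide_nonneg_pos less_imp_le)
      qed
      finally show ?case by (simp add: ennreal_leI)
    qed
    then have "(\<integral>\<^sup>+x. (\<Prod>j\<in>J. epowr (f j x) (w j)) \<partial>M) \<le> (\<integral>\<^sup>+x. ennreal C * (\<Sum>j\<in>J. ennreal (w j / c j) * f j x) \<partial>M)"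
      by (rule nn_integral_mono_AE)
    also have "\<dots> = ennreal C * (\<Sum>j\<in>J. ennreal (w j / c j) * (\<integral>\<^sup>+x. f j x \<partial>M))"
      by (simp add: nn_integral_cmult nn_integral_sum)
    also have "(\<Sum>j\<in>J. ennreal (w j / c j) * (\<integral>\<^sup>+x. f j x \<partial>M)) = (\<Sum>j\<in>J. ennreal (w j))"
    proof (intro sum.cong refl)
      fix j assume j: "j \<in> J"
      show "ennreal (w j / c j) * (\<integral>\<^sup>+x. f j x \<partial>M) = ennreal (w j)"
        using ennreal_mult[of "w j / c j" "c j", symmetric] c[OF j] w(1)[OF j] by simp
    qed
    also have "\<dots> = 1" using w by (subst sum_ennreal) (auto simp: less_imp_le)
    also have "ennreal C * 1 = (\<Prod>j\<in>J. epowr (\<integral>\<^sup>+x. f j x \<partial>M) (w j))"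
      unfolding C_def using c by (simp add: prod_ennreal[symmetric] epowr_ennreal less_imp_le cong: prod.cong)
    finally show ?thesis .
  qed
qed

section \<open>Iterated integrals along given directions\<close>

definition line_integral :: "'a::euclidean_space \<Rightarrow> ('a \<Rightarrow> ennreal) \<Rightarrow> 'a \<Rightarrow> ennreal" where
  "line_integral v g x = (\<integral>\<^sup>+t. g (x + t *\<^sub>R v) \<partial>lborel)"

text \<open>A list of directions instead of a set allows induction on the number of integrations
  with a free base point; for Borel functions the order is immaterial by Tonelli's theorem.\<close>

primrec iter_integral :: "('i \<Rightarrow> 'a::euclidean_space) \<Rightarrow> 'i list \<Rightarrow> ('a \<Rightarrow> ennreal) \<Rightarrow> 'a \<Rightarrow> ennreal" where
  "iter_integral e [] g = g"
| "iter_integral e (k # ks) g = line_integral (e k) (iter_integral e ks g)"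

lemma borel_measurable_line_integral[measurable]:
  assumes [measurable]: "g \<in> borel_measurable borel"
  shows "line_integral v g \<in> borel_measurable borel"
  unfolding line_integral_def[abs_def] by measurable

lemma borel_measurable_iter_integral[measurable]:
  "g \<in> borel_measurable borel \<Longrightarrow> iter_integral e ks g \<in> borel_measurable borel"
  by (induction ks) auto

lemma line_integral_translate:
  assumes "g \<in> borel_measurable borel"
  shows "line_integral v g (x + s *\<^sub>R v) = line_integral v g x"
proof -
  have "line_integral v g x = (\<integral>\<^sup>+t. g (x + (s + 1 * t) *\<^sub>R v) \<partial>lborel)"
    unfolding line_integral_def
    by (subst nn_integral_real_affine[where c=1 and t=s]) (use assms in auto)
  then show ?thesis by (simp add: line_integral_def scaleR_left_distrib add.assoc)
qed

lemma iter_integral_translate: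
  "(\<And>x. g (x + w) = g x) \<Longrightarrow> iter_integral e ks g (x + w) = iter_integral e ks g x"
proof (induction ks arbitrary: x)
  case (Cons k ks)
  have "x + w + t *\<^sub>R e k = x + t *\<^sub>R e k + w" for t by (simp add: algebra_simps)
  then show ?case using Cons by (simp only: iter_integral.simps line_integral_def)
qed simp

lemma line_integral_commute:
  assumes [measurable]: "g \<in> borel_measurable borel"
  shows "line_integral v (line_integral w g) = line_integral w (line_integral v g)"
proof
  fix x
  have "line_integral v (line_integral w g) x = (\<integral>\<^sup>+t. \<integral>\<^sup>+s. g (x + t *\<^sub>R v + s *\<^sub>R w) \<partial>lborel \<partial>lborel)"
    by (simp add: line_integral_def)
  also have "\<dots> = (\<integral>\<^sup>+s. \<integral>\<^sup>+t. g (x + t *\<^sub>R v + s *\<^sub>R w) \<partial>lborel \<partial>lborel)"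
    by (rule lborel_pair.Fubini') measurable
  also have "\<dots> = line_integral w (line_integral v g) x"
    by (simp add: line_integral_def add.assoc add.commute[of "_ *\<^sub>R v"])
  finally show "line_integral v (line_integral w g) x = line_integral w (line_integral v g) x" .
qed

lemma iter_integral_line_integral:
  assumes "g \<in> borel_measurable borel"
  shows "iter_integral e ks (line_integral v g) = line_integral v (iter_integral e ks g)"
  using assms by (induction ks) (auto simp: line_integral_commute)

lemma iter_integral_eq_nn_integral_PiM:
  fixes e :: "'i \<Rightarrow> 'a::euclidean_space"
  assumes "distinct ks" and [measurable]: "g \<in> borel_measurable borel"
  shows "iter_integral e ks g x = (\<integral>\<^sup>+f. g (x + (\<Sum>k\<in>set ks. f k *\<^sub>R e k)) \<partial>(\<Pi>\<^sub>M k\<in>set ks. lborel))"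
  using assms(1)
proof (induction ks arbitrary: x)
  case Nil
  have "(\<integral>\<^sup>+f. g x \<partial>(\<Pi>\<^sub>M k\<in>({}::'i set). lborel::real measure)) = g x"
    by (simp add: PiM_empty)
  then show ?case by simp
next
  case (Cons k ks)
  interpret product_sigma_finite "\<lambda>_::'i. lborel::real measure" ..
  have k: "k \<notin> set ks" using Cons.prems by simp
  have "(\<integral>\<^sup>+f. g (x + (\<Sum>k\<in>set (k # ks). f k *\<^sub>R e k)) \<partial>(\<Pi>\<^sub>M k\<in>set (k # ks). lborel))
     = (\<integral>\<^sup>+t. \<integral>\<^sup>+f. g (x + (\<Sum>j\<in>set (k # ks). (f(k := t)) j *\<^sub>R e j)) \<partial>(\<Pi>\<^sub>M k\<in>set ks. lborel) \<partial>lborel)"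
    using k by (simp del: sum.insert fun_upd_apply) (subst product_nn_integral_insert_rev, auto)
  also have "\<dots> = (\<integral>\<^sup>+t. \<integral>\<^sup>+f. g (x + t *\<^sub>R e k + (\<Sum>j\<in>set ks. f j *\<^sub>R e j)) \<partial>(\<Pi>\<^sub>M k\<in>set ks. lborel) \<partial>lborel)"
  proof (intro nn_integral_cong arg_cong[where f=g])
    fix t f
    have "(\<Sum>j\<in>set ks. (f(k := t)) j *\<^sub>R e j) = (\<Sum>j\<in>set ks. f j *\<^sub>R e j)"
      using k by (intro sum.cong) auto
    then show "x + (\<Sum>j\<in>set (k # ks). (f(k := t)) j *\<^sub>R e j) = x + t *\<^sub>R e k + (\<Sum>j\<in>set ks. f j *\<^sub>R e j)"
      using k by (simp add: add.assoc)
  qed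
  also have "\<dots> = iter_integral e (k # ks) g x"
    using Cons by (simp add: line_integral_def)
  finally show ?case by simp
qed

text \<open>The induction behind Loomis-Whitney. Along \<open>e k\<close> the factor with index
  \<open>k\<close> is constant, since it is already a line integral in that direction, and leaves
  the integral; the other \<open>N - 1\<close> factors carry the exponent \<open>1 / (N - 1)\<close>
  each, which is exactly what Hoelder's inequality requires. \<open>remove1\<close> records that the
  factor with index \<open>i\<close> is never integrated along \<open>e i\<close> a second
  time.\<close>

lemma iter_integral_prod_line_integral_le:
  fixes e :: "'n::finite \<Rightarrow> 'a::euclidean_space"
  assumes N: "CARD('n) \<ge> 2" and [measurable]: "\<And>i. g i \<in> borel_measurable borel" and "distinct ks"
  shows "iter_integral e ks (\<lambda>x. \<Prod>i\<in>UNIV. epowr (line_integral (e i) (g i) x) (1 / real (CARD('n) - 1))) x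
    \<le> (\<Prod>i\<in>UNIV. epowr (iter_integral e (remove1 i ks) (line_integral (e i) (g i)) x) (1 / real (CARD('n) - 1)))"
  using assms(3)
proof (induction ks arbitrary: x)
  case (Cons k ks)
  let ?a = "1 / real (CARD('n) - 1)"
  define F where "F = (\<lambda>x. \<Prod>i\<in>UNIV. epowr (line_integral (e i) (g i) x) ?a)"
  define H where "H i = iter_integral e (remove1 i ks) (line_integral (e i) (g i))" for i
  have [measurable]: "H i \<in> borel_measurable borel" for i unfolding H_def by measurable
  have k: "k \<notin> set ks" "distinct ks" using Cons.prems by auto
  have Hk: "H k (x + t *\<^sub>R e k) = H k x" for x t
    unfolding H_def by (intro iter_integral_translate line_integral_translate) auto
  have "iter_integral e (k # ks) F x = (\<integral>\<^sup>+t. iter_integral e ks F (x + t *\<^sub>R e k) \<partial>lborel)"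
    by (simp add: line_integral_def)
  also have "\<dots> \<le> (\<integral>\<^sup>+t. (\<Prod>i\<in>UNIV. epowr (H i (x + t *\<^sub>R e k)) ?a) \<partial>lborel)"
    using Cons.IH[OF k(2)] unfolding H_def F_def by (rule nn_integral_mono)
  also have "\<dots> = (\<integral>\<^sup>+t. epowr (H k x) ?a * (\<Prod>i\<in>UNIV - {k}. epowr (H i (x + t *\<^sub>R e k)) ?a) \<partial>lborel)"
    by (subst prod.remove[of UNIV k]) (auto simp: Hk)
  also have "\<dots> = epowr (H k x) ?a * (\<integral>\<^sup>+t. (\<Prod>i\<in>UNIV - {k}. epowr (H i (x + t *\<^sub>R e k)) ?a) \<partial>lborel)"
    by (rule nn_integral_cmult) measurable
  also have "\<dots> \<le> epowr (H k x) ?a * (\<Prod>i\<in>UNIV - {k}. epowr (\<integral>\<^sup>+t. H i (x + t *\<^sub>R e k) \<partial>lborel) ?a)"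
    by (intro mult_left_mono nn_integral_prod_Holder) (use N in auto)
  also have "\<dots> = (\<Prod>i\<in>UNIV. epowr (iter_integral e (remove1 i (k # ks)) (line_integral (e i) (g i)) x) ?a)"
  proof -
    have rem: "(\<Prod>i\<in>UNIV. A i) = A k * (\<Prod>i\<in>UNIV - {k}. A i)" for A :: "'n \<Rightarrow> ennreal"
      by (rule prod.remove) auto
    show ?thesis
      unfolding rem using k(1)
      by (intro arg_cong2[where f=times] prod.cong) (auto simp: H_def line_integral_def remove1_idem)
  qed
  finally show ?case unfolding F_def .
qed simp

section \<open>Volume in oblique coordinates\<close>

lemma measurable_vec_lambda[measurable]:
  "vec_lambda \<in> borel_measurable (\<Pi>\<^sub>M k\<in>(UNIV::'n::finite set). (lborel :: real measure))"
proof (subst borel_measurable_euclidean_space, intro ballI)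
  fix b :: "real^'n" assume "b \<in> Basis"
  then obtain k where "b = axis k 1" by (auto simp: Basis_vec_def)
  then show "(\<lambda>f. vec_lambda f \<bullet> b) \<in> borel_measurable (\<Pi>\<^sub>M k\<in>(UNIV::'n set). (lborel :: real measure))"
    by (simp add: cart_eq_inner_axis[symmetric])
qed

lemma lborel_vec_eq_distr_PiM:
  "lborel = distr (\<Pi>\<^sub>M k\<in>(UNIV::'n::finite set). lborel) borel (\<lambda>f. \<chi> k. (f k :: real))"
proof (rule lborel_eqI)
  interpret product_sigma_finite "\<lambda>_::'n. lborel::real measure" ..
  fix l u :: "real^'n" assume lu: "\<And>b. b \<in> Basis \<Longrightarrow> l \<bullet> b \<le> u \<bullet> b"
  have lu': "l $ i \<le> u $ i" for i using lu[of "axis i 1"] by (simp add: cart_eq_inner_axis)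
  have "emeasure (distr (\<Pi>\<^sub>M k\<in>(UNIV::'n set). lborel) borel (\<lambda>f. \<chi> k. (f k :: real))) (box l u)
    = emeasure (\<Pi>\<^sub>M k\<in>(UNIV::'n set). lborel) ((\<lambda>f. \<chi> k. f k) -` box l u \<inter> space (\<Pi>\<^sub>M k\<in>(UNIV::'n set). (lborel::real measure)))"
    by (rule emeasure_distr) auto
  also have "(\<lambda>f. \<chi> k. f k) -` box l u \<inter> space (\<Pi>\<^sub>M k\<in>(UNIV::'n set). (lborel::real measure)) = (\<Pi>\<^sub>E k\<in>UNIV. {l $ k<..<u $ k})"
    by (auto simp: mem_box_cart space_PiM PiE_def Pi_iff)
  also have "emeasure (\<Pi>\<^sub>M k\<in>(UNIV::'n set). lborel) (\<Pi>\<^sub>E k\<in>UNIV. {l $ k<..<u $ k}) = (\<Prod>k\<in>UNIV. ennreal (u $ k - l $ k))"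
    using lu' by (subst emeasure_PiM) auto
  also have "\<dots> = ennreal (\<Prod>k\<in>UNIV. u $ k - l $ k)"
    using lu' by (intro prod_ennreal) auto
  also have "(\<Prod>k\<in>UNIV. u $ k - l $ k) = (\<Prod>b\<in>Basis. (u - l) \<bullet> b)"
    unfolding Basis_vec_def by (subst prod.UNION_disjoint) (auto simp: axis_eq_axis cart_eq_inner_axis inner_diff_left)
  finally show "emeasure (distr (\<Pi>\<^sub>M k\<in>(UNIV::'n set). lborel) borel (\<lambda>f. \<chi> k. (f k :: real))) (box l u)
    = (\<Prod>b\<in>Basis. (u - l) \<bullet> b)" .
qed simp

lemma nn_integral_lborel_translate:
  fixes f :: "'a::euclidean_space \<Rightarrow> ennreal"
  assumes [measurable]: "f \<in> borel_measurable borel"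
  shows "(\<integral>\<^sup>+x. f (x + v) \<partial>lborel) = (\<integral>\<^sup>+x. f x \<partial>lborel)"
proof -
  have "(\<integral>\<^sup>+x. f x \<partial>lborel) = (\<integral>\<^sup>+x. f x \<partial>distr lborel borel ((+) v))"
    by (simp only: lborel_distr_plus)
  also have "\<dots> = (\<integral>\<^sup>+x. f (x + v) \<partial>lborel)" by (subst nn_integral_distr) (auto simp: add.commute)
  finally show ?thesis by simp
qed

text \<open>The determinant formula of \<^theory>\<open>HOL-Analysis.Change_Of_Vars\<close> needs a well-ordered index type;
  here only the uniqueness of translation-invariant measures up to a factor is used.\<close>

lemma nn_integral_linear_change:
  fixes T :: "'a::euclidean_space \<Rightarrow> 'a"
  assumes T: "linear T" "inj T"
  obtains c where "c > 0" "\<And>g. g \<in> borel_measurable borel \<Longrightarrow>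
    (\<integral>\<^sup>+x. g (T x) \<partial>lborel) = ennreal c * (\<integral>\<^sup>+x. g x \<partial>lborel)"
proof -
  obtain S where S: "linear S" "\<And>x. S (T x) = x" "\<And>x. T (S x) = x"
    using linear_injective_isomorphism[OF T] by blast
  have cont: "continuous_on UNIV T" using T(1) by (simp add: linear_continuous_on linear_linear)
  then have [measurable]: "T \<in> borel_measurable borel" by (rule borel_measurable_continuous_onI)
  define b :: "'a \<Rightarrow> ennreal" where "b = indicator (ball 0 1)"
  have [measurable]: "b \<in> borel_measurable borel" unfolding b_def by (rule borel_measurable_indicator) simp
  have "T -` ball 0 1 = S ` ball 0 1"
  proof (intro set_eqI iffI)
    fix x assume "x \<in> T -` ball 0 1"
    then show "x \<in> S ` ball 0 1" using S(2)[of x] by (intro image_eqI[of _ _ "T x"]) auto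
  qed (use S(3) in auto)
  then have bd: "bounded (T -` ball 0 1)"
    using bounded_linear_image[of "ball 0 1" S] S(1) by (simp add: linear_linear)
  have op: "open (T -` ball 0 1)" using open_vimage[OF open_ball cont] .
  have "0 \<in> T -` ball 0 1" using linear_0[OF T(1)] by simp
  then have ne: "T -` ball 0 1 \<noteq> {}" by blast
  have pos0: "emeasure lborel A > 0" if "open A" "A \<noteq> {}" for A :: "'a set"
    using open_not_negligible[OF that] that(1)
    by (auto simp: negligible_iff_emeasure0 zero_less_iff_neq_zero emeasure_completion)
  have pos: "emeasure lborel (T -` ball 0 1) > 0" "emeasure lborel (ball 0 1 :: 'a set) > 0"
    using pos0[OF op ne] pos0[of "ball 0 1"] by auto
  have fin: "emeasure lborel (T -` ball 0 1) < \<infinity>" "emeasure lborel (ball 0 1 :: 'a set) < \<infinity>"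
    using emeasure_bounded_finite[OF bd] emeasure_bounded_finite[of "ball 0 1 :: 'a set"] by auto
  obtain p where p: "emeasure lborel (T -` ball 0 1) = ennreal p" "p > 0"
    using pos(1) fin(1) by (cases "emeasure lborel (T -` ball 0 1)") (auto simp: ennreal_less_zero_iff)
  obtain q where q: "emeasure lborel (ball 0 1 :: 'a set) = ennreal q" "q > 0"
    using pos(2) fin(2) by (cases "emeasure lborel (ball 0 1 :: 'a set)") (auto simp: ennreal_less_zero_iff)
  have ib: "(\<integral>\<^sup>+y. b y \<partial>lborel) = ennreal q" by (simp add: b_def q(1))
  have TS: "T (x + S y) = T x + y" for x y using T(1) S(3) by (simp add: linear_add)
  \<comment> \<open>The double integral of \<open>g (T x) * b y\<close> is computed twice. The
    translations by \<open>S y\<close> and \<open>T x\<close> move the map \<open>T\<close> from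
    \<open>g\<close> to \<open>b\<close>, whose integral is \<open>q\<close> without
    \<open>T\<close> and \<open>p\<close> with it; this is the uniqueness argument for invariant
    measures.\<close>
  have eq: "(\<integral>\<^sup>+x. g (T x) \<partial>lborel) * ennreal q = (\<integral>\<^sup>+x. g x \<partial>lborel) * ennreal p"
    if [measurable]: "g \<in> borel_measurable borel" for g
  proof -
    have "(\<integral>\<^sup>+x. g (T x) \<partial>lborel) * ennreal q = (\<integral>\<^sup>+y. (\<integral>\<^sup>+x. g (T x) * b y \<partial>lborel) \<partial>lborel)"
      by (simp add: nn_integral_multc nn_integral_cmult ib)
    also have "\<dots> = (\<integral>\<^sup>+y. (\<integral>\<^sup>+x. g (T x + y) * b y \<partial>lborel) \<partial>lborel)"
    proof (rule nn_integral_cong)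
      fix y
      show "(\<integral>\<^sup>+x. g (T x) * b y \<partial>lborel) = (\<integral>\<^sup>+x. g (T x + y) * b y \<partial>lborel)"
        using nn_integral_lborel_translate[of "\<lambda>x. g (T x) * b y" "S y"] by (simp add: TS)
    qed
    also have "\<dots> = (\<integral>\<^sup>+x. (\<integral>\<^sup>+y. g (T x + y) * b y \<partial>lborel) \<partial>lborel)"
      by (rule lborel_pair.Fubini') measurable
    also have "\<dots> = (\<integral>\<^sup>+x. (\<integral>\<^sup>+y. g y * b (y - T x) \<partial>lborel) \<partial>lborel)"
    proof (rule nn_integral_cong)
      fix x
      show "(\<integral>\<^sup>+y. g (T x + y) * b y \<partial>lborel) = (\<integral>\<^sup>+y. g y * b (y - T x) \<partial>lborel)"
        using nn_integral_lborel_translate[of "\<lambda>y. g y * b (y - T x)" "T x"] by (simp add: add.commute)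
    qed
    also have "\<dots> = (\<integral>\<^sup>+y. (\<integral>\<^sup>+x. g y * b (y - T x) \<partial>lborel) \<partial>lborel)"
      by (rule lborel_pair.Fubini') measurable
    also have "\<dots> = (\<integral>\<^sup>+y. g y * ennreal p \<partial>lborel)"
    proof (rule nn_integral_cong)
      fix y
      have "(\<integral>\<^sup>+x. g y * b (y - T x) \<partial>lborel) = g y * (\<integral>\<^sup>+x. b (y - T x) \<partial>lborel)"
        by (rule nn_integral_cmult) measurable
      also have "(\<integral>\<^sup>+x. b (y - T x) \<partial>lborel) = (\<integral>\<^sup>+x. b (- T x) \<partial>lborel)"
        using nn_integral_lborel_translate[of "\<lambda>x. b (y - T x)" "S y"] by (simp add: TS)
      \<comment> \<open>The ball is symmetric about 0, so the sign is harmless.\<close>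
      also have "\<dots> = (\<integral>\<^sup>+x. indicator (T -` ball 0 1) x \<partial>lborel)"
        by (rule nn_integral_cong) (simp add: b_def indicator_def)
      also have "\<dots> = ennreal p" using op p(1) by simp
      finally show "(\<integral>\<^sup>+x. g y * b (y - T x) \<partial>lborel) = g y * ennreal p" .
    qed
    also have "\<dots> = (\<integral>\<^sup>+x. g x \<partial>lborel) * ennreal p" by (rule nn_integral_multc) simp
    finally show ?thesis .
  qed
  show ?thesis
  proof (rule that[of "p / q"])
    fix g :: "'a \<Rightarrow> ennreal" assume "g \<in> borel_measurable borel"
    note e = eq[OF this]
    have q1: "ennreal q * ennreal (1 / q) = 1" using q(2) by (simp flip: ennreal_mult)
    have p1: "ennreal p * ennreal (1 / q) = ennreal (p / q)" using p(2) q(2) by (simp flip: ennreal_mult)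
    have "(\<integral>\<^sup>+x. g (T x) \<partial>lborel) = (\<integral>\<^sup>+x. g (T x) \<partial>lborel) * ennreal q * ennreal (1 / q)"
      by (simp only: mult.assoc q1 mult_1_right)
    also have "\<dots> = (\<integral>\<^sup>+x. g x \<partial>lborel) * ennreal (p / q)"
      by (simp only: e mult.assoc p1)
    finally show "(\<integral>\<^sup>+x. g (T x) \<partial>lborel) = ennreal (p / q) * (\<integral>\<^sup>+x. g x \<partial>lborel)"
      by (simp only: mult.commute)
  qed (use p q in simp)
qed

text \<open>For independent directions the iterated integral is an integral in the linear
  coordinates given by \<open>T\<close>, and \<open>c\<close> is the factor by which they change
  volume; it is the same for every order of integration and every \<open>g\<close>.\<close>

lemma iter_integral_UNIV:
  fixes e :: "'n::finite \<Rightarrow> real^'n"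
  assumes e: "\<And>c. (\<Sum>k\<in>UNIV. c k *\<^sub>R e k) = 0 \<Longrightarrow> c = (\<lambda>_. 0)"
  obtains c where "c > 0" "\<And>ks g. distinct ks \<Longrightarrow> set ks = UNIV \<Longrightarrow> g \<in> borel_measurable borel \<Longrightarrow>
    iter_integral e ks g 0 = ennreal c * (\<integral>\<^sup>+x. g x \<partial>lborel)"
proof -
  define T :: "real^'n \<Rightarrow> real^'n" where "T x = (\<Sum>k\<in>UNIV. x $ k *\<^sub>R e k)" for x
  have lin: "linear T"
    by (rule linearI) (simp_all add: T_def scaleR_left_distrib sum.distrib scaleR_sum_right)
  have "inj T"
    unfolding linear_injective_0[OF lin]
  proof (intro allI impI)
    fix x assume "T x = 0"
    then have "(\<lambda>k. x $ k) = (\<lambda>_. 0)" unfolding T_def by (rule e)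
    then show "x = 0" by (simp add: vec_eq_iff fun_eq_iff)
  qed
  from nn_integral_linear_change[OF lin this]
  obtain c where c: "c > 0" "\<And>g. g \<in> borel_measurable borel \<Longrightarrow>
    (\<integral>\<^sup>+x. g (T x) \<partial>lborel) = ennreal c * (\<integral>\<^sup>+x. g x \<partial>lborel)" by blast
  have [measurable]: "T \<in> borel_measurable borel"
    using lin by (intro borel_measurable_continuous_onI linear_continuous_on) (simp add: linear_linear)
  show ?thesis
  proof (rule that[OF c(1)])
    fix ks :: "'n list" and g :: "real^'n \<Rightarrow> ennreal"
    assume ks: "distinct ks" "set ks = UNIV" and [measurable]: "g \<in> borel_measurable borel"
    have "iter_integral e ks g 0 = (\<integral>\<^sup>+f. g (T (\<chi> k. f k)) \<partial>(\<Pi>\<^sub>M k\<in>(UNIV::'n set). lborel))"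
      using iter_integral_eq_nn_integral_PiM[OF ks(1), of g e 0] ks(2) by (simp add: T_def)
    also have "\<dots> = (\<integral>\<^sup>+x. g (T x) \<partial>distr (\<Pi>\<^sub>M k\<in>(UNIV::'n set). lborel) borel (\<lambda>f. \<chi> k. (f k :: real)))"
      by (subst nn_integral_distr) auto
    also have "\<dots> = (\<integral>\<^sup>+x. g (T x) \<partial>lborel)" by (simp only: lborel_vec_eq_distr_PiM[symmetric])
    finally show "iter_integral e ks g 0 = ennreal c * (\<integral>\<^sup>+x. g x \<partial>lborel)" using c(2) by simp
  qed
qed

text \<open>At the base point 0, with all directions integrated, the left-hand side and every factor
  on the right of the inductive inequality become integrals over the whole space.\<close>

theorem Loomis_Whitney:
  fixes e :: "'n::finite \<Rightarrow> real^'n"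
  assumes N: "CARD('n) \<ge> 2" and e: "\<And>c. (\<Sum>k\<in>UNIV. c k *\<^sub>R e k) = 0 \<Longrightarrow> c = (\<lambda>_. 0)"
  obtains K where "K > 0" "\<And>g. g \<in> borel_measurable borel \<Longrightarrow>
    (\<integral>\<^sup>+x. (\<Prod>i\<in>UNIV. epowr (line_integral (e i) g x) (1 / real (CARD('n) - 1))) \<partial>lborel)
      \<le> ennreal K * epowr (\<integral>\<^sup>+x. g x \<partial>lborel) (1 / real (CARD('n) - 1)) ^ CARD('n)"
proof (rule iter_integral_UNIV[OF e])
  fix c :: real
  assume c: "c > 0" "\<And>ks g. distinct ks \<Longrightarrow> set ks = UNIV \<Longrightarrow> g \<in> borel_measurable borel \<Longrightarrow>
    iter_integral e ks g 0 = ennreal c * (\<integral>\<^sup>+x. g x \<partial>lborel)"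
  let ?a = "1 / real (CARD('n) - 1)"
  obtain ks :: "'n list" where ks: "distinct ks" "set ks = UNIV" using finite_distinct_list[OF finite] by metis
  show ?thesis
  \<comment> \<open>Each of the \<open>N\<close> factors contributes \<open>c powr ?a\<close>, and
    the integral on the left contributes one \<open>c\<close> to the denominator.\<close>
  proof (rule that[of "(c powr ?a) ^ CARD('n) / c"])
    fix g :: "real^'n \<Rightarrow> ennreal" assume g[measurable]: "g \<in> borel_measurable borel"
    let ?F = "\<lambda>x. \<Prod>i\<in>UNIV. epowr (line_integral (e i) g x) ?a"
    have "ennreal c * (\<integral>\<^sup>+x. ?F x \<partial>lborel) = iter_integral e ks ?F 0"
      by (rule c(2)[OF ks, symmetric]) measurable
    also have "\<dots> \<le> (\<Prod>i\<in>UNIV. epowr (iter_integral e (remove1 i ks) (line_integral (e i) g) 0) ?a)"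
      by (rule iter_integral_prod_line_integral_le[OF N _ ks(1)]) measurable
    also have "\<dots> = (\<Prod>i\<in>(UNIV::'n set). epowr (ennreal c * (\<integral>\<^sup>+x. g x \<partial>lborel)) ?a)"
    proof (rule prod.cong[OF refl])
      fix i
      \<comment> \<open>Moving the line integral to the front makes the list a complete enumeration
        of the directions again.\<close>
      have "iter_integral e (remove1 i ks) (line_integral (e i) g) 0 = iter_integral e (i # remove1 i ks) g 0"
        by (simp add: iter_integral_line_integral)
      also have "\<dots> = ennreal c * (\<integral>\<^sup>+x. g x \<partial>lborel)"
        by (rule c(2)) (use ks in auto)
      finally show "epowr (iter_integral e (remove1 i ks) (line_integral (e i) g) 0) ?a
        = epowr (ennreal c * (\<integral>\<^sup>+x. g x \<partial>lborel)) ?a" by (rule arg_cong[where f="\<lambda>y. epowr y ?a"])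
    qed
    also have "\<dots> = ennreal ((c powr ?a) ^ CARD('n)) * epowr (\<integral>\<^sup>+x. g x \<partial>lborel) ?a ^ CARD('n)"
      using c(1) by (simp add: epowr_mult power_mult_distrib ennreal_power)
    finally have *: "ennreal c * (\<integral>\<^sup>+x. ?F x \<partial>lborel)
      \<le> ennreal ((c powr ?a) ^ CARD('n)) * epowr (\<integral>\<^sup>+x. g x \<partial>lborel) ?a ^ CARD('n)" .
    have c1: "ennreal (1 / c) * ennreal c = 1" using c(1) by (simp flip: ennreal_mult)
    have c2: "ennreal (1 / c) * ennreal ((c powr ?a) ^ CARD('n)) = ennreal ((c powr ?a) ^ CARD('n) / c)"
      using c(1) by (simp flip: ennreal_mult)
    have "(\<integral>\<^sup>+x. ?F x \<partial>lborel) = ennreal (1 / c) * (ennreal c * (\<integral>\<^sup>+x. ?F x \<partial>lborel))"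
      by (simp only: mult.assoc[symmetric] c1 mult_1_left)
    also have "\<dots> \<le> ennreal (1 / c) * (ennreal ((c powr ?a) ^ CARD('n)) * epowr (\<integral>\<^sup>+x. g x \<partial>lborel) ?a ^ CARD('n))"
      by (rule mult_left_mono[OF *]) simp
    finally show "(\<integral>\<^sup>+x. ?F x \<partial>lborel) \<le> ennreal ((c powr ?a) ^ CARD('n) / c) * epowr (\<integral>\<^sup>+x. g x \<partial>lborel) ?a ^ CARD('n)"
      by (simp only: mult.assoc[symmetric] c2)
  qed (use c(1) in simp)
qed

section \<open>The Sobolev embedding into the square-integrable functions\<close>

text \<open>Near a boundary point the graph direction \<open>e\<close> is tilted slightly towards
  each coordinate axis. Along \<open>e + \<eta> axis k\<close> a point at parameter \<open>t\<close>
  has risen by at least \<open>t (1 - \<eta>)\<close>, whereas the graph below it has risen by at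
  most \<open>L \<eta> t\<close>, so \<open>\<eta> (1 + L) < 1\<close> keeps the point
  inside.\<close>

lemma lipschitz_domain_local_segments:
  fixes \<Omega> :: "(real^'n) set"
  assumes "open \<Omega>" "lipschitz_boundary \<Omega>" "z \<in> closure \<Omega>"
  shows "\<exists>U e h. open U \<and> z \<in> U \<and> h > 0 \<and> (\<forall>c. (\<Sum>k\<in>UNIV. c k *\<^sub>R e k) = 0 \<longrightarrow> c = (\<lambda>_::'n. 0)) \<and>
    (\<forall>x k t. x \<in> \<Omega> \<inter> U \<longrightarrow> 0 \<le> t \<longrightarrow> t \<le> h \<longrightarrow> x + t *\<^sub>R e k \<in> \<Omega>)"
proof (cases "z \<in> \<Omega>")
  case True
  then obtain r where r: "r > 0" "ball z r \<subseteq> \<Omega>" using assms(1) open_contains_ball by blast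
  define e :: "'n \<Rightarrow> real^'n" where "e k = axis k 1" for k
  have "c = (\<lambda>_. 0)" if "(\<Sum>k\<in>UNIV. c k *\<^sub>R e k) = 0" for c
  proof
    fix i
    have "(\<Sum>k\<in>UNIV. c k *\<^sub>R e k) $ i = c i"
      by (simp add: e_def axis_def if_distrib[of "\<lambda>y. _ * y"] sum.delta cong: if_cong)
    then show "c i = 0" using that by simp
  qed
  moreover have "x + t *\<^sub>R e k \<in> \<Omega>" if "x \<in> \<Omega> \<inter> ball z (r/2)" "0 \<le> t" "t \<le> r/2" for x k t
  proof -
    have "dist z (x + t *\<^sub>R e k) \<le> dist z x + dist x (x + t *\<^sub>R e k)" by (rule dist_triangle)
    also have "\<dots> < r" using that by (simp add: dist_norm e_def)
    finally show ?thesis using r by auto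
  qed
  ultimately show ?thesis using r(1)
    by (intro exI[of _ "ball z (r/2)"] exI[of _ e] exI[of _ "r/2"]) auto
next
  case False
  then have "z \<in> frontier \<Omega>" using assms interior_subset by (auto simp: frontier_def)
  then obtain r e L \<gamma> where r: "r > 0" and e: "norm e = 1" and L: "L-lipschitz_on {y. y \<bullet> e = 0} \<gamma>"
    and gr: "\<Omega> \<inter> ball z r = {x \<in> ball z r. \<gamma> (x - (x \<bullet> e) *\<^sub>R e) < x \<bullet> e}"
    using assms(2) unfolding lipschitz_boundary_def by blast
  have L0: "L \<ge> 0" using L lipschitz_on_nonneg by blast
  define s where "s = (\<Sum>k\<in>UNIV. e $ k)"
  \<comment> \<open>The determinant of the tilted directions is
    \<open>\<eta>^(N-1) (s + \<eta>)\<close>, which explains the last condition. At most one value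
    of \<open>\<eta>\<close> violates it, so two candidates suffice.\<close>
  obtain \<eta> where \<eta>: "\<eta> > 0" "\<eta> * (1 + L) < 1" "s + \<eta> \<noteq> 0"
  proof (cases "s + 1 / (2 * (1 + L)) = 0")
    case True
    have "1 / (3 * (1 + L)) < 1 / (2 * (1 + L))" using L0 by (intro divide_strict_left_mono mult_strict_right_mono) auto
    then show ?thesis using L0 True by (intro that[of "1 / (3 * (1 + L))"]) auto
  next
    case False
    then show ?thesis using L0 by (intro that[of "1 / (2 * (1 + L))"]) auto
  qed
  have "0 \<le> L * \<eta>" using L0 \<eta>(1) by simp
  then have \<eta>1: "\<eta> < 1" using \<eta>(2) by (simp add: algebra_simps)
  define v where "v k = e + \<eta> *\<^sub>R axis k 1" for k
  have "c = (\<lambda>_. 0)" if c: "(\<Sum>k\<in>UNIV. c k *\<^sub>R v k) = 0" for c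
  proof -
    define S where "S = (\<Sum>k\<in>UNIV. c k)"
    have 1: "S * e $ i + \<eta> * c i = 0" for i
    proof -
      have "(\<Sum>k\<in>UNIV. c k *\<^sub>R v k) $ i = (\<Sum>k\<in>UNIV. c k * e $ i + (if k = i then \<eta> * c k else 0))"
        by (auto simp: v_def axis_def algebra_simps intro!: sum.cong)
      also have "\<dots> = S * e $ i + \<eta> * c i" by (simp add: sum.distrib sum_distrib_right S_def)
      finally show ?thesis using c by simp
    qed
    \<comment> \<open>Summing the coordinates gives an equation for \<open>S\<close> alone; once
      \<open>S = 0\<close>, every \<open>c i\<close> vanishes.\<close>
    have "(\<Sum>i\<in>UNIV. S * e $ i + \<eta> * c i) = 0" using 1 by simp
    then have "S * s + \<eta> * S = 0"
      by (simp add: sum.distrib sum_distrib_left[symmetric] flip: s_def S_def)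
    then have "S * (s + \<eta>) = 0" by (simp add: algebra_simps)
    then have "S = 0" using \<eta>(3) by simp
    then show ?thesis using 1 \<eta>(1) by auto
  qed
  moreover have "x + t *\<^sub>R v k \<in> \<Omega>" if x: "x \<in> \<Omega> \<inter> ball z (r/2)" and t: "0 \<le> t" "t \<le> r/4" for x k t
  proof -
    define a where "a = axis k 1 \<bullet> e"
    have a: "\<bar>a\<bar> \<le> 1" using Cauchy_Schwarz_ineq2[of "axis k 1" e] e by (simp add: a_def)
    let ?y = "x + t *\<^sub>R v k"
    \<comment> \<open>The start lies within \<open>r / 2\<close> of \<open>z\<close> and moves by at
      most \<open>2 * r / 4\<close>, so the graph description stays valid.\<close>
    have "norm (v k) \<le> 2" unfolding v_def using norm_triangle_ineq[of e "\<eta> *\<^sub>R axis k 1"] e \<eta>(1) \<eta>1 by simp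
    then have "norm (t *\<^sub>R v k) \<le> r / 2" using t mult_mono[of t "r/4" "norm (v k)" 2] by simp
    then have y: "?y \<in> ball z r" using x dist_triangle[of z ?y x] by (simp add: dist_norm)
    have ye: "?y \<bullet> e = x \<bullet> e + t * (1 + \<eta> * a)"
      using e by (simp add: v_def inner_add_left a_def dot_square_norm power2_eq_square algebra_simps)
    have proj: "(w - (w \<bullet> e) *\<^sub>R e) \<bullet> e = 0" for w
      using e by (simp add: inner_diff_left dot_square_norm)
    have d: "(?y - (?y \<bullet> e) *\<^sub>R e) - (x - (x \<bullet> e) *\<^sub>R e) = (t * \<eta>) *\<^sub>R (axis k 1 - a *\<^sub>R e)"
      unfolding ye by (simp add: v_def algebra_simps)
    have "norm (axis k 1 - a *\<^sub>R e) ^ 2 = 1 - a ^ 2"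
    proof -
      have "e \<bullet> e = 1" using e by (simp add: dot_square_norm)
      moreover have "axis k 1 \<bullet> (axis k 1 :: real^'n) = 1" by (simp add: inner_axis_axis)
      ultimately show ?thesis
        unfolding power2_norm_eq_inner
        by (simp add: inner_diff_left inner_diff_right a_def inner_commute power2_eq_square)
    qed
    then have "norm (axis k 1 - a *\<^sub>R e) ^ 2 \<le> 1" by simp
    then have n1: "norm (axis k 1 - a *\<^sub>R e) \<le> 1" using power2_le_imp_le[of "norm (axis k 1 - a *\<^sub>R e)" 1] by simp
    have "\<gamma> (?y - (?y \<bullet> e) *\<^sub>R e) \<le> \<gamma> (x - (x \<bullet> e) *\<^sub>R e) + L * norm ((t * \<eta>) *\<^sub>R (axis k 1 - a *\<^sub>R e))"
      using lipschitz_onD[OF L, of "?y - (?y \<bullet> e) *\<^sub>R e" "x - (x \<bullet> e) *\<^sub>R e"] proj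
      by (simp add: dist_norm d)
    also have "\<dots> \<le> \<gamma> (x - (x \<bullet> e) *\<^sub>R e) + L * (t * \<eta>)"
    proof -
      have "norm ((t * \<eta>) *\<^sub>R (axis k 1 - a *\<^sub>R e)) \<le> t * \<eta>"
        using mult_left_mono[OF n1, of "t * \<eta>"] t \<eta>(1) by simp
      then show ?thesis using L0 by (simp add: mult_left_mono)
    qed
    also have "\<gamma> (x - (x \<bullet> e) *\<^sub>R e) < x \<bullet> e"
    proof -
      have "x \<in> \<Omega> \<inter> ball z r" using x r by auto
      then show ?thesis unfolding gr by simp
    qed
    also have "x \<bullet> e + L * (t * \<eta>) \<le> x \<bullet> e + t * (1 + \<eta> * a)"
    proof -
      have "L * \<eta> \<le> 1 - \<eta>" using \<eta>(2) by (simp add: algebra_simps)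
      also have "1 - \<eta> \<le> 1 + \<eta> * a" using a \<eta>(1) mult_left_mono[of "-1" a \<eta>] by simp
      finally show ?thesis using t mult_left_mono[of "L * \<eta>" "1 + \<eta> * a" t] by (simp add: algebra_simps)
    qed
    finally have "\<gamma> (?y - (?y \<bullet> e) *\<^sub>R e) < ?y \<bullet> e" by (simp only: ye add_strict_right_mono)
    then have "?y \<in> \<Omega> \<inter> ball z r" unfolding gr using y by simp
    then show ?thesis by simp
  qed
  ultimately show ?thesis using r
    by (intro exI[of _ "ball z (r/2)"] exI[of _ v] exI[of _ "r/4"]) auto
qed

text \<open>Replaces the chain rule for \<open>H\<close> along an absolutely continuous path:
  \<open>q\<close> bounds the difference quotients of \<open>H\<close>, which may have corners, as
  truncation does. On a partition so fine that \<open>q\<close> varies by less than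
  \<open>\<eta>\<close> along each piece of the path the increments are estimated piecewise and
  added; then \<open>\<eta>\<close> tends to 0.\<close>

lemma chain_inequality_HK:
  fixes f H q :: "real \<Rightarrow> real"
  assumes f: "f absolutely_integrable_on {0..t}" and t: "0 \<le> t"
    and q: "continuous_on UNIV q" and q_nonneg: "\<And>a. 0 \<le> q a"
    and Hq: "\<And>a b. \<bar>H a - H b\<bar> \<le> max (q a) (q b) * \<bar>a - b\<bar>"
  shows "\<bar>H (u0 + integral {0..t} f) - H u0\<bar>
    \<le> integral {0..t} (\<lambda>s. q (u0 + integral {0..s} f) * \<bar>f s\<bar>)"
    and "(\<lambda>s. q (u0 + integral {0..s} f) * \<bar>f s\<bar>) absolutely_integrable_on {0..t}"
proof -
  have fi: "f integrable_on {0..t}" using f set_lebesgue_integral_eq_integral(1) by blast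
  have fa: "(\<lambda>s. \<bar>f s\<bar>) absolutely_integrable_on {0..t}" using absolutely_integrable_norm[OF f] by (simp add: o_def)
  define U where "U s = u0 + integral {0..s} f" for s
  have U0: "U 0 = u0" by (simp add: U_def)
  have contU: "continuous_on {0..t} U" unfolding U_def
    by (intro continuous_intros indefinite_integral_continuous_1 fi)
  have contqU: "continuous_on {0..t} (\<lambda>s. q (U s))"
    using continuous_on_compose2[OF q contU] by simp
  have int: "(\<lambda>s. (q (U s) + \<eta>) * \<bar>f s\<bar>) absolutely_integrable_on {0..t}" for \<eta>
  proof (rule absolutely_integrable_bounded_measurable_product_real)
    have c: "continuous_on {0..t} (\<lambda>s. q (U s) + \<eta>)" by (intro continuous_intros contqU)
    then show "(\<lambda>s. q (U s) + \<eta>) \<in> borel_measurable (lebesgue_on {0..t})"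
      by (rule continuous_imp_measurable_on_sets_lebesgue) auto
    show "bounded ((\<lambda>s. q (U s) + \<eta>) ` {0..t})"
      by (intro compact_imp_bounded compact_continuous_image c) auto
  qed (use fa in auto)
  show "(\<lambda>s. q (u0 + integral {0..s} f) * \<bar>f s\<bar>) absolutely_integrable_on {0..t}"
    using int[of 0] by (simp add: U_def)
  have inti: "(\<lambda>s. (q (U s) + \<eta>) * \<bar>f s\<bar>) integrable_on {0..t}" for \<eta>
    using int set_lebesgue_integral_eq_integral(1) by blast
  have main: "\<bar>H (U t) - H (U 0)\<bar> \<le> integral {0..t} (\<lambda>s. (q (U s) + \<eta>) * \<bar>f s\<bar>)" if \<eta>: "\<eta> > 0" for \<eta>
  proof -
    have "uniformly_continuous_on {0..t} (\<lambda>s. q (U s))"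
      using compact_uniformly_continuous[OF contqU] by simp
    then obtain \<delta> where \<delta>: "\<delta> > 0" "\<And>x y. x \<in> {0..t} \<Longrightarrow> y \<in> {0..t} \<Longrightarrow> dist y x < \<delta> \<Longrightarrow> dist (q (U y)) (q (U x)) < \<eta>"
      using \<eta> unfolding uniformly_continuous_on_def by metis
    obtain n where n: "t / \<delta> < real n" using reals_Archimedean2 by blast
    then have n0: "n > 0" using t \<delta>(1) by (cases n) (auto simp: divide_less_0_iff)
    define p where "p i = real i * t / real n" for i
    have tn: "t / real n < \<delta>" using n n0 \<delta>(1) by (simp add: field_simps)
    have p0: "p 0 = 0" and pn: "p n = t" using n0 by (auto simp: p_def)
    have pSuc: "p (Suc i) = p i + t / real n" for i by (simp add: p_def add_divide_distrib distrib_right)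
    have p_ge: "0 \<le> p i" for i using t by (simp add: p_def)
    have p_le: "p i \<le> t" if "i \<le> n" for i
      using that t n0 by (simp add: p_def field_simps mult_left_mono)
    have "\<bar>H (U (p i)) - H (U 0)\<bar> \<le> integral {0..p i} (\<lambda>s. (q (U s) + \<eta>) * \<bar>f s\<bar>)" if "i \<le> n" for i
      using that
    proof (induction i)
      case 0
      then show ?case by (simp add: p0)
    next
      case (Suc i)
      have le: "p i \<le> p (Suc i)" using t by (simp add: pSuc)
      have sub: "{p i..p (Suc i)} \<subseteq> {0..t}" using p_ge[of i] p_le[OF Suc.prems] by auto
      have sub2: "{0..p (Suc i)} \<subseteq> {0..t}" using p_le[OF Suc.prems] by auto
      let ?m = "max (q (U (p (Suc i)))) (q (U (p i)))"
      have fi': "f integrable_on {p i..p (Suc i)}" using integrable_on_subinterval[OF fi sub] .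
      have fai: "(\<lambda>s. \<bar>f s\<bar>) integrable_on {p i..p (Suc i)}"
        using integrable_on_subinterval[OF _ sub] fa set_lebesgue_integral_eq_integral(1) by blast
      have q0: "0 \<le> ?m" using q_nonneg by (simp add: le_max_iff_disj)
      have "U (p (Suc i)) - U (p i) = integral {p i..p (Suc i)} f"
        unfolding U_def
        using Henstock_Kurzweil_Integration.integral_combine[OF p_ge le integrable_on_subinterval[OF fi sub2]] by simp
      then have "\<bar>U (p (Suc i)) - U (p i)\<bar> \<le> integral {p i..p (Suc i)} (\<lambda>s. \<bar>f s\<bar>)"
        using integral_norm_bound_integral[OF fi' fai] by simp
      then have "\<bar>H (U (p (Suc i))) - H (U (p i))\<bar> \<le> ?m * integral {p i..p (Suc i)} (\<lambda>s. \<bar>f s\<bar>)"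
        using Hq[of "U (p (Suc i))" "U (p i)"] q0 mult_left_mono order_trans by blast
      also have "\<dots> = integral {p i..p (Suc i)} (\<lambda>s. ?m * \<bar>f s\<bar>)" by simp
      also have "\<dots> \<le> integral {p i..p (Suc i)} (\<lambda>s. (q (U s) + \<eta>) * \<bar>f s\<bar>)"
      proof (rule integral_le)
        show "(\<lambda>s. ?m * \<bar>f s\<bar>) integrable_on {p i..p (Suc i)}" using integrable_on_cmult_left[OF fai, of ?m] by simp
        show "(\<lambda>s. (q (U s) + \<eta>) * \<bar>f s\<bar>) integrable_on {p i..p (Suc i)}"
          using integrable_on_subinterval[OF inti sub] .
        fix s assume s: "s \<in> {p i..p (Suc i)}"
        have "dist (q (U (p (Suc i)))) (q (U s)) < \<eta>" "dist (q (U (p i))) (q (U s)) < \<eta>"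
          using s sub tn le by (intro \<delta>(2); force simp: dist_real_def pSuc)+
        \<comment> \<open>The slack \<open>\<eta>\<close> pays for replacing \<open>q\<close> at the
          end points by \<open>q\<close> at the running point.\<close>
        then have "?m \<le> q (U s) + \<eta>" by (auto simp: dist_real_def)
        then show "?m * \<bar>f s\<bar> \<le> (q (U s) + \<eta>) * \<bar>f s\<bar>" by (rule mult_right_mono) simp
      qed
      finally have "\<bar>H (U (p (Suc i))) - H (U (p i))\<bar> \<le> integral {p i..p (Suc i)} (\<lambda>s. (q (U s) + \<eta>) * \<bar>f s\<bar>)" .
      moreover have "integral {0..p i} (\<lambda>s. (q (U s) + \<eta>) * \<bar>f s\<bar>) + integral {p i..p (Suc i)} (\<lambda>s. (q (U s) + \<eta>) * \<bar>f s\<bar>)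
         = integral {0..p (Suc i)} (\<lambda>s. (q (U s) + \<eta>) * \<bar>f s\<bar>)"
        by (rule Henstock_Kurzweil_Integration.integral_combine[OF p_ge le integrable_on_subinterval[OF inti sub2]])
      ultimately show ?case using Suc by simp
    qed
    from this[of n] show ?thesis using pn by simp
  qed
  have fai: "(\<lambda>s. \<bar>f s\<bar>) integrable_on {0..t}" using fa set_lebesgue_integral_eq_integral(1) by blast
  define I where "I = integral {0..t} (\<lambda>s. q (U s) * \<bar>f s\<bar>)"
  define J where "J = integral {0..t} (\<lambda>s. \<bar>f s\<bar>)"
  have eq: "integral {0..t} (\<lambda>s. (q (U s) + \<eta>) * \<bar>f s\<bar>) = I + \<eta> * J" for \<eta>
    unfolding I_def J_def distrib_right using inti[of 0] fai
      integrable_cmul[OF fai, of \<eta>]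
    by (subst Henstock_Kurzweil_Integration.integral_add) auto
  have "J \<ge> 0" unfolding J_def by (rule Henstock_Kurzweil_Integration.integral_nonneg[OF fai]) simp
  have "\<bar>H (U t) - H (U 0)\<bar> \<le> I"
  proof (rule field_le_epsilon)
    fix \<epsilon> :: real assume "\<epsilon> > 0"
    \<comment> \<open>With \<open>\<eta> = \<epsilon> / (J + 1)\<close> the excess
      \<open>\<eta> * J\<close> is at most \<open>\<epsilon>\<close>; the summand 1 avoids division
      by zero.\<close>
    then have "\<bar>H (U t) - H (U 0)\<bar> \<le> I + (\<epsilon> / (J + 1)) * J"
      using main[of "\<epsilon> / (J + 1)"] \<open>J \<ge> 0\<close> by (simp add: eq)
    also have "(\<epsilon> / (J + 1)) * J \<le> \<epsilon>" using \<open>\<epsilon> > 0\<close> \<open>J \<ge> 0\<close> by (simp add: field_simps)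
    finally show "\<bar>H (U t) - H (U 0)\<bar> \<le> I + \<epsilon>" by simp
  qed
  then show "\<bar>H (u0 + integral {0..t} f) - H u0\<bar> \<le> integral {0..t} (\<lambda>s. q (u0 + integral {0..s} f) * \<bar>f s\<bar>)"
    using U0 by (simp add: I_def U_def)
qed

section \<open>Truncated powers and their growth along segments\<close>

definition trunc :: "real \<Rightarrow> real \<Rightarrow> real" where
  "trunc M a = min \<bar>a\<bar> M"

text \<open>The case distinction replaces the junk value \<open>0 powr 0 = 0\<close>.\<close>

definition weight :: "real \<Rightarrow> real \<Rightarrow> real \<Rightarrow> real" where
  "weight \<beta> M a = (if \<beta> = 0 then 1 else trunc M a powr \<beta>)"

lemma trunc_nonneg: "M \<ge> 0 \<Longrightarrow> 0 \<le> trunc M a"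
  by (simp add: trunc_def)

lemma trunc_diff_le: "\<bar>trunc M a - trunc M b\<bar> \<le> \<bar>a - b\<bar>"
  by (auto simp: trunc_def min_def)

lemma weight_nonneg: "0 \<le> weight \<beta> M a"
  by (simp add: weight_def)

lemma continuous_on_weight:
  assumes "M \<ge> 0" "\<beta> \<ge> 0"
  shows "continuous_on UNIV (weight \<beta> M)"
proof (cases "\<beta> = 0")
  case False
  have "continuous_on UNIV (\<lambda>a. trunc M a powr \<beta>)"
    unfolding trunc_def using assms False by (intro continuous_on_powr' continuous_intros) auto
  then show ?thesis using False by (simp add: weight_def[abs_def])
qed (simp add: weight_def[abs_def])

text \<open>The slope of \<open>x powr (1 + \<beta>)\<close> is
  \<open>(1 + \<beta>) * x powr \<beta>\<close>, at most \<open>2 * x powr \<beta>\<close>; this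
  explains the factor 2 and provides the \<open>q\<close> of \<open>chain_inequality_HK\<close>. The
  elementary proof avoids differentiating at 0 and at the truncation level \<open>M\<close>.\<close>

lemma trunc_mult_weight_diff_le:
  assumes M: "M \<ge> 0" and \<beta>: "0 \<le> \<beta>" "\<beta> \<le> 1"
  shows "\<bar>trunc M a * weight \<beta> M a - trunc M b * weight \<beta> M b\<bar>
    \<le> max (2 * weight \<beta> M a) (2 * weight \<beta> M b) * \<bar>a - b\<bar>"
proof -
  have *: "\<bar>y * y powr \<beta> - x * x powr \<beta>\<bar> \<le> 2 * y powr \<beta> * (y - x)" if xy: "0 \<le> x" "x \<le> y" "\<beta> \<noteq> 0" for x y
  proof (cases "y = 0")
    case False
    then have y: "y > 0" using xy by simp
    \<comment> \<open>Since \<open>x / y \<le> 1\<close> and \<open>\<beta> \<le> 1\<close>,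
      lowering the exponent from 1 to \<open>\<beta>\<close> does not decrease the power.\<close>
    have "x / y = (x / y) powr 1" using xy y by simp
    also have "\<dots> \<le> (x / y) powr \<beta>" using xy y \<beta> by (intro powr_mono') auto
    also have "\<dots> = x powr \<beta> / y powr \<beta>" using xy y by (simp add: powr_divide)
    finally have "x * y powr \<beta> \<le> y * x powr \<beta>" using y by (simp add: field_simps)
    then have "y * (x * y powr \<beta>) \<le> y * (y * x powr \<beta>)" using y by (simp add: mult_left_mono)
    have mono: "x powr \<beta> \<le> y powr \<beta>" using xy \<beta> by (intro powr_mono2) auto
    have "x * (y powr \<beta> - x powr \<beta>) \<le> y powr \<beta> * (y - x)"
    proof -
      have "x * (y powr \<beta> - x powr \<beta>) \<le> y * (y powr \<beta> - x powr \<beta>)"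
        using xy mono by (intro mult_right_mono) auto
      also have "\<dots> \<le> y * y powr \<beta> - x * y powr \<beta>"
        using \<open>x * y powr \<beta> \<le> y * x powr \<beta>\<close> by (simp add: algebra_simps)
      finally show ?thesis by (simp add: algebra_simps)
    qed
    then have "y * y powr \<beta> - x * x powr \<beta> \<le> 2 * y powr \<beta> * (y - x)"
      by (simp add: algebra_simps)
    moreover have "x * x powr \<beta> \<le> y * y powr \<beta>" using xy mono by (intro mult_mono) auto
    ultimately show ?thesis by simp
  qed (use xy in auto)
  show ?thesis
  proof (cases "\<beta> = 0")
    case True
    have "\<bar>trunc M a - trunc M b\<bar> \<le> 2 * \<bar>a - b\<bar>"
      by (rule order_trans[OF trunc_diff_le]) simp
    then show ?thesis using True by (simp add: weight_def)
  next
    case False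
    let ?x = "trunc M a" and ?y = "trunc M b"
    have xy: "0 \<le> ?x" "0 \<le> ?y" using M by (auto simp: trunc_nonneg)
    have "\<bar>?x * ?x powr \<beta> - ?y * ?y powr \<beta>\<bar> \<le> max (2 * ?x powr \<beta>) (2 * ?y powr \<beta>) * \<bar>?x - ?y\<bar>"
    proof (cases "?x \<le> ?y")
      case True
      then have "\<bar>?x * ?x powr \<beta> - ?y * ?y powr \<beta>\<bar> \<le> 2 * ?y powr \<beta> * \<bar>?x - ?y\<bar>"
        using *[OF xy(1) True False] by (simp add: abs_minus_commute)
      also have "\<dots> \<le> max (2 * ?x powr \<beta>) (2 * ?y powr \<beta>) * \<bar>?x - ?y\<bar>"
        by (intro mult_right_mono) auto
      finally show ?thesis .
    next
      case F: False
      then have "\<bar>?x * ?x powr \<beta> - ?y * ?y powr \<beta>\<bar> \<le> 2 * ?x powr \<beta> * \<bar>?x - ?y\<bar>"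
        using *[OF xy(2) _ False, of ?x] by simp
      also have "\<dots> \<le> max (2 * ?x powr \<beta>) (2 * ?y powr \<beta>) * \<bar>?x - ?y\<bar>"
        by (intro mult_right_mono) auto
      finally show ?thesis .
    qed
    also have "\<dots> \<le> max (2 * ?x powr \<beta>) (2 * ?y powr \<beta>) * \<bar>a - b\<bar>"
      by (intro mult_left_mono trunc_diff_le) (auto simp: le_max_iff_disj)
    finally show ?thesis using False by (simp add: weight_def)
  qed
qed

lemma borel_measurable_weight[measurable]: "M \<ge> 0 \<Longrightarrow> \<beta> \<ge> 0 \<Longrightarrow> weight \<beta> M \<in> borel_measurable borel"
  by (rule borel_measurable_continuous_onI[OF continuous_on_weight])

lemma borel_measurable_trunc[measurable]: "trunc M \<in> borel_measurable borel"
  unfolding trunc_def[abs_def] by measurable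

text \<open>For each \<open>t\<close> the identity fails only on a null set of \<open>x\<close>.
  Since the set of good pairs is measurable in the product, Fubini's theorem turns this around: for
  almost every \<open>x\<close>, almost every \<open>t\<close> is good.\<close>

lemma AE_along_segments:
  fixes u :: "real^'n \<Rightarrow> real" and G :: "real^'n \<Rightarrow> real^'n"
  assumes wp: "weak_gradient_pair \<Omega> u G"
    and W: "open W" and sub: "\<And>x s. x \<in> W \<Longrightarrow> 0 \<le> s \<Longrightarrow> s \<le> h \<Longrightarrow> x + s *\<^sub>R v \<in> \<Omega>"
  shows "AE x in lborel. AE t in lborel. x \<in> W \<longrightarrow> t \<in> {0..h} \<longrightarrow>
    u (x + t *\<^sub>R v) - u x = (LINT s|lborel. (G (x + s *\<^sub>R v) \<bullet> v) * indicator {0..t} s)"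
proof -
  note u = weak_gradient_pairD(1)[OF wp] and G = weak_gradient_pairD(2)[OF wp]
  have [measurable]: "u \<in> borel_measurable borel" "G \<in> borel_measurable borel" "W \<in> sets borel" using u G W by auto
  have [measurable]: "Measurable.pred (borel \<Otimes>\<^sub>M borel \<Otimes>\<^sub>M borel) (\<lambda>z::(real^'n) \<times> real \<times> real. snd (snd z) \<in> {0..fst (snd z)})"
    unfolding atLeastAtMost_iff by measurable
  have "AE x in lborel. x \<in> W \<longrightarrow> t \<in> {0..h} \<longrightarrow>
    u (x + t *\<^sub>R v) - u x = (LINT s|lborel. (G (x + s *\<^sub>R v) \<bullet> v) * indicator {0..t} s)" for t
  proof (cases "t \<in> {0..h}")
    case True
    then have "AE x in lborel. x \<in> W \<longrightarrow>
        u (x + t *\<^sub>R v) - u x = (LINT s|lborel. (G (x + s *\<^sub>R v) \<bullet> v) * indicator {0..t} s)"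
      by (intro weak_gradient_increment_AE[OF wp _ W sub]) auto
    then show ?thesis by eventually_elim auto
  next
    case False
    then show ?thesis by (intro AE_I2) auto
  qed
  then have "AE t in lborel. AE x in lborel. x \<in> W \<longrightarrow> t \<in> {0..h} \<longrightarrow>
    u (x + t *\<^sub>R v) - u x = (LINT s|lborel. (G (x + s *\<^sub>R v) \<bullet> v) * indicator {0..t} s)" by simp
  note AEt = this
  have [measurable]: "(\<lambda>z. LINT s|lborel. (G (fst z + s *\<^sub>R v) \<bullet> v) * indicator {0..snd z} s)
     \<in> borel_measurable (lborel \<Otimes>\<^sub>M lborel)"
  proof -
    \<comment> \<open>Written with inequalities, the indicator is visibly measurable in
      \<open>s\<close> and the end point jointly.\<close>
    have *: "indicator {0..b} s = (if 0 \<le> s \<and> s \<le> b then 1 else 0 :: real)" for s b :: real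
      by (simp add: indicator_def)
    show ?thesis unfolding * by measurable
  qed
  define P where "P x t \<longleftrightarrow> (x \<in> W \<longrightarrow> t \<in> {0..h} \<longrightarrow>
    u (x + t *\<^sub>R v) - u x = (LINT s|lborel. (G (x + s *\<^sub>R v) \<bullet> v) * indicator {0..t} s))" for x t
  have "{z \<in> space (lborel \<Otimes>\<^sub>M lborel). P (fst z) (snd z)} \<in> sets (lborel \<Otimes>\<^sub>M lborel)"
    unfolding P_def by measurable
  from lborel_pair.AE_commute[OF this] AEt show ?thesis
    unfolding P_def by blast
qed

text \<open>No boundary values are available, so the value at \<open>x\<close> is compared with the
  values at all points of the segment and averaged over \<open>t\<close> in \<open>{0..h}\<close>.
  The average costs a factor \<open>1 / h\<close> and produces the term with
  \<open>\<bar>u y\<bar>\<close>; the increments cost \<open>2 * norm v\<close>; extending the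
  segment to the whole line only enlarges the right-hand side.\<close>

lemma trunc_weight_le_line_integral:
  fixes u :: "real^'n \<Rightarrow> real" and G :: "real^'n \<Rightarrow> real^'n"
  assumes wp: "weak_gradient_pair \<Omega> u G"
    and W: "open W" and sub: "\<And>x s. x \<in> W \<Longrightarrow> 0 \<le> s \<Longrightarrow> s \<le> h \<Longrightarrow> x + s *\<^sub>R v \<in> \<Omega>"
    and h: "h > 0" and M: "M \<ge> 0" and \<beta>: "0 \<le> \<beta>" "\<beta> \<le> 1"
    and K: "2 * norm v \<le> K" "1 / h \<le> K"
  shows "AE x in lborel. x \<in> W \<longrightarrow> ennreal (trunc M (u x) * weight \<beta> M (u x))
    \<le> line_integral v (\<lambda>y. ennreal (K * (weight \<beta> M (u y) * (\<bar>u y\<bar> + norm (G y))))) x"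
proof -
  note u = weak_gradient_pairD(1)[OF wp] and G = weak_gradient_pairD(2)[OF wp]
  have [measurable]: "u \<in> borel_measurable borel" "G \<in> borel_measurable borel" using u G by auto
  have [measurable]: "weight \<beta> M \<in> borel_measurable borel" using M \<beta> by auto
  have Gv: "integrable lborel (\<lambda>x. G x \<bullet> v)" using G by simp
  let ?H = "\<lambda>a. trunc M a * weight \<beta> M a" and ?q = "\<lambda>a. 2 * weight \<beta> M a"
  have "AE x in lborel. integrable lborel (\<lambda>s. (G (x + s *\<^sub>R v) \<bullet> v) * indicator {0..h} s)"
    using lborel_pair.AE_integrable_fst'[OF integrable_along_segments[OF Gv, of v h]] by simp
  moreover have "AE x in lborel. AE t in lborel. x \<in> W \<longrightarrow> t \<in> {0..h} \<longrightarrow>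
      u (x + t *\<^sub>R v) - u x = (LINT s|lborel. (G (x + s *\<^sub>R v) \<bullet> v) * indicator {0..t} s)"
    by (rule AE_along_segments[OF wp W sub])
  ultimately show ?thesis
  proof eventually_elim
    case (elim x)
    show ?case
    proof
      assume x: "x \<in> W"
      define f where "f s = G (x + s *\<^sub>R v) \<bullet> v" for s
      have fm[measurable]: "f \<in> borel_measurable borel" unfolding f_def by measurable
      have fs: "set_integrable lborel {0..h} f" using elim(1) by (simp add: f_def set_integrable_def mult.commute)
      then have f: "f absolutely_integrable_on {0..h}"
        unfolding set_integrable_def by (subst integrable_completion) auto
      have fsub: "f absolutely_integrable_on {0..t}" "set_integrable lborel {0..t} f" if "t \<in> {0..h}" for t
        using that set_integrable_subset[OF f, of "{0..t}"] set_integrable_subset[OF fs, of "{0..t}"] by auto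
      have "AE t in lborel. t \<in> {0..h} \<longrightarrow> u (x + t *\<^sub>R v) = u x + integral {0..t} f"
        using elim(2)
      proof eventually_elim
        case (elim t)
        show ?case
        proof
          assume t: "t \<in> {0..h}"
          have "(LINT s|lborel. (G (x + s *\<^sub>R v) \<bullet> v) * indicator {0..t} s) = (LINT s:{0..t}|lborel. f s)"
            by (simp add: set_lebesgue_integral_def f_def mult.commute)
          also have "\<dots> = integral {0..t} f"
            using set_borel_integral_eq_integral(2)[OF fsub(2)[OF t]] .
          finally show "u (x + t *\<^sub>R v) = u x + integral {0..t} f" using elim x t by auto
        qed
      qed
      note AEu = this
      \<comment> \<open>The bound for the increments is taken over the full segment, so it does not
        depend on \<open>t\<close>; it may be infinite.\<close>
      define R where "R = (\<integral>\<^sup>+s. ennreal (?q (u (x + s *\<^sub>R v)) * \<bar>f s\<bar>) * indicator {0..h} s \<partial>lborel)"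
      have "AE t in lborel. t \<in> {0..h} \<longrightarrow> ennreal (?H (u x)) \<le> ennreal (?H (u (x + t *\<^sub>R v))) + R"
        using AEu
      proof eventually_elim
        case (elim t)
        show ?case
        proof
          assume t: "t \<in> {0..h}"
          let ?g = "\<lambda>s. ?q (u x + integral {0..s} f) * \<bar>f s\<bar>"
          have cq: "continuous_on UNIV ?q" by (intro continuous_intros continuous_on_weight M \<beta>)
          have chain: "\<bar>?H (u x + integral {0..t} f) - ?H (u x)\<bar> \<le> integral {0..t} ?g"
            "?g absolutely_integrable_on {0..t}"
            using chain_inequality_HK[where q="?q" and H="?H" and f=f and t=t, OF fsub(1)[OF t] _ cq _ trunc_mult_weight_diff_le[OF M \<beta>]]
              t weight_nonneg by auto
          have "?H (u x) \<le> ?H (u (x + t *\<^sub>R v)) + integral {0..t} ?g"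
            using chain(1) elim t by auto
          also have "ennreal \<dots> = ennreal (?H (u (x + t *\<^sub>R v))) + ennreal (integral {0..t} ?g)"
          proof (rule ennreal_plus)
            show "0 \<le> ?H (u (x + t *\<^sub>R v))" using M by (simp add: trunc_nonneg weight_nonneg)
            show "0 \<le> integral {0..t} ?g"
              using chain(1) by linarith
          qed
          also have "ennreal (integral {0..t} ?g) = (\<integral>\<^sup>+s. ennreal (?g s) * indicator {0..t} s \<partial>lebesgue)"
          proof -
            have nn: "0 \<le> indicator {0..t} s * ?g s" for s by (simp add: weight_nonneg)
            have "(\<integral>\<^sup>+s. ennreal (indicator {0..t} s * ?g s) \<partial>lebesgue) = ennreal (LINT s|lebesgue. indicator {0..t} s * ?g s)"
              using chain(2) nn unfolding set_integrable_def by (intro nn_integral_eq_integral) auto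
            also have "(LINT s|lebesgue. indicator {0..t} s * ?g s) = integral {0..t} ?g"
              using set_lebesgue_integral_eq_integral(2)[OF chain(2)] by (simp add: set_lebesgue_integral_def)
            also have "(\<integral>\<^sup>+s. ennreal (indicator {0..t} s * ?g s) \<partial>lebesgue) = (\<integral>\<^sup>+s. ennreal (?g s) * indicator {0..t} s \<partial>lebesgue)"
              by (rule nn_integral_cong) (simp add: indicator_def)
            finally show ?thesis by simp
          qed
          \<comment> \<open>Only for almost every \<open>s\<close> is the running value
            \<open>u x + integral {0..s} f\<close> known to equal \<open>u\<close> on the segment;
            under the integral this is enough.\<close>
          also have "\<dots> \<le> (\<integral>\<^sup>+s. ennreal (?q (u (x + s *\<^sub>R v)) * \<bar>f s\<bar>) * indicator {0..h} s \<partial>lebesgue)"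
          proof (rule nn_integral_mono_AE)
            show "AE s in lebesgue. ennreal (?g s) * indicator {0..t} s \<le> ennreal (?q (u (x + s *\<^sub>R v)) * \<bar>f s\<bar>) * indicator {0..h} s"
              using AE_completion[OF AEu] by eventually_elim (use t in \<open>auto simp: indicator_def\<close>)
          qed
          also have "\<dots> = R"
            unfolding R_def by (rule nn_integral_completion) 
          finally show "ennreal (?H (u x)) \<le> ennreal (?H (u (x + t *\<^sub>R v))) + R"
            by (simp add: ennreal_leI add_left_mono)
        qed
      qed
      \<comment> \<open>This integration over \<open>t\<close> is the averaging; division by
        \<open>h\<close> follows.\<close>
      then have "(\<integral>\<^sup>+t. ennreal (?H (u x)) * indicator {0..h} t \<partial>lborel)
        \<le> (\<integral>\<^sup>+t. ennreal (?H (u (x + t *\<^sub>R v))) * indicator {0..h} t + R * indicator {0..h} t \<partial>lborel)"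
        by (intro nn_integral_mono_AE) (auto elim!: eventually_mono simp: indicator_def)
      also have "\<dots> = (\<integral>\<^sup>+t. ennreal (?H (u (x + t *\<^sub>R v))) * indicator {0..h} t \<partial>lborel) + R * ennreal h"
        using h by (subst nn_integral_add) (auto simp: nn_integral_cmult_indicator)
      also have "(\<integral>\<^sup>+t. ennreal (?H (u x)) * indicator {0..h} t \<partial>lborel) = ennreal (?H (u x)) * ennreal h"
        using h by (simp add: nn_integral_cmult_indicator)
      finally have "ennreal (?H (u x)) * ennreal h * ennreal (1 / h)
         \<le> ((\<integral>\<^sup>+t. ennreal (?H (u (x + t *\<^sub>R v))) * indicator {0..h} t \<partial>lborel) + R * ennreal h) * ennreal (1 / h)"
        by (rule mult_right_mono) simp
      moreover have hh: "ennreal h * ennreal (1 / h) = 1" using h by (simp flip: ennreal_mult)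
      ultimately have "ennreal (?H (u x))
         \<le> (\<integral>\<^sup>+t. ennreal (?H (u (x + t *\<^sub>R v))) * indicator {0..h} t \<partial>lborel) * ennreal (1 / h) + R"
        by (simp only: mult.assoc distrib_right hh mult_1_right)
      also have "\<dots> = (\<integral>\<^sup>+t. ennreal (?H (u (x + t *\<^sub>R v))) * indicator {0..h} t * ennreal (1 / h)
          + ennreal (?q (u (x + t *\<^sub>R v)) * \<bar>f t\<bar>) * indicator {0..h} t \<partial>lborel)"
        unfolding R_def by (subst nn_integral_add) (auto simp: nn_integral_multc)
      also have "\<dots> \<le> (\<integral>\<^sup>+t. ennreal (K * (weight \<beta> M (u (x + t *\<^sub>R v)) * (\<bar>u (x + t *\<^sub>R v)\<bar> + norm (G (x + t *\<^sub>R v))))) \<partial>lborel)"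
      proof (rule nn_integral_mono)
        fix t
        let ?y = "x + t *\<^sub>R v"
        have 1: "?H (u ?y) * (1 / h) \<le> K * (weight \<beta> M (u ?y) * \<bar>u ?y\<bar>)"
        proof -
          have "?H (u ?y) \<le> weight \<beta> M (u ?y) * \<bar>u ?y\<bar>"
            using mult_right_mono[of "trunc M (u ?y)" "\<bar>u ?y\<bar>" "weight \<beta> M (u ?y)"] weight_nonneg[of \<beta> M "u ?y"]
            by (simp add: trunc_def mult.commute)
          from mult_mono[OF this K(2)] have "?H (u ?y) * (1 / h) \<le> (weight \<beta> M (u ?y) * \<bar>u ?y\<bar>) * K"
            using h weight_nonneg[of \<beta> M "u ?y"] by simp
          then show ?thesis by (simp add: mult.commute)
        qed
        have 2: "?q (u ?y) * \<bar>f t\<bar> \<le> K * (weight \<beta> M (u ?y) * norm (G ?y))"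
        proof -
          have "\<bar>f t\<bar> \<le> norm (G ?y) * norm v" unfolding f_def by (rule Cauchy_Schwarz_ineq2)
          then have "?q (u ?y) * \<bar>f t\<bar> \<le> ?q (u ?y) * (norm (G ?y) * norm v)"
            by (intro mult_left_mono) (auto simp: weight_nonneg)
          also have "\<dots> = (2 * norm v) * (weight \<beta> M (u ?y) * norm (G ?y))" by simp
          also have "\<dots> \<le> K * (weight \<beta> M (u ?y) * norm (G ?y))"
            by (intro mult_right_mono K) (auto simp: weight_nonneg)
          finally show ?thesis .
        qed
        have nnH: "0 \<le> ?H (u ?y)" using M by (simp add: trunc_nonneg weight_nonneg)
        have "ennreal (?H (u ?y)) * indicator {0..h} t * ennreal (1 / h) + ennreal (?q (u ?y) * \<bar>f t\<bar>) * indicator {0..h} t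
          \<le> ennreal (?H (u ?y)) * ennreal (1 / h) + ennreal (?q (u ?y) * \<bar>f t\<bar>)"
          by (auto simp: indicator_def)
        also have "\<dots> = ennreal (?H (u ?y) * (1 / h) + ?q (u ?y) * \<bar>f t\<bar>)"
        proof -
          have "ennreal (?H (u ?y)) * ennreal (1 / h) = ennreal (?H (u ?y) * (1 / h))"
            by (rule ennreal_mult[symmetric]) (use nnH h in auto)
          moreover have "0 \<le> ?H (u ?y) * (1 / h)" "0 \<le> ?q (u ?y) * \<bar>f t\<bar>"
            using nnH h by (auto simp: weight_nonneg)
          ultimately show ?thesis by (simp only: ennreal_plus)
        qed
        also have "\<dots> \<le> ennreal (K * (weight \<beta> M (u ?y) * (\<bar>u ?y\<bar> + norm (G ?y))))"
          using 1 2 by (intro ennreal_leI) (simp add: algebra_simps)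
        finally show "ennreal (?H (u ?y)) * indicator {0..h} t * ennreal (1 / h) + ennreal (?q (u ?y) * \<bar>f t\<bar>) * indicator {0..h} t
          \<le> ennreal (K * (weight \<beta> M (u ?y) * (\<bar>u ?y\<bar> + norm (G ?y))))" .
      qed
      finally show "ennreal (?H (u x)) \<le> line_integral v (\<lambda>y. ennreal (K * (weight \<beta> M (u y) * (\<bar>u y\<bar> + norm (G y))))) x"
        by (simp add: line_integral_def)
    qed
  qed
qed

text \<open>The solution \<open>\<beta>\<close> of \<open>(1 + \<beta>) N / (N - 1) = 2\<close>: the
  Loomis-Whitney power of \<open>\<bar>u\<bar> powr (1 + \<beta>)\<close> is then the square of
  \<open>u\<close>. For \<open>N = 2\<close> it is 0.\<close>

definition sob_weight :: "nat \<Rightarrow> real" where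
  "sob_weight N = (real N - 2) / real N"

lemma trunc_weight_powr:
  assumes N: "N \<ge> 2" and M: "M \<ge> 0"
  shows "((trunc M a * weight (sob_weight N) M a) powr (1 / real (N - 1))) ^ N = (trunc M a)\<^sup>2"
proof (cases "trunc M a = 0")
  case True
  then show ?thesis using N by (simp add: zero_power)
next
  case False
  then have w: "trunc M a > 0" using trunc_nonneg[OF M, of a] by simp
  have "trunc M a * weight (sob_weight N) M a = trunc M a powr (1 + sob_weight N)"
    using w by (simp add: weight_def powr_add)
  then have "((trunc M a * weight (sob_weight N) M a) powr (1 / real (N - 1))) ^ N
     = trunc M a powr ((1 + sob_weight N) * (1 / real (N - 1)) * real N)"
    using w by (simp add: powr_realpow[symmetric] powr_powr)
  also have "(1 + sob_weight N) * (1 / real (N - 1)) * real N = 2"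
    using N by (simp add: sob_weight_def field_simps of_nat_diff)
  finally show ?thesis using w by (simp add: powr_realpow[of _ 2, simplified])
qed

abbreviation weighted_integral :: "real \<Rightarrow> real \<Rightarrow> (real^'n \<Rightarrow> real) \<Rightarrow> (real^'n \<Rightarrow> real^'n) \<Rightarrow> ennreal" where
  "weighted_integral \<beta> M u G \<equiv> \<integral>\<^sup>+x. ennreal (weight \<beta> M (u x) * (\<bar>u x\<bar> + norm (G x))) \<partial>lborel"

text \<open>The line bound holds in each of the \<open>N\<close> directions. The product of its
  powers with exponent \<open>1 / (N - 1)\<close> is the squared truncation on the left, and
  Loomis-Whitney integrates the right. \<open>C\<close> is quantified before \<open>u\<close>,
  \<open>G\<close> and \<open>M\<close>, as \<open>M\<close> is sent to infinity later.\<close>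

lemma trunc_square_local_bound:
  fixes e :: "'n::finite \<Rightarrow> real^'n"
  assumes N: "CARD('n) \<ge> 2" and W: "open W" and h: "h > 0"
    and e: "\<And>c. (\<Sum>k\<in>UNIV. c k *\<^sub>R e k) = 0 \<Longrightarrow> c = (\<lambda>_. 0)"
    and sub: "\<And>x k t. x \<in> W \<Longrightarrow> 0 \<le> t \<Longrightarrow> t \<le> h \<Longrightarrow> x + t *\<^sub>R e k \<in> \<Omega>"
  shows "\<exists>C>0. \<forall>u G M. weak_gradient_pair \<Omega> u G \<longrightarrow> M \<ge> 0 \<longrightarrow>
    (\<integral>\<^sup>+x. ennreal ((trunc M (u x))\<^sup>2) * indicator W x \<partial>lborel)
    \<le> ennreal C * epowr (weighted_integral (sob_weight CARD('n)) M u G) (1 / real (CARD('n) - 1)) ^ CARD('n)"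
proof (rule Loomis_Whitney[OF N e])
  fix K0 :: real
  let ?a = "1 / real (CARD('n) - 1)" and ?\<beta> = "sob_weight CARD('n)"
  assume K0: "K0 > 0" "\<And>g. g \<in> borel_measurable borel \<Longrightarrow>
    (\<integral>\<^sup>+x. (\<Prod>i\<in>UNIV. epowr (line_integral (e i) g x) ?a) \<partial>lborel)
      \<le> ennreal K0 * epowr (\<integral>\<^sup>+x. g x \<partial>lborel) ?a ^ CARD('n)"
  \<comment> \<open>One constant for all directions and for both costs of the line bound.\<close>
  define K where "K = (\<Sum>i\<in>UNIV. 2 * norm (e i)) + 1 / h"
  have "2 * norm (e i) \<le> (\<Sum>i\<in>UNIV. 2 * norm (e i))" for i
    by (rule member_le_sum) auto
  moreover have "0 \<le> (\<Sum>i\<in>UNIV. 2 * norm (e i))" by (simp add: sum_nonneg)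
  ultimately have K: "2 * norm (e i) \<le> K" "1 / h \<le> K" for i
    using h unfolding K_def by (smt (verit) divide_pos_pos)+
  have Kpos: "K > 0" using K(2) h by (smt (verit) divide_pos_pos)
  have \<beta>: "0 \<le> ?\<beta>" "?\<beta> \<le> 1" using N by (auto simp: sob_weight_def)
  show ?thesis
  proof (rule exI[of _ "K0 * (K powr ?a) ^ CARD('n)"], intro conjI allI impI)
    show "0 < K0 * (K powr ?a) ^ CARD('n)" using K0 Kpos by simp
    fix u :: "real^'n \<Rightarrow> real" and G :: "real^'n \<Rightarrow> real^'n" and M :: real
    assume wp: "weak_gradient_pair \<Omega> u G" and M: "M \<ge> 0"
    then have [measurable]: "u \<in> borel_measurable borel" "G \<in> borel_measurable borel"
      by (auto simp: weak_gradient_pair_def)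
    have [measurable]: "weight ?\<beta> M \<in> borel_measurable borel" using M \<beta> by auto
    define g where "g y = ennreal (K * (weight ?\<beta> M (u y) * (\<bar>u y\<bar> + norm (G y))))" for y
    have [measurable]: "g \<in> borel_measurable borel" unfolding g_def by measurable
    have "AE x in lborel. x \<in> W \<longrightarrow> ennreal (trunc M (u x) * weight ?\<beta> M (u x)) \<le> line_integral (e i) g x" for i
      unfolding g_def[abs_def]
      by (rule trunc_weight_le_line_integral[OF wp W sub h M \<beta> K])
    then have "AE x in lborel. \<forall>i. x \<in> W \<longrightarrow> ennreal (trunc M (u x) * weight ?\<beta> M (u x)) \<le> line_integral (e i) g x"
      unfolding AE_all_countable by blast
    then have "AE x in lborel. ennreal ((trunc M (u x))\<^sup>2) * indicator W x \<le> (\<Prod>i\<in>UNIV. epowr (line_integral (e i) g x) ?a)"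
    proof eventually_elim
      case (elim x)
      show ?case
      proof (cases "x \<in> W")
        case True
        let ?H = "trunc M (u x) * weight ?\<beta> M (u x)"
        have H0: "0 \<le> ?H" using M by (simp add: trunc_nonneg weight_nonneg)
        have "ennreal ((trunc M (u x))\<^sup>2) = ennreal ((?H powr ?a) ^ CARD('n))"
          by (simp only: trunc_weight_powr[OF N M])
        also have "\<dots> = (\<Prod>i\<in>(UNIV::'n set). epowr (ennreal ?H) ?a)"
          using H0 by (simp add: epowr_ennreal ennreal_power)
        also have "\<dots> \<le> (\<Prod>i\<in>UNIV. epowr (line_integral (e i) g x) ?a)"
          using elim True by (intro prod_mono_ennreal epowr_mono) auto
        finally show ?thesis using True by simp
      qed simp
    qed
    then have "(\<integral>\<^sup>+x. ennreal ((trunc M (u x))\<^sup>2) * indicator W x \<partial>lborel)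
       \<le> (\<integral>\<^sup>+x. (\<Prod>i\<in>UNIV. epowr (line_integral (e i) g x) ?a) \<partial>lborel)"
      by (rule nn_integral_mono_AE)
    also have "\<dots> \<le> ennreal K0 * epowr (\<integral>\<^sup>+x. g x \<partial>lborel) ?a ^ CARD('n)"
      by (rule K0(2)) measurable
    also have "(\<integral>\<^sup>+x. g x \<partial>lborel) = ennreal K * weighted_integral ?\<beta> M u G"
      unfolding g_def using Kpos by (subst nn_integral_cmult[symmetric]) (auto simp: ennreal_mult weight_nonneg)
    also have "epowr \<dots> ?a = ennreal (K powr ?a) * epowr (weighted_integral ?\<beta> M u G) ?a"
      by (rule epowr_mult[OF Kpos])
    finally show "(\<integral>\<^sup>+x. ennreal ((trunc M (u x))\<^sup>2) * indicator W x \<partial>lborel)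
      \<le> ennreal (K0 * (K powr ?a) ^ CARD('n))
         * epowr (weighted_integral ?\<beta> M u G) ?a ^ CARD('n)"
      using K0(1) Kpos by (simp add: power_mult_distrib ennreal_mult ennreal_power mult.assoc)
  qed
qed

text \<open>Compactness of \<open>closure \<Omega>\<close>: finitely many of the neighbourhoods in
  which short segments stay inside cover it, and the local constants add up. This is why local
  segments are provided at boundary points as well.\<close>

lemma trunc_square_bound:
  fixes \<Omega> :: "(real^'n) set"
  assumes N: "CARD('n) \<ge> 2" and \<Omega>: "bounded_lipschitz_domain \<Omega>"
  shows "\<exists>C>0. \<forall>u G M. weak_gradient_pair \<Omega> u G \<longrightarrow> M \<ge> 0 \<longrightarrow>
    (\<integral>\<^sup>+x. ennreal ((trunc M (u x))\<^sup>2) * indicator \<Omega> x \<partial>lborel)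
    \<le> ennreal C * epowr (weighted_integral (sob_weight CARD('n)) M u G) (1 / real (CARD('n) - 1)) ^ CARD('n)"
proof -
  have op: "open \<Omega>" and bd: "bounded \<Omega>" and lb: "lipschitz_boundary \<Omega>" and ne: "\<Omega> \<noteq> {}"
    using \<Omega> by (auto simp: bounded_lipschitz_domain_def)
  define R where "R u G M = epowr (weighted_integral (sob_weight CARD('n)) M u G) (1 / real (CARD('n) - 1)) ^ CARD('n)" for u and G :: "real^'n \<Rightarrow> real^'n" and M
  have "\<forall>z\<in>closure \<Omega>. \<exists>U C. open U \<and> z \<in> U \<and> C > 0 \<and> (\<forall>u G M. weak_gradient_pair \<Omega> u G \<longrightarrow> M \<ge> 0 \<longrightarrow>
    (\<integral>\<^sup>+x. ennreal ((trunc M (u x))\<^sup>2) * indicator (\<Omega> \<inter> U) x \<partial>lborel) \<le> ennreal C * R u G M)"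
  proof
    fix z assume z: "z \<in> closure \<Omega>"
    obtain U e h where U: "open U" "z \<in> U" "h > 0" and e': "\<forall>c. (\<Sum>k\<in>UNIV. c k *\<^sub>R e k) = 0 \<longrightarrow> c = (\<lambda>_::'n. 0)"
      and sub': "\<forall>x k t. x \<in> \<Omega> \<inter> U \<longrightarrow> 0 \<le> t \<longrightarrow> t \<le> h \<longrightarrow> x + t *\<^sub>R e k \<in> \<Omega>"
      using lipschitz_domain_local_segments[OF op lb z] by blast
    have "open (\<Omega> \<inter> U)" using op U(1) by auto
    have "\<exists>C>0. \<forall>u G M. weak_gradient_pair \<Omega> u G \<longrightarrow> M \<ge> 0 \<longrightarrow>
      (\<integral>\<^sup>+x. ennreal ((trunc M (u x))\<^sup>2) * indicator (\<Omega> \<inter> U) x \<partial>lborel) \<le> ennreal C * R u G M"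
      unfolding R_def
      by (rule trunc_square_local_bound[where e=e and h=h, OF N \<open>open (\<Omega> \<inter> U)\<close> U(3)]) (use e' sub' in blast)+
    then obtain C where "C > 0" "\<forall>u G M. weak_gradient_pair \<Omega> u G \<longrightarrow> M \<ge> 0 \<longrightarrow>
      (\<integral>\<^sup>+x. ennreal ((trunc M (u x))\<^sup>2) * indicator (\<Omega> \<inter> U) x \<partial>lborel) \<le> ennreal C * R u G M"
      by blast
    with U(1,2)
    show "\<exists>U C. open U \<and> z \<in> U \<and> C > 0 \<and> (\<forall>u G M. weak_gradient_pair \<Omega> u G \<longrightarrow> M \<ge> 0 \<longrightarrow>
      (\<integral>\<^sup>+x. ennreal ((trunc M (u x))\<^sup>2) * indicator (\<Omega> \<inter> U) x \<partial>lborel) \<le> ennreal C * R u G M)"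
      by (intro exI[of _ U] exI[of _ C] conjI)
  qed
  then obtain U C where UC: "\<forall>z\<in>closure \<Omega>. open (U z) \<and> z \<in> U z \<and> C z > 0 \<and>
    (\<forall>u G M. weak_gradient_pair \<Omega> u G \<longrightarrow> M \<ge> 0 \<longrightarrow>
    (\<integral>\<^sup>+x. ennreal ((trunc M (u x))\<^sup>2) * indicator (\<Omega> \<inter> U z) x \<partial>lborel) \<le> ennreal (C z) * R u G M)"
    unfolding bchoice_iff by blast
  then have U: "\<And>z. z \<in> closure \<Omega> \<Longrightarrow> open (U z)" "\<And>z. z \<in> closure \<Omega> \<Longrightarrow> z \<in> U z"
    and C: "\<And>z. z \<in> closure \<Omega> \<Longrightarrow> C z > 0"
    "\<And>z u G M. z \<in> closure \<Omega> \<Longrightarrow> weak_gradient_pair \<Omega> u G \<Longrightarrow> M \<ge> 0 \<Longrightarrow>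
      (\<integral>\<^sup>+x. ennreal ((trunc M (u x))\<^sup>2) * indicator (\<Omega> \<inter> U z) x \<partial>lborel) \<le> ennreal (C z) * R u G M"
    by blast+
  have "compact (closure \<Omega>)" using bd by simp
  then obtain D where D: "D \<subseteq> closure \<Omega>" "finite D" "closure \<Omega> \<subseteq> (\<Union>z\<in>D. U z)"
    using compactE_image[of "closure \<Omega>" "closure \<Omega>" U] U by blast
  have "closure \<Omega> \<noteq> {}" using ne closure_subset by blast
  then have "D \<noteq> {}" using D(3) by auto
  show ?thesis
  proof (rule exI[of _ "\<Sum>z\<in>D. C z"], intro conjI allI impI)
    show "0 < (\<Sum>z\<in>D. C z)" using D C(1) \<open>D \<noteq> {}\<close> by (intro sum_pos) auto
    fix u :: "real^'n \<Rightarrow> real" and G :: "real^'n \<Rightarrow> real^'n" and M :: real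
    assume wp: "weak_gradient_pair \<Omega> u G" and M: "M \<ge> 0"
    then have [measurable]: "u \<in> borel_measurable borel" by (auto simp: weak_gradient_pair_def)
    have [measurable]: "\<Omega> \<inter> U z \<in> sets borel" if "z \<in> D" for z
      using U(1)[of z] op that D(1) by auto
    have "(\<integral>\<^sup>+x. ennreal ((trunc M (u x))\<^sup>2) * indicator \<Omega> x \<partial>lborel)
      \<le> (\<integral>\<^sup>+x. (\<Sum>z\<in>D. ennreal ((trunc M (u x))\<^sup>2) * indicator (\<Omega> \<inter> U z) x) \<partial>lborel)"
    proof (rule nn_integral_mono)
      fix x
      show "ennreal ((trunc M (u x))\<^sup>2) * indicator \<Omega> x \<le> (\<Sum>z\<in>D. ennreal ((trunc M (u x))\<^sup>2) * indicator (\<Omega> \<inter> U z) x)"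
      proof (cases "x \<in> \<Omega>")
        case True
        then obtain z where z: "z \<in> D" "x \<in> U z" using D(3) closure_subset[of \<Omega>] by blast
        have "ennreal ((trunc M (u x))\<^sup>2) * indicator \<Omega> x = ennreal ((trunc M (u x))\<^sup>2) * indicator (\<Omega> \<inter> U z) x"
          using z True by simp
        also have "\<dots> \<le> (\<Sum>z\<in>D. ennreal ((trunc M (u x))\<^sup>2) * indicator (\<Omega> \<inter> U z) x)"
          using z D(2) by (intro member_le_sum) auto
        finally show ?thesis .
      qed simp
    qed
    also have "\<dots> = (\<Sum>z\<in>D. \<integral>\<^sup>+x. ennreal ((trunc M (u x))\<^sup>2) * indicator (\<Omega> \<inter> U z) x \<partial>lborel)"
      by (rule nn_integral_sum) measurable
    also have "\<dots> \<le> (\<Sum>z\<in>D. ennreal (C z) * R u G M)"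
      using C(2)[OF _ wp M] D(1) by (intro sum_mono) auto
    also have "\<dots> = ennreal (\<Sum>z\<in>D. C z) * R u G M"
    proof -
      have "(\<Sum>z\<in>D. ennreal (C z)) = ennreal (\<Sum>z\<in>D. C z)"
        using C(1) D(1) by (intro sum_ennreal) (auto intro: less_imp_le)
      then show ?thesis by (simp flip: sum_distrib_right)
    qed
    finally show "(\<integral>\<^sup>+x. ennreal ((trunc M (u x))\<^sup>2) * indicator \<Omega> x \<partial>lborel) \<le> ennreal (\<Sum>z\<in>D. C z) *
      epowr (weighted_integral (sob_weight CARD('n)) M u G) (1 / real (CARD('n) - 1)) ^ CARD('n)"
      unfolding R_def .
  qed
qed

text \<open>Hoelder's inequality with weights \<open>\<theta> = \<beta> / 2\<close> and
  \<open>1 - \<theta>\<close>: the weight is the squared truncation to the power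
  \<open>\<theta>\<close>, and \<open>2N / (N + 2)\<close> is the reciprocal of
  \<open>1 - \<theta>\<close>. Thus the square integral \<open>\<xi>\<close>, which is to be
  estimated, enters its own bound with a small power.\<close>

lemma integral_weight_le:
  fixes G :: "real^'n \<Rightarrow> real^'n"
  assumes N: "CARD('n) \<ge> 2" and M: "M \<ge> 0"
    and [measurable]: "u \<in> borel_measurable borel" "G \<in> borel_measurable borel"
    and \<xi>: "(\<integral>\<^sup>+x. ennreal ((trunc M (u x))\<^sup>2) \<partial>lborel) = ennreal \<xi>" "\<xi> > 0"
    and y: "(\<integral>\<^sup>+x. ennreal ((\<bar>u x\<bar> + norm (G x)) powr (2 * real CARD('n) / (real CARD('n) + 2))) \<partial>lborel) \<le> ennreal y" "y \<ge> 0"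
  shows "weighted_integral (sob_weight CARD('n)) M u G
    \<le> ennreal (\<xi> powr (sob_weight CARD('n) / 2) * y powr (1 - sob_weight CARD('n) / 2))"
proof (cases "CARD('n) = 2")
  \<comment> \<open>For \<open>N = 2\<close> the first Hoelder weight would be 0; but then
    \<open>weight\<close> is constantly 1 and the exponent of the hypothesis is 1, so the claim is
    the hypothesis.\<close>
  case True
  then show ?thesis using y \<xi>(2)
    by (simp add: sob_weight_def weight_def)
next
  case False
  let ?\<beta> = "sob_weight CARD('n)" and ?r = "2 * real CARD('n) / (real CARD('n) + 2)"
  define \<theta> where "\<theta> = ?\<beta> / 2"
  have \<theta>: "0 < \<theta>" "\<theta> < 1" and \<beta>: "?\<beta> \<noteq> 0" using N False by (auto simp: \<theta>_def sob_weight_def field_simps)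
  have "1 - \<theta> = (real CARD('n) + 2) / (2 * real CARD('n))" using N by (simp add: \<theta>_def sob_weight_def field_simps)
  moreover have "real CARD('n) + 2 \<noteq> 0" by linarith
  ultimately have r\<theta>: "?r * (1 - \<theta>) = 1" using N by simp
  define w where "w b = (if b then \<theta> else 1 - \<theta>)" for b
  define f where "f b x = (if b then ennreal ((trunc M (u x))\<^sup>2) else ennreal ((\<bar>u x\<bar> + norm (G x)) powr ?r))" for b x
  have [measurable]: "f b \<in> borel_measurable lborel" for b unfolding f_def by measurable
  have "weighted_integral ?\<beta> M u G
     = (\<integral>\<^sup>+x. (\<Prod>b\<in>UNIV. epowr (f b x) (w b)) \<partial>lborel)"
  proof (rule nn_integral_cong)
    fix x
    have "((trunc M (u x))\<^sup>2) powr \<theta> = weight ?\<beta> M (u x)"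
    proof (cases "trunc M (u x) = 0")
      case F: False
      then have "trunc M (u x) > 0" using trunc_nonneg[OF M, of "u x"] by simp
      then have "((trunc M (u x))\<^sup>2) powr \<theta> = trunc M (u x) powr (2 * \<theta>)"
        using powr_realpow[of "trunc M (u x)" 2] by (simp add: powr_powr flip: powr_numeral)
      then show ?thesis using \<beta> by (simp add: weight_def \<theta>_def)
    qed (use \<beta> in \<open>simp add: weight_def\<close>)
    moreover have "((\<bar>u x\<bar> + norm (G x)) powr ?r) powr (1 - \<theta>) = \<bar>u x\<bar> + norm (G x)"
      unfolding powr_powr r\<theta> by simp
    ultimately show "ennreal (weight ?\<beta> M (u x) * (\<bar>u x\<bar> + norm (G x))) = (\<Prod>b\<in>UNIV. epowr (f b x) (w b))"
      by (simp add: UNIV_bool f_def w_def epowr_ennreal ennreal_mult weight_nonneg mult.commute)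
  qed
  also have "\<dots> \<le> (\<Prod>b\<in>UNIV. epowr (\<integral>\<^sup>+x. f b x \<partial>lborel) (w b))"
    by (rule nn_integral_prod_Holder) (use \<theta> in \<open>auto simp: w_def UNIV_bool\<close>)
  also have "\<dots> = epowr (\<integral>\<^sup>+x. ennreal ((\<bar>u x\<bar> + norm (G x)) powr ?r) \<partial>lborel) (1 - \<theta>) * epowr (ennreal \<xi>) \<theta>"
    by (simp add: UNIV_bool f_def w_def \<xi>)
  also have "\<dots> \<le> epowr (ennreal y) (1 - \<theta>) * epowr (ennreal \<xi>) \<theta>"
    using \<theta> y by (intro mult_right_mono epowr_mono) auto
  also have "\<dots> = ennreal (\<xi> powr \<theta> * y powr (1 - \<theta>))"
    using y \<xi> by (simp add: epowr_ennreal ennreal_mult mult.commute)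
  finally show ?thesis unfolding \<theta>_def .
qed

text \<open>The two preceding bounds combine to \<open>\<xi> \<le> C \<xi>^k y^s\<close> with
  \<open>k = (N - 2) / (2 (N - 1)) < 1\<close>, so \<open>\<xi>^(1-k) \<le> C y^s\<close>. The
  resulting bound does not involve \<open>M\<close>, and Fatou's lemma removes the
  truncation.\<close>

lemma Sobolev_L2_borel:
  fixes \<Omega> :: "(real^'n) set"
  assumes N: "CARD('n) \<ge> 2" and \<Omega>: "bounded_lipschitz_domain \<Omega>"
  shows "\<exists>C s t. C > 0 \<and> s > 0 \<and> t > 0 \<and> (\<forall>u G y. weak_gradient_pair \<Omega> u G \<longrightarrow> (\<forall>x. x \<notin> \<Omega> \<longrightarrow> u x = 0) \<longrightarrow> y \<ge> 0 \<longrightarrow>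
    (\<integral>\<^sup>+x. ennreal ((\<bar>u x\<bar> + norm (G x)) powr (2 * real CARD('n) / (real CARD('n) + 2))) \<partial>lborel) \<le> ennreal y \<longrightarrow>
    (\<integral>\<^sup>+x. ennreal ((u x)\<^sup>2) \<partial>lborel) \<le> ennreal ((C * y powr s) powr t))"
proof -
  let ?a = "1 / real (CARD('n) - 1)" and ?\<beta> = "sob_weight CARD('n)"
  let ?\<theta> = "?\<beta> / 2"
  obtain C where C: "C > 0" "\<And>u G M. weak_gradient_pair \<Omega> u G \<Longrightarrow> M \<ge> 0 \<Longrightarrow>
    (\<integral>\<^sup>+x. ennreal ((trunc M (u x))\<^sup>2) * indicator \<Omega> x \<partial>lborel)
    \<le> ennreal C * epowr (weighted_integral ?\<beta> M u G) ?a ^ CARD('n)"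
    using trunc_square_bound[OF N \<Omega>] by blast
  define s where "s = (1 - ?\<theta>) * (?a * real CARD('n))"
  define k where "k = ?\<theta> * (?a * real CARD('n))"
  have k: "k < 1" using N by (simp add: k_def sob_weight_def field_simps of_nat_diff)
  have "1 - ?\<theta> = (real CARD('n) + 2) / (2 * real CARD('n))" using N by (simp add: sob_weight_def field_simps)
  moreover have "\<dots> > 0" by (intro divide_pos_pos) auto
  ultimately have s: "s > 0" unfolding s_def using N by (intro mult_pos_pos) auto
  show ?thesis
  proof (rule exI[of _ C], rule exI[of _ s], rule exI[of _ "1 / (1 - k)"], intro conjI allI impI C(1) s)
    show "1 / (1 - k) > 0" using k by simp
    fix u :: "real^'n \<Rightarrow> real" and G :: "real^'n \<Rightarrow> real^'n" and y :: real
    assume wp: "weak_gradient_pair \<Omega> u G" and u0: "\<forall>x. x \<notin> \<Omega> \<longrightarrow> u x = 0" and y0: "y \<ge> 0"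
      and y: "(\<integral>\<^sup>+x. ennreal ((\<bar>u x\<bar> + norm (G x)) powr (2 * real CARD('n) / (real CARD('n) + 2))) \<partial>lborel) \<le> ennreal y"
    have ui: "integrable lborel u" and [measurable]: "u \<in> borel_measurable borel" "G \<in> borel_measurable borel"
      using wp by (auto simp: weak_gradient_pair_def)
    have bound: "(\<integral>\<^sup>+x. ennreal ((trunc M (u x))\<^sup>2) \<partial>lborel) \<le> ennreal ((C * y powr s) powr (1 / (1 - k)))" if M: "M \<ge> 0" for M
    proof -
      \<comment> \<open>Truncation makes the square integral finite: it is at most \<open>M\<close>
        times the integral of \<open>\<bar>u\<bar>\<close>. Only a finite \<open>\<xi>\<close> can
        be absorbed below.\<close>
      have "(\<integral>\<^sup>+x. ennreal ((trunc M (u x))\<^sup>2) \<partial>lborel) \<le> (\<integral>\<^sup>+x. ennreal M * ennreal (norm (u x)) \<partial>lborel)"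
      proof (rule nn_integral_mono)
        fix x
        have "(trunc M (u x))\<^sup>2 \<le> M * norm (u x)"
          unfolding power2_eq_square using M by (intro mult_mono) (auto simp: trunc_def)
        then show "ennreal ((trunc M (u x))\<^sup>2) \<le> ennreal M * ennreal (norm (u x))"
          using M by (simp add: ennreal_mult[symmetric] ennreal_leI)
      qed
      also have "\<dots> = ennreal M * (\<integral>\<^sup>+x. ennreal (norm (u x)) \<partial>lborel)" by (rule nn_integral_cmult) measurable
      also have "\<dots> < \<infinity>" using ui by (simp add: integrable_iff_bounded ennreal_mult_less_top)
      finally obtain \<xi> where \<xi>: "(\<integral>\<^sup>+x. ennreal ((trunc M (u x))\<^sup>2) \<partial>lborel) = ennreal \<xi>" "\<xi> \<ge> 0"
        by (cases "\<integral>\<^sup>+x. ennreal ((trunc M (u x))\<^sup>2) \<partial>lborel") auto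
      show ?thesis
      proof (cases "\<xi> = 0")
        case False
        then have \<xi>0: "\<xi> > 0" using \<xi> by simp
        have "ennreal \<xi> = (\<integral>\<^sup>+x. ennreal ((trunc M (u x))\<^sup>2) * indicator \<Omega> x \<partial>lborel)"
          unfolding \<xi>(1)[symmetric] using u0 M by (intro nn_integral_cong) (auto simp: indicator_def trunc_def)
        also have "\<dots> \<le> ennreal C * epowr (weighted_integral ?\<beta> M u G) ?a ^ CARD('n)"
          by (rule C(2)[OF wp M])
        also have "\<dots> \<le> ennreal C * epowr (ennreal (\<xi> powr ?\<theta> * y powr (1 - ?\<theta>))) ?a ^ CARD('n)"
          by (intro mult_left_mono power_mono epowr_mono integral_weight_le[OF N M _ _ \<xi>(1) \<xi>0 y y0]) auto
        also have "\<dots> = ennreal (C * ((\<xi> powr ?\<theta> * y powr (1 - ?\<theta>)) powr ?a) ^ CARD('n))"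
        proof -
          have z: "0 \<le> \<xi> powr ?\<theta> * y powr (1 - ?\<theta>)" by simp
          have "ennreal ((\<xi> powr ?\<theta> * y powr (1 - ?\<theta>)) powr ?a) ^ CARD('n)
            = ennreal (((\<xi> powr ?\<theta> * y powr (1 - ?\<theta>)) powr ?a) ^ CARD('n))"
            by (rule ennreal_power) simp
          then show ?thesis unfolding epowr_ennreal[OF z] using C(1) by (simp only: ennreal_mult' less_imp_le)
        qed
        finally have le: "\<xi> \<le> C * ((\<xi> powr ?\<theta> * y powr (1 - ?\<theta>)) powr ?a) ^ CARD('n)"
          using C(1) by (subst (asm) ennreal_le_iff) auto
        then have y_pos: "y > 0" using \<xi>0 y0 N by (cases "y = 0") (auto simp: zero_power)
        have "((\<xi> powr ?\<theta> * y powr (1 - ?\<theta>)) powr ?a) ^ CARD('n) = (\<xi> powr ?\<theta> * y powr (1 - ?\<theta>)) powr (?a * real CARD('n))"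
          using \<xi>0 y_pos by (simp add: powr_realpow[symmetric] powr_powr)
        also have "\<dots> = \<xi> powr k * y powr s"
          using \<xi>0 y_pos by (simp add: powr_mult powr_powr k_def s_def)
        finally have "\<xi> \<le> \<xi> powr k * (C * y powr s)" using le by (simp add: ac_simps)
        then have "\<xi> powr (- k) * \<xi> \<le> \<xi> powr (- k) * (\<xi> powr k * (C * y powr s))"
          by (intro mult_left_mono) auto
        moreover have "\<xi> powr (- k) * \<xi> = \<xi> powr (1 - k)"
          using \<xi>0 powr_add[of \<xi> "- k" 1] by simp
        moreover have "\<xi> powr (- k) * (\<xi> powr k * (C * y powr s)) = C * y powr s"
          using \<xi>0 by (simp add: mult.assoc[symmetric] powr_add[symmetric])
        ultimately have "\<xi> powr (1 - k) \<le> C * y powr s" by simp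
        then have "(\<xi> powr (1 - k)) powr (1 / (1 - k)) \<le> (C * y powr s) powr (1 / (1 - k))"
          using k by (intro powr_mono2) auto
        then have "\<xi> \<le> (C * y powr s) powr (1 / (1 - k))"
          using \<xi>0 k by (simp add: powr_powr)
        then show ?thesis unfolding \<xi>(1) by (rule ennreal_leI)
      qed (simp add: \<xi>(1))
    qed
    \<comment> \<open>At each point the truncation at height \<open>n\<close> is eventually
      inactive, which gives the liminf form that Fatou's lemma expects.\<close>
    have "(\<integral>\<^sup>+x. ennreal ((u x)\<^sup>2) \<partial>lborel) = (\<integral>\<^sup>+x. liminf (\<lambda>n. ennreal ((trunc (real n) (u x))\<^sup>2)) \<partial>lborel)"
    proof (rule nn_integral_cong)
      fix x
      obtain n0 :: nat where "\<bar>u x\<bar> \<le> real n0" using real_arch_simple by blast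
      then have "eventually (\<lambda>n. ennreal ((u x)\<^sup>2) = ennreal ((trunc (real n) (u x))\<^sup>2)) sequentially"
        unfolding eventually_sequentially by (intro exI[of _ n0]) (auto simp: trunc_def min_def)
      then have "(\<lambda>n. ennreal ((trunc (real n) (u x))\<^sup>2)) \<longlonglongrightarrow> ennreal ((u x)\<^sup>2)"
        by (rule Lim_transform_eventually[OF tendsto_const])
      then show "ennreal ((u x)\<^sup>2) = liminf (\<lambda>n. ennreal ((trunc (real n) (u x))\<^sup>2))"
        using lim_imp_Liminf by (metis trivial_limit_sequentially)
    qed
    also have "\<dots> \<le> liminf (\<lambda>n. \<integral>\<^sup>+x. ennreal ((trunc (real n) (u x))\<^sup>2) \<partial>lborel)"
      by (rule nn_integral_liminf) measurable
    also have "\<dots> \<le> liminf (\<lambda>n::nat. ennreal ((C * y powr s) powr (1 / (1 - k))))"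
      by (intro Liminf_mono always_eventually allI bound) simp
    also have "\<dots> = ennreal ((C * y powr s) powr (1 / (1 - k)))"
      by (simp add: Liminf_const)
    finally show "(\<integral>\<^sup>+x. ennreal ((u x)\<^sup>2) \<partial>lborel) \<le> ennreal ((C * y powr s) powr (1 / (1 - k)))" .
  qed
qed

section \<open>From Borel to Lebesgue measurable functions\<close>

lemma borel_representative:
  fixes u :: "'a::euclidean_space \<Rightarrow> real"
  assumes \<Omega>: "open \<Omega>" and u: "u \<in> borel_measurable (lebesgue_on \<Omega>)"
  obtains v where "v \<in> borel_measurable borel" "\<And>x. x \<notin> \<Omega> \<Longrightarrow> v x = 0"
    "AE x in lebesgue. v x = indicator \<Omega> x * u x"
proof -
  have "(\<lambda>x. indicator \<Omega> x * u x) \<in> borel_measurable lebesgue"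
    using u \<Omega> by (subst (asm) borel_measurable_restrict_space_iff) (auto simp: mult.commute)
  then obtain v where v: "v \<in> borel_measurable lborel" "AE x in lborel. indicator \<Omega> x * u x = v x"
    using completion_ex_borel_measurable_real by blast
  show ?thesis
  proof (rule that[of "\<lambda>x. indicator \<Omega> x * v x"])
    have "\<Omega> \<in> sets borel" using \<Omega> by simp
    then show "(\<lambda>x. indicator \<Omega> x * v x) \<in> borel_measurable borel" using v(1) by simp
    show "AE x in lebesgue. indicator \<Omega> x * v x = indicator \<Omega> x * u x"
      using AE_completion[OF v(2)] by eventually_elim (auto simp: indicator_def)
  qed simp
qed

lemma abs_le_1_plus_powr: "1 \<le> r \<Longrightarrow> 0 \<le> a \<Longrightarrow> a \<le> 1 + a powr r" for a r :: real
  using powr_mono[of 1 r a] by (cases "a \<le> 1") (auto intro: order_trans[of _ 1])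

text \<open>Extension by 0 and passage to Borel representatives reduce the claim to the previous
  lemma; the extension need not have a weak gradient across the boundary, as only bumps inside
  \<open>\<Omega>\<close> are tested. The explicit dependence on \<open>y\<close> later turns
  smallness of the modulars into smallness in the mean square.\<close>

theorem Sobolev_L2:
  fixes \<Omega> :: "(real^'n) set"
  assumes N: "CARD('n) \<ge> 2" and \<Omega>: "bounded_lipschitz_domain \<Omega>"
  shows "\<exists>C s t. C > 0 \<and> s > 0 \<and> t > 0 \<and> (\<forall>u G y. is_weak_gradient \<Omega> u G \<longrightarrow> y \<ge> 0 \<longrightarrow>
    (\<integral>\<^sup>+x. ennreal ((\<bar>u x\<bar> + norm (G x)) powr (2 * real CARD('n) / (real CARD('n) + 2))) \<partial>lebesgue_on \<Omega>) \<le> ennreal y \<longrightarrow>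
    (\<integral>\<^sup>+x. ennreal ((u x)\<^sup>2) \<partial>lebesgue_on \<Omega>) \<le> ennreal ((C * y powr s) powr t))"
proof -
  let ?r = "2 * real CARD('n) / (real CARD('n) + 2)"
  have r: "1 \<le> ?r" using N by (simp add: field_simps)
  have op: "open \<Omega>" and bd: "bounded \<Omega>" using \<Omega> by (auto simp: bounded_lipschitz_domain_def)
  have \<Omega>m[simp]: "\<Omega> \<in> sets lebesgue" "\<Omega> \<in> sets borel" using op by auto
  obtain C s t where C: "C > 0" "s > 0" "t > 0" and
    b: "\<And>u G y. weak_gradient_pair \<Omega> u G \<Longrightarrow> (\<And>x. x \<notin> \<Omega> \<Longrightarrow> u x = 0) \<Longrightarrow> y \<ge> 0 \<Longrightarrow>
    (\<integral>\<^sup>+x. ennreal ((\<bar>u x\<bar> + norm (G x)) powr ?r) \<partial>lborel) \<le> ennreal y \<Longrightarrow>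
    (\<integral>\<^sup>+x. ennreal ((u x)\<^sup>2) \<partial>lborel) \<le> ennreal ((C * y powr s) powr t)"
    using Sobolev_L2_borel[OF N \<Omega>] by auto
  show ?thesis
  proof (rule exI[of _ C], rule exI[of _ s], rule exI[of _ t], intro conjI C allI impI)
    fix u :: "real^'n \<Rightarrow> real" and G :: "real^'n \<Rightarrow> real^'n" and y :: real
    assume wg: "is_weak_gradient \<Omega> u G" and y0: "y \<ge> 0"
      and y: "(\<integral>\<^sup>+x. ennreal ((\<bar>u x\<bar> + norm (G x)) powr ?r) \<partial>lebesgue_on \<Omega>) \<le> ennreal y"
    have um: "u \<in> borel_measurable (lebesgue_on \<Omega>)" and Gm: "G \<in> borel_measurable (lebesgue_on \<Omega>)"
      using wg by (auto simp: is_weak_gradient_def)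
    obtain v where v[measurable]: "v \<in> borel_measurable borel" and v0: "\<And>x. x \<notin> \<Omega> \<Longrightarrow> v x = 0"
      and vu: "AE x in lebesgue. v x = indicator \<Omega> x * u x"
      using borel_representative[OF op um] by metis
    have "\<forall>i. \<exists>g. g \<in> borel_measurable borel \<and> (\<forall>x. x \<notin> \<Omega> \<longrightarrow> g x = 0) \<and>
      (AE x in lebesgue. g x = indicator \<Omega> x * G x $ i)"
    proof
      fix i
      have "(\<lambda>x. G x $ i) \<in> borel_measurable (lebesgue_on \<Omega>)"
        using borel_measurable_continuous_on[OF linear_continuous_on[OF bounded_linear_vec_nth] Gm] .
      from borel_representative[OF op this] show "\<exists>g. g \<in> borel_measurable borel \<and> (\<forall>x. x \<notin> \<Omega> \<longrightarrow> g x = 0) \<and>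
        (AE x in lebesgue. g x = indicator \<Omega> x * G x $ i)" by metis
    qed
    then obtain g where gm: "\<And>i. g i \<in> borel_measurable borel" and g0: "\<And>i x. x \<notin> \<Omega> \<Longrightarrow> g i x = 0"
      and gG: "\<And>i. AE x in lebesgue. g i x = indicator \<Omega> x * G x $ i"
      unfolding choice_iff by blast
    define H where "H x = (\<chi> i. g i x)" for x
    have H[measurable]: "H \<in> borel_measurable borel"
    proof (subst borel_measurable_euclidean_space, intro ballI)
      fix b :: "real^'n" assume "b \<in> Basis"
      then obtain k where "b = axis k 1" by (auto simp: Basis_vec_def)
      then show "(\<lambda>x. H x \<bullet> b) \<in> borel_measurable borel"
        using gm by (simp add: cart_eq_inner_axis[symmetric] H_def)
    qed
    have "AE x in lebesgue. \<forall>i. g i x = indicator \<Omega> x * G x $ i" unfolding AE_all_countable using gG by blast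
    then have HG: "AE x in lebesgue. H x = indicator \<Omega> x *\<^sub>R G x"
      by eventually_elim (simp add: H_def vec_eq_iff)
    \<comment> \<open>Integrands vanishing at \<open>(0, 0)\<close> do not see the extension by
      0.\<close>
    have nn: "(\<integral>\<^sup>+x. \<phi> (v x) (H x) \<partial>lborel) = (\<integral>\<^sup>+x. \<phi> (u x) (G x) \<partial>lebesgue_on \<Omega>)"
      if "\<phi> 0 0 = (0::ennreal)" for \<phi>
    proof -
      have "(\<integral>\<^sup>+x. \<phi> (v x) (H x) \<partial>lborel) = (\<integral>\<^sup>+x. \<phi> (v x) (H x) \<partial>lebesgue)"
        by (simp add: nn_integral_completion)
      also have "\<dots> = (\<integral>\<^sup>+x. \<phi> (u x) (G x) * indicator \<Omega> x \<partial>lebesgue)"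
      proof (rule nn_integral_cong_AE)
        show "AE x in lebesgue. \<phi> (v x) (H x) = \<phi> (u x) (G x) * indicator \<Omega> x"
          using vu HG by eventually_elim (use that in \<open>auto simp: indicator_def\<close>)
      qed
      also have "\<dots> = (\<integral>\<^sup>+x. \<phi> (u x) (G x) \<partial>lebesgue_on \<Omega>)"
        by (rule nn_integral_restrict_space[symmetric]) simp
      finally show ?thesis .
    qed
    have y': "(\<integral>\<^sup>+x. ennreal ((\<bar>v x\<bar> + norm (H x)) powr ?r) \<partial>lborel) \<le> ennreal y"
      using y nn[of "\<lambda>a b. ennreal ((\<bar>a\<bar> + norm b) powr ?r)"] by simp
    have H0: "H x = 0" if "x \<notin> \<Omega>" for x using g0[OF that] by (simp add: H_def vec_eq_iff)
    \<comment> \<open>On the bounded set \<open>\<Omega>\<close>, integrability of the power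
      \<open>?r\<close> gives integrability through \<open>a \<le> 1 + a powr ?r\<close>.\<close>
    have "(\<integral>\<^sup>+x. ennreal (\<bar>v x\<bar> + norm (H x)) \<partial>lborel)
      \<le> (\<integral>\<^sup>+x. indicator \<Omega> x + ennreal ((\<bar>v x\<bar> + norm (H x)) powr ?r) \<partial>lborel)"
    proof (rule nn_integral_mono)
      fix x
      have "\<bar>v x\<bar> + norm (H x) \<le> 1 + (\<bar>v x\<bar> + norm (H x)) powr ?r"
        by (rule abs_le_1_plus_powr[OF r]) simp
      then have "ennreal (\<bar>v x\<bar> + norm (H x)) \<le> ennreal (1 + (\<bar>v x\<bar> + norm (H x)) powr ?r)" by (rule ennreal_leI)
      also have "\<dots> = 1 + ennreal ((\<bar>v x\<bar> + norm (H x)) powr ?r)" by (subst ennreal_plus) auto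
      finally show "ennreal (\<bar>v x\<bar> + norm (H x)) \<le> indicator \<Omega> x + ennreal ((\<bar>v x\<bar> + norm (H x)) powr ?r)"
        using v0[of x] H0[of x] by (cases "x \<in> \<Omega>") auto
    qed
    also have "\<dots> = emeasure lborel \<Omega> + (\<integral>\<^sup>+x. ennreal ((\<bar>v x\<bar> + norm (H x)) powr ?r) \<partial>lborel)"
      by (subst nn_integral_add) (auto intro!: borel_measurable_indicator)
    also have "\<dots> < \<infinity>"
    proof -
      have "(\<integral>\<^sup>+x. ennreal ((\<bar>v x\<bar> + norm (H x)) powr ?r) \<partial>lborel) < \<infinity>"
        using y' by (rule le_less_trans) simp
      then show ?thesis using emeasure_bounded_finite[OF bd] by simp
    qed
    finally have fin: "(\<integral>\<^sup>+x. ennreal (\<bar>v x\<bar> + norm (H x)) \<partial>lborel) < \<infinity>" .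
    have vi: "integrable lborel v"
      unfolding integrable_iff_bounded
      by (intro conjI le_less_trans[OF nn_integral_mono fin]) (auto intro!: ennreal_leI)
    have Hi: "integrable lborel H"
      unfolding integrable_iff_bounded
      by (intro conjI le_less_trans[OF nn_integral_mono fin]) (auto intro!: ennreal_leI)
    have "weak_gradient_pair \<Omega> v H"
      unfolding weak_gradient_pair_def
    proof (intro conjI vi Hi allI impI)
      fix a b :: "real^'n" and c :: real and i :: 'n
      assume ab: "cbox a b \<subseteq> \<Omega>" and c: "c > 0"
      have \<phi>: "bump c a b \<in> test_functions \<Omega>" by (rule bump_in_test_functions[OF c ab])
      have bm[measurable]: "bump c a b \<in> borel_measurable borel" "partial_deriv i (bump c a b) \<in> borel_measurable borel"
        using test_function_continuous[OF \<phi>] by (auto intro: borel_measurable_continuous_onI)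
      have tr: "(LINT x|lborel. w x * \<psi> x) = (LINT x|lebesgue_on \<Omega>. z x * \<psi> x)"
        if w: "w \<in> borel_measurable borel" and wz: "AE x in lebesgue. w x = indicator \<Omega> x * z x"
          and z: "z \<in> borel_measurable (lebesgue_on \<Omega>)"
          and \<psi>: "\<psi> \<in> borel_measurable borel" for w z \<psi> :: "real^'n \<Rightarrow> real"
      proof -
        have "(LINT x|lborel. w x * \<psi> x) = (LINT x|lebesgue. w x * \<psi> x)"
          using w \<psi> by (subst integral_completion) auto
        also have "\<dots> = (LINT x|lebesgue. indicator \<Omega> x *\<^sub>R (z x * \<psi> x))"
        proof (rule integral_cong_AE)
          show "(\<lambda>x. w x * \<psi> x) \<in> borel_measurable lebesgue"
            using w \<psi> by (intro measurable_completion) auto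
          have "(\<lambda>x. indicator \<Omega> x * z x) \<in> borel_measurable lebesgue"
            using z by (subst (asm) borel_measurable_restrict_space_iff) (auto simp: mult.commute)
          moreover have "\<psi> \<in> borel_measurable lebesgue" using \<psi> by (intro measurable_completion) auto
          ultimately have "(\<lambda>x. (indicator \<Omega> x * z x) * \<psi> x) \<in> borel_measurable lebesgue"
            by (rule borel_measurable_times)
          then show "(\<lambda>x. indicator \<Omega> x *\<^sub>R (z x * \<psi> x)) \<in> borel_measurable lebesgue"
            by (simp add: mult.assoc)
          show "AE x in lebesgue. w x * \<psi> x = indicator \<Omega> x *\<^sub>R (z x * \<psi> x)"
            using wz by eventually_elim simp
        qed
        also have "\<dots> = (LINT x|lebesgue_on \<Omega>. z x * \<psi> x)"
          by (rule integral_restrict_space[symmetric]) simp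
        finally show ?thesis .
      qed
      have Gi: "(\<lambda>x. G x $ i) \<in> borel_measurable (lebesgue_on \<Omega>)"
        using borel_measurable_continuous_on[OF linear_continuous_on[OF bounded_linear_vec_nth] Gm] .
      have "(LINT x|lborel. v x * partial_deriv i (bump c a b) x) = (LINT x|lebesgue_on \<Omega>. u x * partial_deriv i (bump c a b) x)"
        by (rule tr[OF v vu um bm(2)])
      also have "\<dots> = - (LINT x|lebesgue_on \<Omega>. G x $ i * bump c a b x)"
        using wg \<phi> unfolding is_weak_gradient_def by blast
      also have "(LINT x|lebesgue_on \<Omega>. G x $ i * bump c a b x) = (LINT x|lborel. g i x * bump c a b x)"
        by (rule tr[OF gm gG Gi bm(1), symmetric])
      finally show "(LINT x|lborel. v x * partial_deriv i (bump c a b) x) = - (LINT x|lborel. H x $ i * bump c a b x)"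
        by (simp add: H_def)
    qed
    from b[OF this v0 y0 y'] show "(\<integral>\<^sup>+x. ennreal ((u x)\<^sup>2) \<partial>lebesgue_on \<Omega>) \<le> ennreal ((C * y powr s) powr t)"
      using nn[of "\<lambda>a b. ennreal (a\<^sup>2)"] by simp
  qed
qed

section \<open>Modular convergence\<close>

text \<open>Completeness of Lebesgue measure; it is applied to an almost everywhere limit of Riemann
  sums.\<close>

lemma borel_measurable_lebesgue_on_AE:
  fixes f g :: "'a::euclidean_space \<Rightarrow> real"
  assumes \<Omega>: "\<Omega> \<in> sets lebesgue" and f: "f \<in> borel_measurable (lebesgue_on \<Omega>)"
    and eq: "AE x in lebesgue_on \<Omega>. f x = g x"
  shows "g \<in> borel_measurable (lebesgue_on \<Omega>)"
proof -
  have fm: "(\<lambda>x. indicator \<Omega> x * f x) \<in> borel_measurable lebesgue"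
    using f \<Omega> by (subst (asm) borel_measurable_restrict_space_iff) (auto simp: mult.commute)
  have "AE x in lebesgue. x \<in> \<Omega> \<longrightarrow> f x = g x"
    using eq \<Omega> by (subst (asm) AE_restrict_space_iff) auto
  then have "AE x in lebesgue. indicator \<Omega> x * f x = indicator \<Omega> x * g x"
    by eventually_elim (auto simp: indicator_def)
  from borel_measurable_AE[OF fm this] show ?thesis
    using \<Omega> by (subst borel_measurable_restrict_space_iff) (auto simp: mult.commute)
qed

abbreviation modular :: "(real^'n) set \<Rightarrow> (real^'n \<Rightarrow> real) \<Rightarrow> (real^'n \<Rightarrow> real) \<Rightarrow> ennreal" where
  "modular \<Omega> q u \<equiv> \<integral>\<^sup>+x. ennreal (\<bar>u x\<bar> powr q x) \<partial>lebesgue_on \<Omega>"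

lemma powr_add_le:
  fixes a b :: real
  assumes "0 \<le> a" "0 \<le> b" "0 \<le> q" "q \<le> P"
  shows "(a + b) powr q \<le> 2 powr P * (a powr q + b powr q)"
proof -
  have "(a + b) powr q \<le> (2 * max a b) powr q" using assms by (intro powr_mono2) auto
  also have "\<dots> = 2 powr q * (max a b) powr q" using assms by (simp add: powr_mult)
  also have "\<dots> \<le> 2 powr P * (a powr q + b powr q)"
    using assms by (intro mult_mono powr_mono) (auto simp: max_def)
  finally show ?thesis .
qed

text \<open>With the hypothesis in the form of a pointwise bound almost everywhere, one lemma serves
  sums, differences and norms of gradients alike.\<close>

lemma Lvar_add_le:
  assumes u: "u \<in> Lvar \<Omega> q" and v: "v \<in> Lvar \<Omega> q" and w: "w \<in> borel_measurable (lebesgue_on \<Omega>)"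
    and \<Omega>: "\<Omega> \<in> sets lebesgue"
    and q: "\<And>x. x \<in> \<Omega> \<Longrightarrow> 0 \<le> q x \<and> q x \<le> P" "q \<in> borel_measurable (lebesgue_on \<Omega>)"
    and le: "AE x in lebesgue_on \<Omega>. \<bar>w x\<bar> \<le> \<bar>u x\<bar> + \<bar>v x\<bar>"
  shows "w \<in> Lvar \<Omega> q"
    and "modular \<Omega> q w \<le> ennreal (2 powr P) *
      (modular \<Omega> q u + modular \<Omega> q v)"
proof -
  have [measurable]: "u \<in> borel_measurable (lebesgue_on \<Omega>)" "v \<in> borel_measurable (lebesgue_on \<Omega>)"
    "q \<in> borel_measurable (lebesgue_on \<Omega>)" using u v q by (auto simp: Lvar_def)
  have "AE x in lebesgue_on \<Omega>. x \<in> \<Omega>" using AE_space[of "lebesgue_on \<Omega>"] \<Omega> by simp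
  then have "AE x in lebesgue_on \<Omega>. ennreal (\<bar>w x\<bar> powr q x) \<le> ennreal (2 powr P) * (ennreal (\<bar>u x\<bar> powr q x) + ennreal (\<bar>v x\<bar> powr q x))"
    using le
  proof eventually_elim
    case (elim x)
    have "\<bar>w x\<bar> powr q x \<le> (\<bar>u x\<bar> + \<bar>v x\<bar>) powr q x" using elim q by (intro powr_mono2) auto
    also have "\<dots> \<le> 2 powr P * (\<bar>u x\<bar> powr q x + \<bar>v x\<bar> powr q x)" using elim q by (intro powr_add_le) auto
    finally show ?case by (simp add: ennreal_mult[symmetric] ennreal_leI flip: ennreal_plus)
  qed
  then have "modular \<Omega> q w
     \<le> (\<integral>\<^sup>+x. ennreal (2 powr P) * (ennreal (\<bar>u x\<bar> powr q x) + ennreal (\<bar>v x\<bar> powr q x)) \<partial>lebesgue_on \<Omega>)"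
    by (rule nn_integral_mono_AE)
  also have "\<dots> = ennreal (2 powr P) *
      (modular \<Omega> q u + modular \<Omega> q v)"
    by (subst nn_integral_cmult, measurable, subst nn_integral_add) auto
  finally show *: "modular \<Omega> q w \<le> ennreal (2 powr P) *
      (modular \<Omega> q u + modular \<Omega> q v)" .
  also have "\<dots> < \<infinity>" using u v by (auto simp: Lvar_def ennreal_mult_less_top)
  finally show "w \<in> Lvar \<Omega> q" using w by (simp add: Lvar_def)
qed

lemma Lvar_scale:
  assumes u: "u \<in> Lvar \<Omega> q" and \<Omega>: "\<Omega> \<in> sets lebesgue"
    and q: "\<And>x. x \<in> \<Omega> \<Longrightarrow> 0 \<le> q x \<and> q x \<le> P" "q \<in> borel_measurable (lebesgue_on \<Omega>)"
    and c: "0 \<le> c"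
  shows "(\<lambda>x. c * u x) \<in> Lvar \<Omega> q"
proof -
  have [measurable]: "u \<in> borel_measurable (lebesgue_on \<Omega>)"
    "q \<in> borel_measurable (lebesgue_on \<Omega>)" using u q by (auto simp: Lvar_def)
  have "(\<integral>\<^sup>+x. ennreal (\<bar>c * u x\<bar> powr q x) \<partial>lebesgue_on \<Omega>)
      \<le> (\<integral>\<^sup>+x. ennreal ((1 + c) powr P) * ennreal (\<bar>u x\<bar> powr q x) \<partial>lebesgue_on \<Omega>)"
  proof (rule nn_integral_mono)
    fix x assume "x \<in> space (lebesgue_on \<Omega>)"
    then have x: "x \<in> \<Omega>" using \<Omega> by simp
    have "\<bar>c * u x\<bar> powr q x = c powr q x * \<bar>u x\<bar> powr q x" using c by (simp add: abs_mult powr_mult)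
    also have "\<dots> \<le> (1 + c) powr P * \<bar>u x\<bar> powr q x"
    proof (intro mult_right_mono)
      have "c powr q x \<le> (1 + c) powr q x" using c q(1)[OF x] by (intro powr_mono2) auto
      also have "\<dots> \<le> (1 + c) powr P" using c q(1)[OF x] by (intro powr_mono) auto
      finally show "c powr q x \<le> (1 + c) powr P" .
    qed simp
    finally show "ennreal (\<bar>c * u x\<bar> powr q x) \<le> ennreal ((1 + c) powr P) * ennreal (\<bar>u x\<bar> powr q x)"
      by (simp add: ennreal_mult[symmetric] ennreal_leI)
  qed
  also have "\<dots> = ennreal ((1 + c) powr P) * modular \<Omega> q u"
    by (rule nn_integral_cmult) measurable
  also have "\<dots> < \<infinity>" using u by (auto simp: Lvar_def ennreal_mult_less_top)
  finally show ?thesis by (simp add: Lvar_def)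
qed

text \<open>Dividing by \<open>T \<ge> 1\<close> shrinks the modular at least by the factor
  \<open>1 / T\<close>, as \<open>q \<ge> 1\<close>; a \<open>T\<close> one larger than the modular
  suffices. This keeps the norm meaningful, for \<open>Inf\<close> of the empty set would carry no
  information.\<close>

lemma Lvar_norm_set_nonempty:
  assumes u: "u \<in> Lvar \<Omega> q" and \<Omega>: "\<Omega> \<in> sets lebesgue" and q: "\<And>x. x \<in> \<Omega> \<Longrightarrow> 1 \<le> q x"
    "q \<in> borel_measurable (lebesgue_on \<Omega>)"
  shows "{t. t > 0 \<and> (\<integral>\<^sup>+x. ennreal (\<bar>u x / t\<bar> powr q x) \<partial>lebesgue_on \<Omega>) \<le> 1} \<noteq> {}"
proof -
  have [measurable]: "u \<in> borel_measurable (lebesgue_on \<Omega>)" "q \<in> borel_measurable (lebesgue_on \<Omega>)"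
    using u q by (auto simp: Lvar_def)
  obtain R where R: "modular \<Omega> q u = ennreal R" "R \<ge> 0"
    using u by (cases "modular \<Omega> q u") (auto simp: Lvar_def)
  define T where "T = R + 1"
  have T: "T \<ge> 1" using R by (simp add: T_def)
  have "(\<integral>\<^sup>+x. ennreal (\<bar>u x / T\<bar> powr q x) \<partial>lebesgue_on \<Omega>)
    \<le> (\<integral>\<^sup>+x. ennreal (1 / T) * ennreal (\<bar>u x\<bar> powr q x) \<partial>lebesgue_on \<Omega>)"
  proof (rule nn_integral_mono)
    fix x assume "x \<in> space (lebesgue_on \<Omega>)"
    then have x: "x \<in> \<Omega>" using \<Omega> by simp
    have "\<bar>u x / T\<bar> powr q x = (1 / T) powr q x * \<bar>u x\<bar> powr q x" using T by (simp add: powr_divide abs_divide)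
    also have "(1 / T) powr q x \<le> (1 / T) powr 1" using T q(1)[OF x] by (intro powr_mono') auto
    finally have "\<bar>u x / T\<bar> powr q x \<le> 1 / T * \<bar>u x\<bar> powr q x" using T by (simp add: mult_right_mono)
    then show "ennreal (\<bar>u x / T\<bar> powr q x) \<le> ennreal (1 / T) * ennreal (\<bar>u x\<bar> powr q x)"
      using T by (simp add: ennreal_mult[symmetric] ennreal_leI)
  qed
  also have "\<dots> = ennreal (1 / T) * ennreal R" by (subst nn_integral_cmult) (auto simp: R)
  also have "\<dots> \<le> 1" using R T by (simp add: ennreal_mult[symmetric] T_def)
  finally show ?thesis using T by (auto intro!: exI[of _ T])
qed

lemma Lvar_norm_nonneg:
  assumes "u \<in> Lvar \<Omega> q" "\<Omega> \<in> sets lebesgue" "\<And>x. x \<in> \<Omega> \<Longrightarrow> 1 \<le> q x" "q \<in> borel_measurable (lebesgue_on \<Omega>)"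
  shows "0 \<le> Lvar_norm \<Omega> q u"
  unfolding Lvar_norm_def by (rule cInf_greatest[OF Lvar_norm_set_nonempty[OF assms]]) auto

text \<open>Some admissible \<open>s\<close> lies below \<open>t\<close>, and
  \<open>s powr q \<le> s\<close> because \<open>s \<le> 1 \<le> q\<close>. This is the passage from
  norm convergence to modular convergence.\<close>

lemma modular_le_if_Lvar_norm_less:
  assumes u: "u \<in> Lvar \<Omega> q" and \<Omega>: "\<Omega> \<in> sets lebesgue" and q: "\<And>x. x \<in> \<Omega> \<Longrightarrow> 1 \<le> q x"
    "q \<in> borel_measurable (lebesgue_on \<Omega>)" and t: "Lvar_norm \<Omega> q u < t" "t \<le> 1"
  shows "modular \<Omega> q u \<le> ennreal t"
proof -
  have [measurable]: "u \<in> borel_measurable (lebesgue_on \<Omega>)" "q \<in> borel_measurable (lebesgue_on \<Omega>)"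
    using u q by (auto simp: Lvar_def)
  obtain s where s: "s > 0" "(\<integral>\<^sup>+x. ennreal (\<bar>u x / s\<bar> powr q x) \<partial>lebesgue_on \<Omega>) \<le> 1" "s < t"
    using cInf_lessD[OF Lvar_norm_set_nonempty[OF u \<Omega> q] t(1)[unfolded Lvar_norm_def]] by blast
  have "modular \<Omega> q u
    \<le> (\<integral>\<^sup>+x. ennreal s * ennreal (\<bar>u x / s\<bar> powr q x) \<partial>lebesgue_on \<Omega>)"
  proof (rule nn_integral_mono)
    fix x assume "x \<in> space (lebesgue_on \<Omega>)"
    then have x: "x \<in> \<Omega>" using \<Omega> by simp
    have "\<bar>u x\<bar> powr q x = s powr q x * \<bar>u x / s\<bar> powr q x" using s by (simp add: powr_mult[symmetric] abs_divide)
    also have "\<dots> \<le> s powr 1 * \<bar>u x / s\<bar> powr q x"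
      using s t q(1)[OF x] by (intro mult_right_mono powr_mono') auto
    finally show "ennreal (\<bar>u x\<bar> powr q x) \<le> ennreal s * ennreal (\<bar>u x / s\<bar> powr q x)"
      using s by (simp add: ennreal_mult[symmetric] ennreal_leI)
  qed
  also have "\<dots> = ennreal s * (\<integral>\<^sup>+x. ennreal (\<bar>u x / s\<bar> powr q x) \<partial>lebesgue_on \<Omega>)"
    by (rule nn_integral_cmult) measurable
  also have "\<dots> \<le> ennreal s * 1" by (intro mult_left_mono s) auto
  also have "\<dots> \<le> ennreal t" using s by (simp add: ennreal_leI)
  finally show ?thesis .
qed

text \<open>The subsequence principle. It is needed because an integrable majorant is constructed
  only along rapidly converging subsequences.\<close>

lemma tendsto_if_subsequences:
  fixes X :: "nat \<Rightarrow> 'a::metric_space"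
  assumes "\<And>\<sigma>. strict_mono \<sigma> \<Longrightarrow> \<exists>\<tau>. strict_mono (\<tau> :: nat \<Rightarrow> nat) \<and> (\<lambda>k. X (\<sigma> (\<tau> k))) \<longlonglongrightarrow> L"
  shows "X \<longlonglongrightarrow> L"
proof (rule ccontr)
  assume "\<not> X \<longlonglongrightarrow> L"
  then obtain e where e: "e > 0" "\<forall>N. \<exists>n\<ge>N. \<not> dist (X n) L < e"
    unfolding lim_sequentially by blast
  then have "infinite {n. \<not> dist (X n) L < e}" unfolding infinite_nat_iff_unbounded_le by blast
  then have \<sigma>: "strict_mono (enumerate {n. \<not> dist (X n) L < e})"
    "\<And>k. enumerate {n. \<not> dist (X n) L < e} k \<in> {n. \<not> dist (X n) L < e}"
    by (simp_all add: strict_mono_enumerate enumerate_in_set del: mem_Collect_eq)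
  from assms[OF \<sigma>(1)] obtain \<tau> :: "nat \<Rightarrow> nat"
    where "(\<lambda>k. X (enumerate {n. \<not> dist (X n) L < e} (\<tau> k))) \<longlonglongrightarrow> L" by blast
  then have "\<exists>k. dist (X (enumerate {n. \<not> dist (X n) L < e} (\<tau> k))) L < e"
    using e(1) unfolding lim_sequentially by blast
  then show False using \<sigma>(2) by blast
qed

lemma eventually_subsequence:
  assumes "\<And>k. eventually (P k) sequentially"
  obtains \<tau> :: "nat \<Rightarrow> nat" where "strict_mono \<tau>" "\<And>k. P k (\<tau> k)"
proof -
  have "\<exists>f. \<forall>n. P n (f n) \<and> f n < f (Suc n)"
  proof (rule dependent_nat_choice)
    show "\<exists>x. P 0 x" using assms[of 0] by (auto simp: eventually_sequentially)
    fix x n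
    obtain N where "\<forall>m\<ge>N. P (Suc n) m" using assms[of "Suc n"] by (auto simp: eventually_sequentially)
    then show "\<exists>y. P (Suc n) y \<and> x < y" by (intro exI[of _ "max N (Suc x)"]) auto
  qed
  then show ?thesis using that by (auto simp: strict_mono_Suc_iff)
qed

section \<open>Integrals of increasing functions\<close>

lemma
  fixes F :: "real \<Rightarrow> real"
  assumes mono: "\<And>s t. 0 \<le> s \<Longrightarrow> s \<le> t \<Longrightarrow> F s \<le> F t"
  shows set_integrable_increasing: "0 \<le> s \<Longrightarrow> s \<le> t \<Longrightarrow> set_integrable lborel {s..t} F"
    and integral_increasing_bounds: "0 \<le> s \<Longrightarrow> s \<le> t \<Longrightarrow>
      (t - s) * F s \<le> (LINT x:{0..t}|lborel. F x) - (LINT x:{0..s}|lborel. F x) \<and>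
      (LINT x:{0..t}|lborel. F x) - (LINT x:{0..s}|lborel. F x) \<le> (t - s) * F t"
proof -
  \<comment> \<open>\<open>F\<close> is known to increase only on the half-line; freezing it at
    \<open>F 0\<close> to the left makes it monotone everywhere and hence Borel.\<close>
  have "mono (\<lambda>x. F (max 0 x))" by (intro monoI mono) auto
  then have m[measurable]: "(\<lambda>x. F (max 0 x)) \<in> borel_measurable borel" by (rule borel_measurable_mono)
  have int: "set_integrable lborel {s..t} F" if st: "0 \<le> s" "s \<le> t" for s t
    unfolding set_integrable_def
  proof (rule Bochner_Integration.integrable_bound[where f="\<lambda>x. indicator {s..t} x *\<^sub>R (\<bar>F s\<bar> + \<bar>F t\<bar>)"])
    have eq: "(\<lambda>x. indicator {s..t} x *\<^sub>R F x) = (\<lambda>x. indicator {s..t} x *\<^sub>R F (max 0 x))"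
      using st by (auto simp: fun_eq_iff indicator_def max_def)
    show "(\<lambda>x. indicator {s..t} x *\<^sub>R F x) \<in> borel_measurable lborel" unfolding eq by measurable
    show "AE x in lborel. norm (indicator {s..t} x *\<^sub>R F x) \<le> norm (indicator {s..t} x *\<^sub>R (\<bar>F s\<bar> + \<bar>F t\<bar>))"
    proof (rule AE_I2)
      fix x
      show "norm (indicator {s..t} x *\<^sub>R F x) \<le> norm (indicator {s..t} x *\<^sub>R (\<bar>F s\<bar> + \<bar>F t\<bar>))"
        using mono[of s x] mono[of x t] st by (auto simp: indicator_def)
    qed
    show "integrable lborel (\<lambda>x. indicator {s..t} x *\<^sub>R (\<bar>F s\<bar> + \<bar>F t\<bar>))"
      by (intro integrable_scaleR_left integrable_real_indicator) (auto simp: emeasure_lborel_Icc_eq)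
  qed
  then show "0 \<le> s \<Longrightarrow> s \<le> t \<Longrightarrow> set_integrable lborel {s..t} F" .
  assume st: "0 \<le> s" "s \<le> t"
  have HK: "(LINT x:{s..t}|lborel. F x) = integral {s..t} F" "F integrable_on {s..t}" if "0 \<le> s" "s \<le> t" for s t
    using set_borel_integral_eq_integral[OF int[OF that]] by auto
  have "(LINT x:{0..t}|lborel. F x) - (LINT x:{0..s}|lborel. F x) = integral {s..t} F"
    using Henstock_Kurzweil_Integration.integral_combine[OF st HK(2)] HK st by simp
  moreover have "(t - s) * F s \<le> integral {s..t} F"
    using integral_le[of "\<lambda>_. F s" "{s..t}" F] HK(2)[OF st] mono st integrable_const_ivl[of "F s" s t] by simp
  moreover have "integral {s..t} F \<le> (t - s) * F t"
    using integral_le[of F "{s..t}" "\<lambda>_. F t"] HK(2)[OF st] mono st integrable_const_ivl[of "F t" s t] by simp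
  ultimately show "(t - s) * F s \<le> (LINT x:{0..t}|lborel. F x) - (LINT x:{0..s}|lborel. F x) \<and>
      (LINT x:{0..t}|lborel. F x) - (LINT x:{0..s}|lborel. F x) \<le> (t - s) * F t" by simp
qed

text \<open>An increasing function is integrable on bounded intervals, and its indefinite integral
  is continuous. For almost every \<open>x\<close> this will give pointwise convergence of the
  energy densities.\<close>

lemma continuous_on_integral_increasing:
  fixes F :: "real \<Rightarrow> real"
  assumes mono: "\<And>s t. 0 \<le> s \<Longrightarrow> s \<le> t \<Longrightarrow> F s \<le> F t"
  shows "continuous_on {0..} (\<lambda>s. LINT x:{0..s}|lborel. F x)"
proof -
  have "continuous (at s within {0..}) (\<lambda>s. LINT x:{0..s}|lborel. F x)" if s: "s \<in> {0..}" for s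
  proof -
    have "F integrable_on {0..s + 1}"
      using set_borel_integral_eq_integral(1)[OF set_integrable_increasing[where F=F and s=0 and t="s + 1", OF mono]] s by auto
    then have "continuous_on {0..s + 1} (\<lambda>x. integral {0..x} F)" by (rule indefinite_integral_continuous_1)
    then have "continuous_on {0..s + 1} (\<lambda>x. LINT x:{0..x}|lborel. F x)"
      by (rule continuous_on_eq) (use set_borel_integral_eq_integral(2)[OF set_integrable_increasing[where F=F and s=0, OF mono]] in auto)
    then have "continuous (at s within {0..s + 1}) (\<lambda>x. LINT x:{0..x}|lborel. F x)"
      using s by (simp add: continuous_on_eq_continuous_within)
    moreover have "at s within {0..s + 1} = at s within {0..}"
      by (rule at_within_nhd[of s "{..<s + 1}"]) auto
    ultimately show ?thesis by (simp add: continuous_within)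
  qed
  then show ?thesis by (simp add: continuous_on_eq_continuous_within)
qed

lemma set_lebesgue_integral_singleton:
  fixes F :: "real \<Rightarrow> real"
  shows "(LINT x:{a}|lborel. F x) = 0"
  unfolding set_lebesgue_integral_def
  by (rule integral_eq_zero_AE, rule eventually_mono[OF AE_lborel_singleton[of a]]) auto

text \<open>The integral lies between the lower and the upper sums, whose difference telescopes to
  \<open>m (F m - F 0) / n\<close>. The sums involve \<open>F\<close> only at fixed multiples of
  \<open>m\<close>, which later gives measurability in a parameter.\<close>

lemma Riemann_sums_increasing:
  fixes F :: "real \<Rightarrow> real"
  assumes mono: "\<And>s t. 0 \<le> s \<Longrightarrow> s \<le> t \<Longrightarrow> F s \<le> F t" and m: "0 \<le> m"
  shows "(\<lambda>n. \<Sum>k<n. m / real n * F (real k / real n * m)) \<longlonglongrightarrow> (LINT x:{0..m}|lborel. F x)"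
proof -
  let ?a = "\<lambda>s. LINT x:{0..s}|lborel. F x"
  have "\<bar>(\<Sum>k<n. m / real n * F (real k / real n * m)) - ?a m\<bar> \<le> (m * (F m - F 0)) / real n" if n: "n > 0" for n
  proof -
    define p where "p k = real k / real n * m" for k
    have p0: "p 0 = 0" and pn: "p n = m" using n by (auto simp: p_def)
    have d: "p (Suc k) - p k = m / real n" for k by (simp add: p_def add_divide_distrib distrib_right)
    have "0 \<le> m / real n" using m by simp
    then have p: "0 \<le> p k" "p k \<le> p (Suc k)" for k
      using m d[of k] by (simp add: p_def, linarith)
    note b = integral_increasing_bounds[where F=F, OF mono p, unfolded d]
    have "?a m = (\<Sum>k<n. ?a (p (Suc k)) - ?a (p k))"
      by (subst sum_lessThan_telescope) (simp add: p0 pn set_lebesgue_integral_singleton)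
    moreover have "(\<Sum>k<n. m / real n * F (p k)) \<le> (\<Sum>k<n. ?a (p (Suc k)) - ?a (p k))"
      using b by (intro sum_mono) auto
    moreover have "(\<Sum>k<n. ?a (p (Suc k)) - ?a (p k)) \<le> (\<Sum>k<n. m / real n * F (p (Suc k)))"
      using b by (intro sum_mono) auto
    moreover have "(\<Sum>k<n. m / real n * F (p (Suc k))) - (\<Sum>k<n. m / real n * F (p k)) = (m * (F m - F 0)) / real n"
    proof -
      have "(\<Sum>k<n. m / real n * F (p (Suc k))) - (\<Sum>k<n. m / real n * F (p k))
        = m / real n * (\<Sum>k<n. F (p (Suc k)) - F (p k))"
        by (simp only: sum_distrib_left right_diff_distrib sum_subtractf)
      also have "(\<Sum>k<n. F (p (Suc k)) - F (p k)) = F m - F 0"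
        by (subst sum_lessThan_telescope) (simp add: p0 pn)
      finally show ?thesis by simp
    qed
    ultimately show ?thesis unfolding p_def by linarith
  qed
  then have "\<forall>\<^sub>F n in sequentially. norm ((\<Sum>k<n. m / real n * F (real k / real n * m)) - ?a m) \<le> (m * (F m - F 0)) / real n"
    unfolding eventually_sequentially by (intro exI[of _ 1]) auto
  moreover have "(\<lambda>n. (m * (F m - F 0)) / real n) \<longlonglongrightarrow> 0"
    by (rule lim_const_over_n)
  ultimately have "(\<lambda>n. (\<Sum>k<n. m / real n * F (real k / real n * m)) - ?a m) \<longlonglongrightarrow> 0"
    by (rule Lim_null_comparison)
  then show ?thesis by (simp add: LIM_zero_iff)
qed

text \<open>The distance \<open>exp (- C / \<epsilon>)\<close> is where the logarithmic bound falls
  to \<open>\<epsilon>\<close>.\<close>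

lemma log_hoelder_imp_continuous:
  assumes "log_hoelder_on S p"
  shows "continuous_on S p"
proof -
  obtain C where C: "C > 0" "\<And>x y. x \<in> S \<Longrightarrow> y \<in> S \<Longrightarrow> 0 < norm (x - y) \<Longrightarrow> norm (x - y) < 1/2 \<Longrightarrow>
    \<bar>p x - p y\<bar> \<le> C / (- ln (norm (x - y)))"
    using assms unfolding log_hoelder_on_def by blast
  show ?thesis
    unfolding continuous_on_iff
  proof (intro ballI allI impI)
    fix x and \<epsilon> :: real assume x: "x \<in> S" and \<epsilon>: "\<epsilon> > 0"
    have "dist (p y) (p x) < \<epsilon>" if y: "y \<in> S" and d: "dist y x < min (1/2) (exp (- C / \<epsilon>))" for y
    proof (cases "y = x")
      case False
      then have n: "0 < norm (y - x)" "norm (y - x) < 1/2" "norm (y - x) < exp (- C / \<epsilon>)"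
        using d by (auto simp: dist_norm)
      have "ln (norm (y - x)) < ln (exp (- C / \<epsilon>))" using n(1,3) by (subst ln_less_cancel_iff) auto
      then have "ln (norm (y - x)) < - C / \<epsilon>" by simp
      then have l: "C / \<epsilon> < - ln (norm (y - x))" by simp
      then have "0 < - ln (norm (y - x))" using C(1) \<epsilon> by (meson divide_pos_pos less_trans)
      then have "C / (- ln (norm (y - x))) < \<epsilon>" using l \<epsilon> by (simp add: field_simps)
      then show ?thesis using C(2)[OF y x n(1,2)] by (simp add: dist_real_def)
    qed (use \<epsilon> in simp)
    then show "\<exists>d>0. \<forall>x'\<in>S. dist x' x < d \<longrightarrow> dist (p x') (p x) < \<epsilon>"
      by (intro exI[of _ "min (1/2) (exp (- C / \<epsilon>))"]) auto
  qed
qed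

text \<open>Young's inequality with constants 1. The two terms on the right coincide for
  \<open>b = a powr (p - 1)\<close>, and on either side of this threshold one of them alone
  dominates the product.\<close>

lemma mult_le_powr_add_powr_conjugate:
  fixes a b p :: real
  assumes "0 \<le> a" "0 \<le> b" "1 < p"
  shows "a * b \<le> a powr p + b powr (p / (p - 1))"
proof (cases "a = 0 \<or> b = 0")
  case False
  then have a: "a > 0" and b: "b > 0" using assms by auto
  show ?thesis
  proof (cases "b \<le> a powr (p - 1)")
    case True
    then have "a * b \<le> a * a powr (p - 1)" using a by simp
    also have "\<dots> = a powr p" using a powr_add[of a 1 "p - 1"] by simp
    finally show ?thesis by (simp add: add_increasing2)
  next
    case F: False
    then have "(a powr (p - 1)) powr (1 / (p - 1)) \<le> b powr (1 / (p - 1))"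
      using assms by (intro powr_mono2) auto
    then have "a \<le> b powr (1 / (p - 1))" using a assms by (simp add: powr_powr)
    then have "a * b \<le> b powr (1 / (p - 1)) * b" by (rule mult_right_mono) (use b in simp)
    also have "\<dots> = b powr (1 / (p - 1) + 1)" using b powr_add[of b "1 / (p - 1)" 1] by simp
    also have "1 / (p - 1) + 1 = p / (p - 1)" using assms by (simp add: field_simps)
    finally show ?thesis by (simp add: add_increasing)
  qed
qed (use assms in auto)

section \<open>The energy density as a function of the norm of the gradient\<close>

lemma Phi_mono:
  assumes pos: "\<And>s. s > 0 \<Longrightarrow> \<Psi> x s > 0" and mono: "strict_mono_on {0<..} (\<lambda>s. \<Psi> x s * s)"
    and st: "0 \<le> s" "s \<le> t"
  shows "Phi \<Psi> x s \<le> Phi \<Psi> x t"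
proof (cases "s = 0")
  case True
  then show ?thesis using pos[of t] st by (auto simp: Phi_def less_imp_le)
next
  case False
  then have "\<Psi> x s * s \<le> \<Psi> x t * t"
    using strict_mono_onD[OF mono, of s t] st by (cases "s = t") (auto intro: less_imp_le)
  then show ?thesis using False st by (simp add: Phi_def)
qed

lemma Phi_nonneg:
  assumes "\<And>s. s > 0 \<Longrightarrow> \<Psi> x s > 0"
  shows "0 \<le> Phi \<Psi> x s"
  using assms[of "\<bar>s\<bar>"] by (auto simp: Phi_def less_imp_le)

definition A_rad :: "(real ^ 'n \<Rightarrow> real \<Rightarrow> real) \<Rightarrow> real ^ 'n \<Rightarrow> real \<Rightarrow> real" where
  "A_rad \<Psi> x s = (LINT t:{0..s}|lborel. Phi \<Psi> x t)"

lemma A_fun_eq_A_rad: "A_fun \<Psi> x \<xi> = A_rad \<Psi> x (norm \<xi>)"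
  by (simp add: A_fun_def A_rad_def)

lemma A_rad_bounds:
  assumes pos: "\<And>s. s > 0 \<Longrightarrow> \<Psi> x s > 0" and mono: "strict_mono_on {0<..} (\<lambda>s. \<Psi> x s * s)"
    and st: "0 \<le> s" "s \<le> t"
  shows "0 \<le> A_rad \<Psi> x s" "A_rad \<Psi> x s \<le> t * Phi \<Psi> x t"
proof -
  have b: "(b - a) * Phi \<Psi> x a \<le> A_rad \<Psi> x b - A_rad \<Psi> x a \<and> A_rad \<Psi> x b - A_rad \<Psi> x a \<le> (b - a) * Phi \<Psi> x b"
    if "0 \<le> a" "a \<le> b" for a b
    unfolding A_rad_def
    by (rule integral_increasing_bounds[where F="Phi \<Psi> x", OF Phi_mono[where \<Psi>=\<Psi> and x=x, OF pos mono]]) (use that in auto)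
  have nn: "0 \<le> (b - a) * Phi \<Psi> x a" if "a \<le> b" for a b
    using that Phi_nonneg[of \<Psi> x, OF pos] by simp
  have "A_rad \<Psi> x 0 = 0"
    by (simp add: A_rad_def set_lebesgue_integral_singleton)
  then show "0 \<le> A_rad \<Psi> x s" "A_rad \<Psi> x s \<le> t * Phi \<Psi> x t"
    using b[of 0 s] b[of s t] b[of 0 t] nn[of 0 s] nn[of s t] st by auto
qed

text \<open>\<open>growth\<close> acts twice: it makes \<open>x \<mapsto> Phi \<Psi> x (v x)\<close>
  measurable, and it makes the majorant of the energy densities integrable.\<close>

locale growth_setting =
  fixes \<Omega> :: "(real^'n) set" and p :: "real^'n \<Rightarrow> real" and P :: real and \<Psi> :: "real^'n \<Rightarrow> real \<Rightarrow> real"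
  assumes op: "open \<Omega>" and pm: "p \<in> borel_measurable (lebesgue_on \<Omega>)"
    and p1: "\<And>x. x \<in> \<Omega> \<Longrightarrow> 1 < p x" and pP: "\<And>x. x \<in> \<Omega> \<Longrightarrow> p x \<le> P"
    and Psi_pos: "\<And>x s. x \<in> \<Omega> \<Longrightarrow> s > 0 \<Longrightarrow> \<Psi> x s > 0"
    and Psi_mono: "AE x in lebesgue_on \<Omega>. strict_mono_on {0<..} (\<lambda>s. \<Psi> x s * s)"
    and growth: "\<And>v. v \<in> Lvar \<Omega> p \<Longrightarrow> (\<lambda>x. Phi \<Psi> x (v x)) \<in> Lvar \<Omega> (\<lambda>x. p x / (p x - 1))"
begin

lemma \<Omega>_lebesgue: "\<Omega> \<in> sets lebesgue"
  using op by simp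

lemma AE_regular: "AE x in lebesgue_on \<Omega>. x \<in> \<Omega> \<and> strict_mono_on {0<..} (\<lambda>s. \<Psi> x s * s)"
  using AE_space[of "lebesgue_on \<Omega>"] Psi_mono by eventually_elim (use \<Omega>_lebesgue in simp)

lemma p_bounds: "x \<in> \<Omega> \<Longrightarrow> 0 \<le> p x \<and> p x \<le> P"
  using p1[of x] pP[of x] by auto

text \<open>\<open>growth\<close> applied to the multiples \<open>k / n * w\<close> makes every
  Riemann sum of the energy measurable. Their limit equals the energy where \<open>Psi_mono\<close>
  holds, and completeness of Lebesgue measure covers the remaining null set.\<close>

lemma A_rad_measurable:
  assumes w: "w \<in> Lvar \<Omega> p" "\<And>x. 0 \<le> w x"
  shows "(\<lambda>x. A_rad \<Psi> x (w x)) \<in> borel_measurable (lebesgue_on \<Omega>)"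
proof -
  define R where "R n x = (\<Sum>k<n. w x / real n * Phi \<Psi> x (real k / real n * w x))" for n x
  have wm[measurable]: "w \<in> borel_measurable (lebesgue_on \<Omega>)" using w by (simp add: Lvar_def)
  have "(\<lambda>x. Phi \<Psi> x (real k / real n * w x)) \<in> borel_measurable (lebesgue_on \<Omega>)" for k n :: nat
    using growth[OF Lvar_scale[OF w(1) \<Omega>_lebesgue p_bounds pm, of "real k / real n"]] by (simp add: Lvar_def)
  then have "R n \<in> borel_measurable (lebesgue_on \<Omega>)" for n
    unfolding R_def[abs_def] by measurable
  then have m: "(\<lambda>x. lim (\<lambda>n. R n x)) \<in> borel_measurable (lebesgue_on \<Omega>)"
    by (rule borel_measurable_lim_metric)
  have "AE x in lebesgue_on \<Omega>. lim (\<lambda>n. R n x) = A_rad \<Psi> x (w x)"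
    using AE_regular
  proof eventually_elim
    case (elim x)
    have "(\<lambda>n. R n x) \<longlonglongrightarrow> A_rad \<Psi> x (w x)"
      unfolding R_def A_rad_def
      by (rule Riemann_sums_increasing[OF Phi_mono w(2)]) (use elim Psi_pos in auto)
    then show ?case by (rule limI)
  qed
  from borel_measurable_lebesgue_on_AE[OF \<Omega>_lebesgue m this] show ?thesis .
qed

text \<open>The majorant \<open>h\<close> is built as in the completeness proof for spaces of
  integrable functions. The point is that it belongs to \<open>Lvar \<Omega> p\<close>, so that
  \<open>growth\<close> applies to it.\<close>

lemma A_rad_integral_tendsto:
  assumes v: "v \<in> Lvar \<Omega> p" "\<And>x. 0 \<le> v x" and vs: "\<And>n. vs n \<in> Lvar \<Omega> p" "\<And>n x. 0 \<le> vs n x"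
    and d: "\<And>n. d n \<in> Lvar \<Omega> p" "\<And>n. AE x in lebesgue_on \<Omega>. \<bar>vs n x - v x\<bar> \<le> \<bar>d n x\<bar>"
    and conv: "\<And>t. t > 0 \<Longrightarrow> eventually (\<lambda>n. modular \<Omega> p (d n) \<le> ennreal t) sequentially"
  shows "(\<lambda>n. LINT x|lebesgue_on \<Omega>. A_rad \<Psi> x (vs n x)) \<longlonglongrightarrow> (LINT x|lebesgue_on \<Omega>. A_rad \<Psi> x (v x))"
proof (rule tendsto_if_subsequences)
  fix \<sigma> :: "nat \<Rightarrow> nat" assume \<sigma>: "strict_mono \<sigma>"
  \<comment> \<open>Geometric thresholds make the modulars along the subsequence summable.\<close>
  have "eventually (\<lambda>n. modular \<Omega> p (d (\<sigma> n)) \<le> ennreal ((1/2) ^ k)) sequentially" for k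
    using eventually_compose_filterlim[OF conv filterlim_subseq[OF \<sigma>], of "(1/2) ^ k"] by simp
  then obtain \<tau> where \<tau>: "strict_mono \<tau>"
    and \<tau>d: "\<And>k. modular \<Omega> p (d (\<sigma> (\<tau> k))) \<le> ennreal ((1/2) ^ k)"
    by (rule eventually_subsequence[where P="\<lambda>k n. modular \<Omega> p (d (\<sigma> n)) \<le> ennreal ((1/2) ^ k)"]) auto
  define e where "e k = d (\<sigma> (\<tau> k))" for k
  have [measurable]: "v \<in> borel_measurable (lebesgue_on \<Omega>)" "e k \<in> borel_measurable (lebesgue_on \<Omega>)"
    "p \<in> borel_measurable (lebesgue_on \<Omega>)" for k
    using v d pm by (auto simp: Lvar_def e_def)
  have sumfin: "(\<integral>\<^sup>+x. (\<Sum>k. ennreal (\<bar>e k x\<bar> powr p x)) \<partial>lebesgue_on \<Omega>) < \<infinity>"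
  proof -
    have "(\<integral>\<^sup>+x. (\<Sum>k. ennreal (\<bar>e k x\<bar> powr p x)) \<partial>lebesgue_on \<Omega>) = (\<Sum>k. \<integral>\<^sup>+x. ennreal (\<bar>e k x\<bar> powr p x) \<partial>lebesgue_on \<Omega>)"
      by (rule nn_integral_suminf) measurable
    also have "\<dots> \<le> (\<Sum>k. ennreal ((1/2) ^ k))"
      using \<tau>d unfolding e_def by (intro suminf_le) auto
    also have "\<dots> = ennreal (\<Sum>k. (1/2) ^ k)" by (intro suminf_ennreal2 summable_geometric) auto
    also have "\<dots> < \<infinity>" by simp
    finally show ?thesis .
  qed
  \<comment> \<open>Where the series diverges this real sum carries no information; that happens
    only on a null set.\<close>
  define S where "S x = (\<Sum>k. \<bar>e k x\<bar> powr p x)" for x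
  have Sm[measurable]: "S \<in> borel_measurable (lebesgue_on \<Omega>)" unfolding S_def[abs_def] by measurable
  have "AE x in lebesgue_on \<Omega>. (\<Sum>k. ennreal (\<bar>e k x\<bar> powr p x)) \<noteq> \<infinity>"
    using sumfin by (intro nn_integral_PInf_AE) auto
  then have AEs: "AE x in lebesgue_on \<Omega>. summable (\<lambda>k. \<bar>e k x\<bar> powr p x)"
    by eventually_elim (auto intro: summable_suminf_not_top)
  define h where "h x = v x + \<bar>S x powr (1 / p x)\<bar>" for x
  have h0: "0 \<le> h x" for x using v(2)[of x] by (simp add: h_def)
  have hm[measurable]: "h \<in> borel_measurable (lebesgue_on \<Omega>)" unfolding h_def[abs_def] by measurable
  have SL: "(\<lambda>x. S x powr (1 / p x)) \<in> Lvar \<Omega> p"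
  proof -
    have "(\<integral>\<^sup>+x. ennreal (\<bar>S x powr (1 / p x)\<bar> powr p x) \<partial>lebesgue_on \<Omega>)
      \<le> (\<integral>\<^sup>+x. (\<Sum>k. ennreal (\<bar>e k x\<bar> powr p x)) \<partial>lebesgue_on \<Omega>)"
    proof (rule nn_integral_mono_AE)
      show "AE x in lebesgue_on \<Omega>. ennreal (\<bar>S x powr (1 / p x)\<bar> powr p x) \<le> (\<Sum>k. ennreal (\<bar>e k x\<bar> powr p x))"
        using AEs AE_regular
      proof eventually_elim
        case (elim x)
        then have "S x \<ge> 0" unfolding S_def by (intro suminf_nonneg) auto
        then have "\<bar>S x powr (1 / p x)\<bar> powr p x = S x" using p1[of x] elim by (simp add: powr_powr)
        also have "ennreal (S x) = (\<Sum>k. ennreal (\<bar>e k x\<bar> powr p x))"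
          unfolding S_def using elim by (intro suminf_ennreal2[symmetric]) auto
        finally show ?case by simp
      qed
    qed
    also have "\<dots> < \<infinity>" by (rule sumfin)
    finally show ?thesis by (simp add: Lvar_def)
  qed
  have hL: "h \<in> Lvar \<Omega> p"
    by (rule Lvar_add_le(1)[OF v(1) SL hm \<Omega>_lebesgue p_bounds pm])
      (simp_all only: h_def, rule AE_I2, rule order_trans[OF abs_triangle_ineq], simp)
  have \<Phi>L: "(\<lambda>x. Phi \<Psi> x (h x)) \<in> Lvar \<Omega> (\<lambda>x. p x / (p x - 1))" by (rule growth[OF hL])
  have \<Phi>m[measurable]: "(\<lambda>x. Phi \<Psi> x (h x)) \<in> borel_measurable (lebesgue_on \<Omega>)"
    using \<Phi>L by (simp add: Lvar_def)
  have wint: "integrable (lebesgue_on \<Omega>) (\<lambda>x. h x * Phi \<Psi> x (h x))"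
    unfolding integrable_iff_bounded
  proof
    have "(\<integral>\<^sup>+x. ennreal (norm (h x * Phi \<Psi> x (h x))) \<partial>lebesgue_on \<Omega>)
      \<le> (\<integral>\<^sup>+x. ennreal (\<bar>h x\<bar> powr p x) + ennreal (\<bar>Phi \<Psi> x (h x)\<bar> powr (p x / (p x - 1))) \<partial>lebesgue_on \<Omega>)"
    proof (rule nn_integral_mono)
      fix x assume "x \<in> space (lebesgue_on \<Omega>)"
      then have x: "x \<in> \<Omega>" using \<Omega>_lebesgue by simp
      have "norm (h x * Phi \<Psi> x (h x)) \<le> \<bar>h x\<bar> powr p x + \<bar>Phi \<Psi> x (h x)\<bar> powr (p x / (p x - 1))"
        using mult_le_powr_add_powr_conjugate[of "\<bar>h x\<bar>" "\<bar>Phi \<Psi> x (h x)\<bar>" "p x"] p1[OF x] by (simp add: abs_mult)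
      then show "ennreal (norm (h x * Phi \<Psi> x (h x))) \<le> ennreal (\<bar>h x\<bar> powr p x) + ennreal (\<bar>Phi \<Psi> x (h x)\<bar> powr (p x / (p x - 1)))"
        by (simp add: ennreal_leI flip: ennreal_plus)
    qed
    also have "\<dots> = modular \<Omega> p h + (\<integral>\<^sup>+x. ennreal (\<bar>Phi \<Psi> x (h x)\<bar> powr (p x / (p x - 1))) \<partial>lebesgue_on \<Omega>)"
      by (rule nn_integral_add) measurable
    also have "\<dots> < \<infinity>" using hL \<Phi>L by (simp add: Lvar_def)
    finally show "(\<integral>\<^sup>+x. ennreal (norm (h x * Phi \<Psi> x (h x))) \<partial>lebesgue_on \<Omega>) < \<infinity>" .
  qed measurable
  have AEd: "AE x in lebesgue_on \<Omega>. \<forall>k. \<bar>vs (\<sigma> (\<tau> k)) x - v x\<bar> \<le> \<bar>e k x\<bar>"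
    unfolding AE_all_countable e_def using d(2) by blast
  have "(\<lambda>k. LINT x|lebesgue_on \<Omega>. A_rad \<Psi> x (vs (\<sigma> (\<tau> k)) x)) \<longlonglongrightarrow> (LINT x|lebesgue_on \<Omega>. A_rad \<Psi> x (v x))"
  proof (rule integral_dominated_convergence[OF _ _ wint])
    show "(\<lambda>x. A_rad \<Psi> x (v x)) \<in> borel_measurable (lebesgue_on \<Omega>)" by (rule A_rad_measurable[OF v])
    show "(\<lambda>x. A_rad \<Psi> x (vs (\<sigma> (\<tau> k)) x)) \<in> borel_measurable (lebesgue_on \<Omega>)" for k by (rule A_rad_measurable[OF vs])
    show "AE x in lebesgue_on \<Omega>. (\<lambda>k. A_rad \<Psi> x (vs (\<sigma> (\<tau> k)) x)) \<longlonglongrightarrow> A_rad \<Psi> x (v x)"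
      using AEd AEs AE_regular
    proof eventually_elim
      case (elim x)
      then have x: "x \<in> \<Omega>" and px: "p x > 1" using p1 by auto
      \<comment> \<open>Terms of a convergent series tend to 0, so the summability that provides the
        majorant also yields pointwise convergence.\<close>
      have "(\<lambda>k. \<bar>e k x\<bar> powr p x) \<longlonglongrightarrow> 0" using elim(2) by (rule summable_LIMSEQ_zero)
      then have "(\<lambda>k. (\<bar>e k x\<bar> powr p x) powr (1 / p x)) \<longlonglongrightarrow> 0 powr (1 / p x)"
        using px by (intro tendsto_powr' tendsto_const) auto
      then have "(\<lambda>k. \<bar>e k x\<bar>) \<longlonglongrightarrow> 0" using px by (simp add: powr_powr)
      then have "(\<lambda>k. vs (\<sigma> (\<tau> k)) x - v x) \<longlonglongrightarrow> 0"
        by (rule Lim_null_comparison[rotated]) (use elim(1) in auto)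
      then have lim: "(\<lambda>k. vs (\<sigma> (\<tau> k)) x) \<longlonglongrightarrow> v x" by (simp add: LIM_zero_iff)
      have "continuous_on {0..} (A_rad \<Psi> x)"
        unfolding A_rad_def[abs_def]
        by (rule continuous_on_integral_increasing[OF Phi_mono]) (use elim Psi_pos x in auto)
      from continuous_on_tendsto_compose[OF this lim] show "(\<lambda>k. A_rad \<Psi> x (vs (\<sigma> (\<tau> k)) x)) \<longlonglongrightarrow> A_rad \<Psi> x (v x)"
        using v(2) vs(2) by auto
    qed
    show "AE x in lebesgue_on \<Omega>. norm (A_rad \<Psi> x (vs (\<sigma> (\<tau> k)) x)) \<le> h x * Phi \<Psi> x (h x)" for k
      using AEd AEs AE_regular
    proof eventually_elim
      case (elim x)
      then have x: "x \<in> \<Omega>" and px: "p x > 1" using p1 by auto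
      have "\<bar>e k x\<bar> powr p x = (\<Sum>j\<in>{k}. \<bar>e j x\<bar> powr p x)" by simp
      also have "\<dots> \<le> S x" unfolding S_def by (rule sum_le_suminf[OF elim(2)]) auto
      finally have "(\<bar>e k x\<bar> powr p x) powr (1 / p x) \<le> S x powr (1 / p x)" using px by (intro powr_mono2) auto
      then have "\<bar>e k x\<bar> \<le> S x powr (1 / p x)" using px by (simp add: powr_powr)
      moreover have "\<bar>vs (\<sigma> (\<tau> k)) x - v x\<bar> \<le> \<bar>e k x\<bar>" using elim(1) by blast
      ultimately have le: "vs (\<sigma> (\<tau> k)) x \<le> h x" unfolding h_def by linarith
      show ?case
        using A_rad_bounds[where \<Psi>=\<Psi> and x=x, OF Psi_pos[OF x] _ vs(2) le] elim(3) by auto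
    qed
  qed
  then show "\<exists>\<tau>. strict_mono \<tau> \<and> (\<lambda>k. LINT x|lebesgue_on \<Omega>. A_rad \<Psi> x (vs (\<sigma> (\<tau> k)) x)) \<longlonglongrightarrow> (LINT x|lebesgue_on \<Omega>. A_rad \<Psi> x (v x))"
    using \<tau> by blast
qed

end

section \<open>Convergence of the functional\<close>

text \<open>The values are split at height \<open>\<eta>\<close>: below it
  \<open>\<bar>a x\<bar> powr r \<le> \<eta>\<close> because \<open>\<eta> \<le> 1 \<le> r\<close>;
  above it, passing from \<open>r\<close> to \<open>p x\<close> costs at most the factor
  \<open>\<eta> powr (- P)\<close>. A split at height 1 would leave the measure of
  \<open>\<Omega>\<close> as an error; here a small \<open>\<eta>\<close> is fixed first, and then a
  small modular makes the second term small.\<close>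

lemma modular_lower_exponent:
  assumes a[measurable]: "a \<in> borel_measurable (lebesgue_on \<Omega>)" and pm[measurable]: "p \<in> borel_measurable (lebesgue_on \<Omega>)"
    and \<Omega>: "\<Omega> \<in> sets lebesgue" and r: "1 \<le> r" and p: "\<And>x. x \<in> \<Omega> \<Longrightarrow> r \<le> p x \<and> p x \<le> P"
    and \<eta>: "0 < \<eta>" "\<eta> \<le> 1"
  shows "(\<integral>\<^sup>+x. ennreal (\<bar>a x\<bar> powr r) \<partial>lebesgue_on \<Omega>)
    \<le> ennreal \<eta> * emeasure lebesgue \<Omega> + ennreal (\<eta> powr (- P)) * modular \<Omega> p a"
proof -
  have "(\<integral>\<^sup>+x. ennreal (\<bar>a x\<bar> powr r) \<partial>lebesgue_on \<Omega>)
    \<le> (\<integral>\<^sup>+x. ennreal \<eta> + ennreal (\<eta> powr (- P)) * ennreal (\<bar>a x\<bar> powr p x) \<partial>lebesgue_on \<Omega>)"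
  proof (rule nn_integral_mono)
    fix x assume "x \<in> space (lebesgue_on \<Omega>)"
    then have x: "x \<in> \<Omega>" using \<Omega> by simp
    have "\<bar>a x\<bar> powr r \<le> \<eta> + \<eta> powr (- P) * \<bar>a x\<bar> powr p x"
    proof (cases "\<bar>a x\<bar> \<le> \<eta>")
      case True
      have "\<bar>a x\<bar> powr r \<le> \<eta> powr r" using True r by (intro powr_mono2) auto
      also have "\<dots> \<le> \<eta> powr 1" using \<eta> r by (intro powr_mono') auto
      also have "\<dots> \<le> \<eta> + \<eta> powr (- P) * \<bar>a x\<bar> powr p x" using \<eta> by simp
      finally show ?thesis .
    next
      case False
      then have a0: "\<bar>a x\<bar> > 0" using \<eta> by linarith
      have "\<bar>a x\<bar> powr r = \<bar>a x\<bar> powr (r - p x) * \<bar>a x\<bar> powr p x" using a0 by (simp add: powr_add[symmetric])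
      also have "\<bar>a x\<bar> powr (r - p x) \<le> \<eta> powr (r - p x)"
        using False \<eta> p[OF x] by (intro powr_mono2') auto
      also have "\<eta> powr (r - p x) \<le> \<eta> powr (- P)" using \<eta> r p[OF x] by (intro powr_mono') auto
      finally have "\<bar>a x\<bar> powr r \<le> \<eta> powr (- P) * \<bar>a x\<bar> powr p x" by (simp add: mult_right_mono)
      then show ?thesis using \<eta> by simp
    qed
    then show "ennreal (\<bar>a x\<bar> powr r) \<le> ennreal \<eta> + ennreal (\<eta> powr (- P)) * ennreal (\<bar>a x\<bar> powr p x)"
      using \<eta> by (simp add: ennreal_mult[symmetric] ennreal_leI flip: ennreal_plus)
  qed
  also have "\<dots> = (\<integral>\<^sup>+x. ennreal \<eta> \<partial>lebesgue_on \<Omega>) + (\<integral>\<^sup>+x. ennreal (\<eta> powr (- P)) * ennreal (\<bar>a x\<bar> powr p x) \<partial>lebesgue_on \<Omega>)"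
    by (rule nn_integral_add) measurable
  also have "(\<integral>\<^sup>+x. ennreal (\<eta> powr (- P)) * ennreal (\<bar>a x\<bar> powr p x) \<partial>lebesgue_on \<Omega>)
    = ennreal (\<eta> powr (- P)) * modular \<Omega> p a"
    by (rule nn_integral_cmult) measurable
  also have "(\<integral>\<^sup>+x. ennreal \<eta> \<partial>lebesgue_on \<Omega>) = ennreal \<eta> * emeasure lebesgue \<Omega>"
    using \<Omega> by (simp add: emeasure_restrict_space)
  finally show ?thesis .
qed

text \<open>Young's inequality with a parameter plays the part of the Cauchy-Schwarz inequality:
  cross terms are bounded by \<open>\<eta> n\<close> times a constant plus
  \<open>D n / \<eta> n\<close>, and \<open>\<eta> n\<close> is chosen so that both parts tend to
  0.\<close>

lemma (in finite_measure) L2_perturbation_tendsto: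
  fixes v g :: "'a \<Rightarrow> real" and d :: "nat \<Rightarrow> 'a \<Rightarrow> real"
  assumes [measurable]: "v \<in> borel_measurable M" "g \<in> borel_measurable M" "\<And>n. d n \<in> borel_measurable M"
    and v: "(\<integral>\<^sup>+x. ennreal ((v x)\<^sup>2) \<partial>M) < \<infinity>" and d: "\<And>n. (\<integral>\<^sup>+x. ennreal ((d n x)\<^sup>2) \<partial>M) < \<infinity>"
    and conv: "\<And>t. t > 0 \<Longrightarrow> eventually (\<lambda>n. (\<integral>\<^sup>+x. ennreal ((d n x)\<^sup>2) \<partial>M) \<le> ennreal t) sequentially"
    and g: "AE x in M. \<bar>g x\<bar> \<le> B" and B: "0 \<le> B"
  shows "(\<lambda>n. LINT x|M. (v x + d n x)\<^sup>2) \<longlonglongrightarrow> (LINT x|M. (v x)\<^sup>2)"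
    and "(\<lambda>n. LINT x|M. g x * (v x + d n x)) \<longlonglongrightarrow> (LINT x|M. g x * v x)"
proof -
  define D where "D n = (LINT x|M. (d n x)\<^sup>2)" for n
  define S where "S = (LINT x|M. (v x)\<^sup>2)"
  define m where "m = measure M (space M)"
  have vi: "integrable M (\<lambda>x. (v x)\<^sup>2)" and di: "integrable M (\<lambda>x. (d n x)\<^sup>2)" for n
    using v d by (simp_all add: integrable_iff_bounded)
  have D0: "0 \<le> D n" for n unfolding D_def by simp
  have D: "D \<longlonglongrightarrow> 0"
  proof (rule tendstoI)
    fix t :: real assume "t > 0"
    then have "eventually (\<lambda>n. (\<integral>\<^sup>+x. ennreal ((d n x)\<^sup>2) \<partial>M) \<le> ennreal (t / 2)) sequentially" by (intro conv) simp
    then show "eventually (\<lambda>n. dist (D n) 0 < t) sequentially"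
    proof eventually_elim
      case (elim n)
      have "ennreal (D n) \<le> ennreal (t / 2)"
        using elim nn_integral_eq_integral[OF di, of n] by (simp add: D_def)
      then have "D n \<le> t / 2" using \<open>t > 0\<close> by (simp add: ennreal_le_iff)
      then show ?case using D0[of n] \<open>t > 0\<close> by simp
    qed
  qed
  \<comment> \<open>Under the root, \<open>D n\<close> gives
    \<open>D n / \<eta> n \<le> \<eta> n\<close>, and \<open>1 / real (Suc n)\<close> keeps
    \<open>\<eta> n\<close> positive even if \<open>D n = 0\<close>.\<close>
  define \<eta> where "\<eta> n = sqrt (D n + 1 / real (Suc n))" for n
  have \<eta>0: "0 < \<eta> n" for n using D0[of n] by (simp add: \<eta>_def add_nonneg_pos)
  have \<eta>D: "D n / \<eta> n \<le> \<eta> n" for n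
  proof -
    have "D n \<le> \<eta> n * \<eta> n" using D0[of n] by (simp add: \<eta>_def)
    then show ?thesis using \<eta>0[of n] by (simp add: field_simps)
  qed
  have "(\<lambda>n. sqrt (D n + 1 / real (Suc n))) \<longlonglongrightarrow> sqrt (0 + 0)"
    by (intro tendsto_intros D LIMSEQ_Suc[OF lim_1_over_n])
  then have \<eta>lim: "\<eta> \<longlonglongrightarrow> 0" by (simp add: \<eta>_def[abs_def])
  have young: "2 * \<bar>a * b\<bar> \<le> \<eta> n * a\<^sup>2 + b\<^sup>2 / \<eta> n" for a b n
  proof -
    have "0 \<le> (\<eta> n * \<bar>a\<bar> - \<bar>b\<bar>)\<^sup>2 / \<eta> n" using \<eta>0[of n] by (simp add: less_imp_le)
    also have "\<dots> = \<eta> n * a\<^sup>2 + b\<^sup>2 / \<eta> n - 2 * \<bar>a * b\<bar>"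
      using \<eta>0[of n] by (simp add: power2_diff abs_mult field_simps power2_eq_square)
    finally show ?thesis by simp
  qed
  have vdi: "integrable M (\<lambda>x. v x * d n x)" for n
  proof (rule Bochner_Integration.integrable_bound)
    show "integrable M (\<lambda>x. \<eta> n * (v x)\<^sup>2 + (d n x)\<^sup>2 / \<eta> n)" using vi di by simp
    show "AE x in M. norm (v x * d n x) \<le> norm (\<eta> n * (v x)\<^sup>2 + (d n x)\<^sup>2 / \<eta> n)"
    proof (rule AE_I2)
      fix x
      show "norm (v x * d n x) \<le> norm (\<eta> n * (v x)\<^sup>2 + (d n x)\<^sup>2 / \<eta> n)"
        using young[of "v x" "d n x" n] abs_ge_zero[of "v x * d n x"] unfolding real_norm_def by linarith
    qed
  qed measurable
  show "(\<lambda>n. LINT x|M. (v x + d n x)\<^sup>2) \<longlonglongrightarrow> (LINT x|M. (v x)\<^sup>2)"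
  proof (rule LIM_zero_cancel, rule Lim_null_comparison)
    show "eventually (\<lambda>n. norm ((LINT x|M. (v x + d n x)\<^sup>2) - (LINT x|M. (v x)\<^sup>2)) \<le> \<eta> n * (S + 1) + D n) sequentially"
    proof (intro always_eventually allI)
      fix n
      have e: "(LINT x|M. (v x + d n x)\<^sup>2) - (LINT x|M. (v x)\<^sup>2) = (LINT x|M. 2 * (v x * d n x) + (d n x)\<^sup>2)"
        using vi di vdi by (simp add: power2_sum mult.assoc)
      have "norm ((LINT x|M. (v x + d n x)\<^sup>2) - (LINT x|M. (v x)\<^sup>2)) \<le> (LINT x|M. \<bar>2 * (v x * d n x) + (d n x)\<^sup>2\<bar>)"
        unfolding e using integral_norm_bound[of M "\<lambda>x. 2 * (v x * d n x) + (d n x)\<^sup>2"] by simp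
      also have "\<dots> \<le> (LINT x|M. \<eta> n * (v x)\<^sup>2 + (d n x)\<^sup>2 / \<eta> n + (d n x)\<^sup>2)"
      proof (rule integral_mono)
        show "integrable M (\<lambda>x. \<bar>2 * (v x * d n x) + (d n x)\<^sup>2\<bar>)"
          using vdi di by (intro integrable_abs Bochner_Integration.integrable_add integrable_mult_right)
        show "integrable M (\<lambda>x. \<eta> n * (v x)\<^sup>2 + (d n x)\<^sup>2 / \<eta> n + (d n x)\<^sup>2)" using vi di by simp
        fix x
        show "\<bar>2 * (v x * d n x) + (d n x)\<^sup>2\<bar> \<le> \<eta> n * (v x)\<^sup>2 + (d n x)\<^sup>2 / \<eta> n + (d n x)\<^sup>2"
          using young[of "v x" "d n x" n] abs_triangle_ineq[of "2 * (v x * d n x)" "(d n x)\<^sup>2"] by (simp add: abs_mult)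
      qed
      also have "\<dots> = \<eta> n * S + D n / \<eta> n + D n" using vi di by (simp add: S_def D_def)
      also have "\<dots> \<le> \<eta> n * (S + 1) + D n" using \<eta>D[of n] by (simp add: distrib_left)
      finally show "norm ((LINT x|M. (v x + d n x)\<^sup>2) - (LINT x|M. (v x)\<^sup>2)) \<le> \<eta> n * (S + 1) + D n" .
    qed
    have "(\<lambda>n. \<eta> n * (S + 1) + D n) \<longlonglongrightarrow> 0 * (S + 1) + 0" by (intro tendsto_intros \<eta>lim D)
    then show "(\<lambda>n. \<eta> n * (S + 1) + D n) \<longlonglongrightarrow> 0" by simp
  qed
  \<comment> \<open>Young's inequality with \<open>a = 1\<close>; the constant on the right is
    integrable because the measure is finite.\<close>
  have small: "\<bar>b\<bar> \<le> \<eta> n + b\<^sup>2 / \<eta> n" for b n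
    using young[of 1 b n] abs_ge_zero[of b] by simp
  have vi1: "integrable M v"
  proof (rule Bochner_Integration.integrable_bound)
    show "integrable M (\<lambda>x. \<eta> 0 + (v x)\<^sup>2 / \<eta> 0)" using vi by simp
    show "AE x in M. norm (v x) \<le> norm (\<eta> 0 + (v x)\<^sup>2 / \<eta> 0)"
    proof (rule AE_I2)
      fix x show "norm (v x) \<le> norm (\<eta> 0 + (v x)\<^sup>2 / \<eta> 0)"
        using small[of "v x" 0] unfolding real_norm_def by linarith
    qed
  qed measurable
  have di1: "integrable M (d n)" for n
  proof (rule Bochner_Integration.integrable_bound)
    show "integrable M (\<lambda>x. \<eta> 0 + (d n x)\<^sup>2 / \<eta> 0)" using di by simp
    show "AE x in M. norm (d n x) \<le> norm (\<eta> 0 + (d n x)\<^sup>2 / \<eta> 0)"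
    proof (rule AE_I2)
      fix x show "norm (d n x) \<le> norm (\<eta> 0 + (d n x)\<^sup>2 / \<eta> 0)"
        using small[of "d n x" 0] unfolding real_norm_def by linarith
    qed
  qed measurable
  have gi: "integrable M (\<lambda>x. g x * w x)" if w: "integrable M w" for w
  proof (rule Bochner_Integration.integrable_bound)
    show "integrable M (\<lambda>x. B * w x)" using w by simp
    show "AE x in M. norm (g x * w x) \<le> norm (B * w x)"
      using g by eventually_elim (use B in \<open>simp add: abs_mult mult_right_mono\<close>)
  qed (use w in measurable)
  show "(\<lambda>n. LINT x|M. g x * (v x + d n x)) \<longlonglongrightarrow> (LINT x|M. g x * v x)"
  proof (rule LIM_zero_cancel, rule Lim_null_comparison)
    show "eventually (\<lambda>n. norm ((LINT x|M. g x * (v x + d n x)) - (LINT x|M. g x * v x)) \<le> B * (\<eta> n * (m + 1))) sequentially"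
    proof (intro always_eventually allI)
      fix n
      have e: "(LINT x|M. g x * (v x + d n x)) - (LINT x|M. g x * v x) = (LINT x|M. g x * d n x)"
        using gi[OF vi1] gi[OF di1] by (simp add: distrib_left)
      have "norm ((LINT x|M. g x * (v x + d n x)) - (LINT x|M. g x * v x)) \<le> (LINT x|M. norm (g x * d n x))"
        unfolding e by (rule integral_norm_bound)
      also have "\<dots> \<le> (LINT x|M. B * (\<eta> n + (d n x)\<^sup>2 / \<eta> n))"
      proof (rule integral_mono_AE)
        show "integrable M (\<lambda>x. norm (g x * d n x))" using gi[OF di1] by (rule integrable_norm)
        show "integrable M (\<lambda>x. B * (\<eta> n + (d n x)\<^sup>2 / \<eta> n))" using di by simp
        show "AE x in M. norm (g x * d n x) \<le> B * (\<eta> n + (d n x)\<^sup>2 / \<eta> n)"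
          using g
        proof eventually_elim
          case (elim x)
          show ?case unfolding real_norm_def abs_mult by (intro mult_mono elim small B) simp
        qed
      qed
      also have "\<dots> = B * (\<eta> n * m + D n / \<eta> n)" using di by (simp add: D_def m_def mult.commute)
      also have "\<dots> \<le> B * (\<eta> n * (m + 1))" using \<eta>D[of n] B by (intro mult_left_mono) (auto simp: distrib_left)
      finally show "norm ((LINT x|M. g x * (v x + d n x)) - (LINT x|M. g x * v x)) \<le> B * (\<eta> n * (m + 1))" .
    qed
    have "(\<lambda>n. B * (\<eta> n * (m + 1))) \<longlonglongrightarrow> B * (0 * (m + 1))" by (intro tendsto_intros \<eta>lim)
    then show "(\<lambda>n. B * (\<eta> n * (m + 1))) \<longlonglongrightarrow> 0" by simp
  qed
qed

theorem lemma6p1: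
  fixes \<Omega> :: "(real ^ 'n) set"
    and p :: "real ^ 'n \<Rightarrow> real"
    and \<Psi> :: "real ^ 'n \<Rightarrow> real \<Rightarrow> real"
    and g V :: "real ^ 'n \<Rightarrow> real"
    and Vs :: "nat \<Rightarrow> real ^ 'n \<Rightarrow> real"
    and \<epsilon> :: "nat \<Rightarrow> real"
    and lam \<delta> \<delta>' :: real
  assumes N: "CARD('n) \<ge> 2"
    and Omega: "bounded_lipschitz_domain \<Omega>"
    and p_gt_1: "\<And>x. x \<in> closure \<Omega> \<Longrightarrow> 1 < p x"
    and p_regular:
      "log_hoelder_on (closure \<Omega>) p \<and>
         (INF x\<in>closure \<Omega>. p x) \<ge> 2 * real CARD('n) / (real CARD('n) + 2)
       \<or> continuous_on (closure \<Omega>) p \<and>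
         (INF x\<in>closure \<Omega>. p x) > 2 * real CARD('n) / (real CARD('n) + 2)"
    and Psi_pos: "\<And>x s. x \<in> closure \<Omega> \<Longrightarrow> s > 0 \<Longrightarrow> \<Psi> x s > 0"
    and Psi_meas: "\<And>s. s > 0 \<Longrightarrow> (\<lambda>x. \<Psi> x s) \<in> borel_measurable (lebesgue_on (closure \<Omega>))"
    and Psi_ac: "AE x in lebesgue_on \<Omega>. locally_abs_continuous_pos (\<Psi> x)"
    and Psi_lim: "\<And>x. x \<in> \<Omega> \<Longrightarrow> ((\<lambda>s. \<Psi> x s * s) \<longlongrightarrow> 0) (at_right 0)"
    and Psi_mono: "AE x in lebesgue_on \<Omega>. strict_mono_on {0<..} (\<lambda>s. \<Psi> x s * s)"
    and Phi_growth: "\<And>v. v \<in> Lvar \<Omega> p \<Longrightarrow>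
      (\<lambda>x. Phi \<Psi> x (v x)) \<in> Lvar \<Omega> (\<lambda>x. p x / (p x - 1))"
    and delta: "\<delta> > 0" "\<delta>' \<ge> 0"
    and coercive: "\<And>v. v \<in> W1var \<Omega> p \<Longrightarrow>
      (LINT x|lebesgue_on \<Omega>. A_fun \<Psi> x (wgrad \<Omega> v x))
        \<ge> \<delta> * (LINT x|lebesgue_on \<Omega>. norm (wgrad \<Omega> v x) powr p x) - \<delta>'"
    and lam: "lam > 0"
    and g: "g \<in> Linfty \<Omega>" "AE x in lebesgue_on \<Omega>. 0 \<le> g x \<and> g x \<le> lam"
    and V: "V \<in> W1var \<Omega> p"
    and Vs: "\<And>n. Vs n \<in> W1var \<Omega> p"
    and conv: "(\<lambda>n. W1var_norm \<Omega> p (\<lambda>x. Vs n x - V x)) \<longlonglongrightarrow> 0"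
    and eps: "\<epsilon> \<longlonglongrightarrow> 0"
  shows "(\<lambda>n. J_fun \<Omega> p \<Psi> g lam (\<epsilon> n) (Vs n)) \<longlonglongrightarrow> J_fun \<Omega> p \<Psi> g lam 0 V"
proof -
  have op: "open \<Omega>" and bd: "bounded \<Omega>" and ne: "\<Omega> \<noteq> {}"
    using Omega by (auto simp: bounded_lipschitz_domain_def)
  have \<Omega>: "\<Omega> \<in> sets lebesgue" using op by simp
  let ?M = "lebesgue_on \<Omega>"
  have cl: "\<Omega> \<subseteq> closure \<Omega>" by (rule closure_subset)
  let ?r = "2 * real CARD('n) / (real CARD('n) + 2)"
  have r1: "1 \<le> ?r" using N by (simp add: field_simps)
  \<comment> \<open>Both alternatives on \<open>p\<close> are reduced to continuity up to the
    boundary and the lower bound \<open>?r\<close>.\<close>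
  have cont: "continuous_on (closure \<Omega>) p" and INF: "?r \<le> (INF x\<in>closure \<Omega>. p x)"
    using p_regular log_hoelder_imp_continuous by auto
  have comp: "compact (closure \<Omega>)" using bd by simp
  have rp: "?r \<le> p x" if "x \<in> \<Omega>" for x
  proof -
    have "bdd_below (p ` closure \<Omega>)" using p_gt_1 by (intro bdd_belowI[of _ 1]) (auto intro: less_imp_le)
    then have "(INF x\<in>closure \<Omega>. p x) \<le> p x" using that cl by (intro cINF_lower) auto
    then show ?thesis using INF by simp
  qed
  have "bounded (p ` closure \<Omega>)"
    by (intro compact_imp_bounded compact_continuous_image cont comp)
  then obtain P where P: "\<And>x. x \<in> closure \<Omega> \<Longrightarrow> \<bar>p x\<bar> \<le> P" by (auto simp: bounded_iff)
  have pP: "p x \<le> P" if "x \<in> \<Omega>" for x using P[of x] that cl by auto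
  have p1: "1 < p x" if "x \<in> \<Omega>" for x using p_gt_1[of x] that cl by auto
  have p1': "1 \<le> p x" if "x \<in> \<Omega>" for x using p1[OF that] by simp
  have p0P: "0 \<le> p x \<and> p x \<le> P" if "x \<in> \<Omega>" for x using p1[OF that] pP[OF that] by simp
  have prP: "?r \<le> p x \<and> p x \<le> P" if "x \<in> \<Omega>" for x using rp[OF that] pP[OF that] by simp
  have pm[measurable]: "p \<in> borel_measurable ?M"
    by (rule continuous_imp_measurable_on_sets_lebesgue[OF continuous_on_subset[OF cont cl] \<Omega>])
  interpret growth_setting \<Omega> p P \<Psi>
    by standard (use op pm p1 pP Psi_pos Psi_mono Phi_growth cl in auto)
  have fin\<Omega>: "emeasure lebesgue \<Omega> < \<infinity>"
    using bounded_set_imp_lmeasurable[OF bd \<Omega>] unfolding fmeasurable_def by blast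
  define m where "m = measure lebesgue \<Omega>"
  have m: "emeasure lebesgue \<Omega> = ennreal m" "0 \<le> m"
    using fin\<Omega> by (auto simp: m_def emeasure_eq_ennreal_measure)
  define G where "G = wgrad \<Omega> V"
  define Gs where "Gs n = wgrad \<Omega> (Vs n)" for n
  define d where "d n x = Vs n x - V x" for n x
  \<comment> \<open>The norm in \<open>conv\<close> is formed with \<open>wgrad\<close> of the
    difference, a choice unrelated to \<open>Gs n\<close> and \<open>G\<close>; \<open>AEG\<close>
    connects them.\<close>
  define Gd where "Gd n = wgrad \<Omega> (d n)" for n
  have wG: "is_weak_gradient \<Omega> V G" and wGs: "is_weak_gradient \<Omega> (Vs n) (Gs n)" for n
    using V Vs wgrad_is_weak_gradient unfolding G_def Gs_def W1var_def by blast+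
  have wd: "is_weak_gradient \<Omega> (d n) (\<lambda>x. Gs n x - G x)" for n
    unfolding d_def by (rule is_weak_gradient_diff[OF op wGs wG])
  have wGd: "is_weak_gradient \<Omega> (d n) (Gd n)" for n
    unfolding Gd_def by (rule wgrad_is_weak_gradient[OF wd])
  have AEG: "AE x in ?M. Gd n x = Gs n x - G x" for n by (rule is_weak_gradient_unique[OF op wGd wd])
  have [measurable]: "V \<in> borel_measurable ?M" "Vs n \<in> borel_measurable ?M" "d n \<in> borel_measurable ?M"
    "G \<in> borel_measurable ?M" "Gs n \<in> borel_measurable ?M" "Gd n \<in> borel_measurable ?M" for n
    using wG wGs wGd by (auto simp: is_weak_gradient_def)
  have VL: "V \<in> Lvar \<Omega> p" "(\<lambda>x. norm (G x)) \<in> Lvar \<Omega> p" and VsL: "Vs n \<in> Lvar \<Omega> p" "(\<lambda>x. norm (Gs n x)) \<in> Lvar \<Omega> p" for n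
    using V Vs by (auto simp: W1var_def G_def Gs_def)
  have dL: "d n \<in> Lvar \<Omega> p" for n
    by (rule Lvar_add_le(1)[OF VsL(1)[of n] VL(1) _ \<Omega> p0P pm]) (auto simp: d_def)
  have GdL: "(\<lambda>x. norm (Gd n x)) \<in> Lvar \<Omega> p" for n
  proof (rule Lvar_add_le(1)[OF VsL(2) VL(2) _ \<Omega> p0P pm])
    show "AE x in ?M. \<bar>norm (Gd n x)\<bar> \<le> \<bar>norm (Gs n x)\<bar> + \<bar>norm (G x)\<bar>"
      using AEG[of n] by eventually_elim (simp add: norm_triangle_ineq4)
  qed measurable
  let ?\<rho> = "modular \<Omega> p"
  have norm0: "0 \<le> Lvar_norm \<Omega> p (d n)" "0 \<le> Lvar_norm \<Omega> p (\<lambda>x. norm (Gd n x))" for n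
    by (rule Lvar_norm_nonneg[OF dL \<Omega> p1' pm] Lvar_norm_nonneg[OF GdL \<Omega> p1' pm]; assumption)+
  have conv': "(\<lambda>n. Lvar_norm \<Omega> p (d n) + Lvar_norm \<Omega> p (\<lambda>x. norm (Gd n x))) \<longlonglongrightarrow> 0"
    using conv by (simp add: W1var_norm_def Gd_def d_def[abs_def])
  have small: "eventually (\<lambda>n. ?\<rho> (d n) \<le> ennreal t \<and> ?\<rho> (\<lambda>x. norm (Gd n x)) \<le> ennreal t) sequentially" if t: "t > 0" for t
  proof -
    \<comment> \<open>The modular is compared with the norm for thresholds up to 1 only, hence the
      minimum.\<close>
    have "eventually (\<lambda>n. Lvar_norm \<Omega> p (d n) + Lvar_norm \<Omega> p (\<lambda>x. norm (Gd n x)) < min t 1) sequentially"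
      using order_tendstoD(2)[OF conv', of "min t 1"] t by simp
    then show ?thesis
    proof eventually_elim
      case (elim n)
      then have "Lvar_norm \<Omega> p (d n) < min t 1" "Lvar_norm \<Omega> p (\<lambda>x. norm (Gd n x)) < min t 1"
        using norm0[of n] by linarith+
      then have "?\<rho> (d n) \<le> ennreal (min t 1)" "?\<rho> (\<lambda>x. norm (Gd n x)) \<le> ennreal (min t 1)"
        using modular_le_if_Lvar_norm_less[OF dL \<Omega> p1' pm] modular_le_if_Lvar_norm_less[OF GdL \<Omega> p1' pm] by auto
      moreover have "ennreal (min t 1) \<le> ennreal t" by (rule ennreal_leI) simp
      ultimately show ?case using order_trans by blast
    qed
  qed
  obtain C s t where C: "C > 0" "s > 0" "t > 0" and
    sob: "\<And>u G y. is_weak_gradient \<Omega> u G \<Longrightarrow> y \<ge> 0 \<Longrightarrow>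
    (\<integral>\<^sup>+x. ennreal ((\<bar>u x\<bar> + norm (G x)) powr ?r) \<partial>?M) \<le> ennreal y \<Longrightarrow>
    (\<integral>\<^sup>+x. ennreal ((u x)\<^sup>2) \<partial>?M) \<le> ennreal ((C * y powr s) powr t)"
    using Sobolev_L2[OF N Omega] by blast
  \<comment> \<open>\<open>\<eta>\<close> stays free: \<open>\<eta> = 1\<close> will give
    finiteness, a small \<open>\<eta>\<close> smallness.\<close>
  have lower: "(\<integral>\<^sup>+x. ennreal ((\<bar>u x\<bar> + norm (H x)) powr ?r) \<partial>?M)
      \<le> ennreal (\<eta> * m) + ennreal (\<eta> powr (- P) * 2 powr P) * (?\<rho> u + ?\<rho> (\<lambda>x. norm (H x)))"
    if u: "u \<in> Lvar \<Omega> p" and H: "(\<lambda>x. norm (H x)) \<in> Lvar \<Omega> p" and \<eta>: "0 < \<eta>" "\<eta> \<le> 1"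
    for u and H :: "real^'n \<Rightarrow> real^'n" and \<eta>
  proof -
    have [measurable]: "u \<in> borel_measurable ?M" "(\<lambda>x. norm (H x)) \<in> borel_measurable ?M" using u H by (auto simp: Lvar_def)
    have w: "(\<lambda>x. \<bar>u x\<bar> + norm (H x)) \<in> borel_measurable ?M" by measurable
    have "(\<integral>\<^sup>+x. ennreal ((\<bar>u x\<bar> + norm (H x)) powr ?r) \<partial>?M)
      \<le> ennreal \<eta> * emeasure lebesgue \<Omega> + ennreal (\<eta> powr (- P)) * ?\<rho> (\<lambda>x. \<bar>u x\<bar> + norm (H x))"
      using modular_lower_exponent[OF w pm \<Omega> r1 prP \<eta>] by simp
    also have "?\<rho> (\<lambda>x. \<bar>u x\<bar> + norm (H x)) \<le> ennreal (2 powr P) * (?\<rho> u + ?\<rho> (\<lambda>x. norm (H x)))"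
      by (rule Lvar_add_le(2)[OF u H w \<Omega> p0P pm]) auto
    also have "ennreal \<eta> * emeasure lebesgue \<Omega> = ennreal (\<eta> * m)" using \<eta> m by (simp add: ennreal_mult)
    finally show ?thesis by (simp add: ennreal_mult mult.assoc mult_left_mono add_left_mono)
  qed
  have L2fin: "(\<integral>\<^sup>+x. ennreal ((u x)\<^sup>2) \<partial>?M) < \<infinity>"
    if wu: "is_weak_gradient \<Omega> u H" and u: "u \<in> Lvar \<Omega> p" and H: "(\<lambda>x. norm (H x)) \<in> Lvar \<Omega> p"
    for u and H :: "real^'n \<Rightarrow> real^'n"
  proof -
    have "ennreal (1 * m) + ennreal (1 powr (- P) * 2 powr P) * (?\<rho> u + ?\<rho> (\<lambda>x. norm (H x))) < \<infinity>"
      using u H by (simp add: Lvar_def ennreal_mult_less_top)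
    from le_less_trans[OF lower[OF u H zero_less_one order_refl] this]
    have "(\<integral>\<^sup>+x. ennreal ((\<bar>u x\<bar> + norm (H x)) powr ?r) \<partial>?M) < \<infinity>" .
    then obtain y where "(\<integral>\<^sup>+x. ennreal ((\<bar>u x\<bar> + norm (H x)) powr ?r) \<partial>?M) = ennreal y" "y \<ge> 0"
      by (cases "\<integral>\<^sup>+x. ennreal ((\<bar>u x\<bar> + norm (H x)) powr ?r) \<partial>?M") auto
    then have "(\<integral>\<^sup>+x. ennreal ((u x)\<^sup>2) \<partial>?M) \<le> ennreal ((C * y powr s) powr t)"
      by (intro sob[OF wu]) auto
    then show ?thesis by (rule le_less_trans) simp
  qed
  have L2small: "eventually (\<lambda>n. (\<integral>\<^sup>+x. ennreal ((d n x)\<^sup>2) \<partial>?M) \<le> ennreal \<tau>) sequentially" if \<tau>: "\<tau> > 0" for \<tau>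
  proof -
    \<comment> \<open>\<open>y\<close> solves \<open>(C * y powr s) powr t = \<tau>\<close>. This
      budget is then divided: one half for the term \<open>\<eta> * m\<close>, one quarter for each
      of the two modulars after multiplication by \<open>K\<close>, which explains the threshold
      \<open>y / (4 * K)\<close>.\<close>
    define y where "y = (\<tau> powr (1 / t) / C) powr (1 / s)"
    have y: "y > 0" using \<tau> C by (simp add: y_def)
    have yt: "(C * y powr s) powr t = \<tau>" using \<tau> C by (simp add: y_def powr_powr)
    define \<eta> where "\<eta> = min 1 (y / (2 * (m + 1)))"
    have \<eta>: "0 < \<eta>" "\<eta> \<le> 1" using y m by (auto simp: \<eta>_def)
    have \<eta>m: "\<eta> * m \<le> y / 2"
    proof -
      have "\<eta> * m \<le> y / (2 * (m + 1)) * m" using m by (intro mult_right_mono) (auto simp: \<eta>_def)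
      also have "\<dots> \<le> y / 2" using y m by (simp add: field_simps)
      finally show ?thesis .
    qed
    define K where "K = \<eta> powr (- P) * 2 powr P"
    have K: "K > 0" using \<eta> by (simp add: K_def)
    have "eventually (\<lambda>n. ?\<rho> (d n) \<le> ennreal (y / (4 * K)) \<and> ?\<rho> (\<lambda>x. norm (Gd n x)) \<le> ennreal (y / (4 * K))) sequentially"
      by (rule small) (use y K in simp)
    then show ?thesis
    proof eventually_elim
      case (elim n)
      have "(\<integral>\<^sup>+x. ennreal ((\<bar>d n x\<bar> + norm (Gd n x)) powr ?r) \<partial>?M)
        \<le> ennreal (\<eta> * m) + ennreal K * (?\<rho> (d n) + ?\<rho> (\<lambda>x. norm (Gd n x)))"
        unfolding K_def by (rule lower[OF dL GdL \<eta>])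
      also have "\<dots> \<le> ennreal (y / 2) + ennreal K * (ennreal (y / (4 * K)) + ennreal (y / (4 * K)))"
        using elim \<eta>m by (intro add_mono mult_left_mono ennreal_leI) auto
      also have "\<dots> = ennreal (y / 2 + K * (y / (4 * K) + y / (4 * K)))"
        using y K by (simp add: ennreal_plus[symmetric] ennreal_mult[symmetric] del: ennreal_plus)
      also have "y / 2 + K * (y / (4 * K) + y / (4 * K)) = y" using K by (simp add: field_simps)
      finally have "(\<integral>\<^sup>+x. ennreal ((\<bar>d n x\<bar> + norm (Gd n x)) powr ?r) \<partial>?M) \<le> ennreal y" .
      from sob[OF wGd _ this] y show ?case by (simp add: yt)
    qed
  qed
  interpret M: finite_measure ?M
    using bounded_set_imp_lmeasurable[OF bd \<Omega>] by (rule finite_measure_lebesgue_on)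
  have gm[measurable]: "g \<in> borel_measurable ?M" using g by (simp add: Linfty_def)
  have gB: "AE x in ?M. \<bar>g x\<bar> \<le> lam" using g(2) by eventually_elim simp
  have Vd: "V x + d n x = Vs n x" for n x by (simp add: d_def)
  have T2: "(\<lambda>n. LINT x|?M. (Vs n x)\<^sup>2) \<longlonglongrightarrow> (LINT x|?M. (V x)\<^sup>2)"
    and T4: "(\<lambda>n. LINT x|?M. g x * Vs n x) \<longlonglongrightarrow> (LINT x|?M. g x * V x)"
    using M.L2_perturbation_tendsto[of V g d lam, OF _ _ _ L2fin[OF wG VL] L2fin[OF wGd dL GdL] L2small gB] lam
    by (simp_all add: Vd)
  have T1: "(\<lambda>n. LINT x|?M. A_fun \<Psi> x (wgrad \<Omega> (Vs n) x)) \<longlonglongrightarrow> (LINT x|?M. A_fun \<Psi> x (wgrad \<Omega> V x))"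
    unfolding A_fun_eq_A_rad G_def[symmetric] Gs_def[symmetric]
  proof (rule A_rad_integral_tendsto[where d="\<lambda>n x. norm (Gd n x)"])
    show "AE x in ?M. \<bar>norm (Gs n x) - norm (G x)\<bar> \<le> \<bar>norm (Gd n x)\<bar>" for n
      using AEG[of n] by eventually_elim (simp add: norm_triangle_ineq3)
    show "eventually (\<lambda>n. ?\<rho> (\<lambda>x. norm (Gd n x)) \<le> ennreal t) sequentially" if "t > 0" for t
      using small[OF that] by eventually_elim simp
  qed (use VL VsL GdL in auto)
  have T3: "(\<lambda>n. \<epsilon> n * (LINT x|?M. \<bar>Vs n x\<bar> powr p x / p x)) \<longlonglongrightarrow> 0"
  proof -
    obtain R where R: "?\<rho> V = ennreal R" "R \<ge> 0" using VL(1) by (cases "?\<rho> V") (auto simp: Lvar_def)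
    \<comment> \<open>The integrals multiplied by \<open>\<epsilon> n\<close> need only stay
      bounded, so closeness of the modulars with threshold 1 suffices.\<close>
    have "eventually (\<lambda>n. norm (LINT x|?M. \<bar>Vs n x\<bar> powr p x / p x) \<le> 2 powr P * (R + 1)) sequentially"
      using small[of 1, simplified]
    proof eventually_elim
      case (elim n)
      have "?\<rho> (Vs n) \<le> ennreal (2 powr P) * (?\<rho> V + ?\<rho> (d n))"
        by (rule Lvar_add_le(2)[OF VL(1) dL _ \<Omega> p0P pm]) (auto simp: d_def)
      also have "\<dots> \<le> ennreal (2 powr P) * (ennreal R + 1)" using elim R by (intro mult_left_mono add_mono) auto
      also have "\<dots> = ennreal (2 powr P * (R + 1))" using R by (simp add: ennreal_mult)
      finally have le: "?\<rho> (Vs n) \<le> ennreal (2 powr P * (R + 1))" .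
      have nn: "0 \<le> \<bar>Vs n x\<bar> powr p x / p x" if "x \<in> \<Omega>" for x using p1[OF that] by simp
      have sp: "space ?M = \<Omega>" using \<Omega> by simp
      have "(LINT x|?M. \<bar>Vs n x\<bar> powr p x / p x) = enn2real (\<integral>\<^sup>+x. ennreal (\<bar>Vs n x\<bar> powr p x / p x) \<partial>?M)"
        by (rule integral_eq_nn_integral) (use nn sp in auto)
      also have "\<dots> \<le> 2 powr P * (R + 1)"
      proof (rule enn2real_leI)
        have "(\<integral>\<^sup>+x. ennreal (\<bar>Vs n x\<bar> powr p x / p x) \<partial>?M) \<le> ?\<rho> (Vs n)"
        proof (intro nn_integral_mono ennreal_leI)
          fix x assume "x \<in> space ?M"
          then have "1 < p x" using p1 sp by auto
          then show "\<bar>Vs n x\<bar> powr p x / p x \<le> \<bar>Vs n x\<bar> powr p x"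
            using mult_left_mono[of 1 "p x" "\<bar>Vs n x\<bar> powr p x"] by (simp add: divide_le_eq)
        qed
        then show "(\<integral>\<^sup>+x. ennreal (\<bar>Vs n x\<bar> powr p x / p x) \<partial>?M) \<le> ennreal (2 powr P * (R + 1))"
          using le by (rule order_trans)
      qed (use R in simp)
      finally have "(LINT x|?M. \<bar>Vs n x\<bar> powr p x / p x) \<le> 2 powr P * (R + 1)" .
      moreover have "0 \<le> (LINT x|?M. \<bar>Vs n x\<bar> powr p x / p x)"
        by (rule Bochner_Integration.integral_nonneg) (use nn sp in auto)
      ultimately show ?case by simp
    qed
    then have "eventually (\<lambda>n. norm (\<epsilon> n * (LINT x|?M. \<bar>Vs n x\<bar> powr p x / p x))
        \<le> \<bar>\<epsilon> n\<bar> * (2 powr P * (R + 1))) sequentially"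
      by eventually_elim (simp add: abs_mult mult_left_mono)
    moreover have "(\<lambda>n. \<bar>\<epsilon> n\<bar> * (2 powr P * (R + 1))) \<longlonglongrightarrow> 0"
      using tendsto_mult_left_zero[OF tendsto_rabs_zero[OF eps]] .
    ultimately show ?thesis by (rule Lim_null_comparison)
  qed
  have "(\<lambda>n. J_fun \<Omega> p \<Psi> g lam (\<epsilon> n) (Vs n)) \<longlonglongrightarrow>
    (LINT x|?M. A_fun \<Psi> x (wgrad \<Omega> V x)) + lam / 2 * (LINT x|?M. (V x)\<^sup>2) + 0 - (LINT x|?M. g x * V x)"
    unfolding J_fun_def by (intro tendsto_intros T1 T2 T3 T4)
  then show ?thesis by (simp add: J_fun_def)
qed

end
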